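(* Let $q,m\in(0,\infty)$. Let $u,w,v$ be weights such that the pair $(u,w)$ is admissible with respect to $(m,q)$. Let $$C=\sup_{h\in\mathfrak M_+}\frac{\left(\int_0^{\infty}\left(\int_t^\infty \left(\int_s^{\infty}h(y)\,dy\right)^m u(s)\,ds\right)^{\frac{q}{m}}w(t)\,dt\right)^{\frac{1}{q}}}{\int_0^{\infty}h(t)v(t)\,dt}.$$ (a) Let $1\le m<\infty$ and $1\le q<\infty$. Then $C\approx\widetilde A_1$, where $$\widetilde A_1=\operatorname*{ess\,sup}_{t\in(0,\infty)}\left(\int_0^t w(s)\left(\int_s^t u(y)\,dy\right)^{\frac qm}ds\right)^{\frac1q}\frac1{v(t)}.$$ (b) Let $1\le m<\infty$ and $0<q<1$. Then $C\approx\widetilde A_2+\widetilde A_3$, where $$\widetilde A_2=\left(\int_0^{\infty}\left(\int_0^t w(s)\,ds\right)^{-q'}w(t)\operatorname*{ess\,sup}_{z\in(t,\infty)}\left(\int_t^z u(y)\,dy\right)^{-\frac{q'}m}v(z)^{q'}\,dt\right)^{-\frac1{q'}}$$ and $$\widetilde A_3=\left(\int_0^{\infty}\left(\int_0^t w(s)\left(\int_s^t u(y)\,dy\right)^{\frac qm}ds\right)^{-q'}w(t)\operatorname*{ess\,sup}_{z\in(t,\infty)}\left(\int_t^z u(y)\,dy\right)^{\frac qm}v(z)^{q'}\,dt\right)^{-\frac1{q'}}.$$ (c) Let $0<m<1$ and $1\le q$. Then $C\approx\widetilde A_1+\widetilde A_4$, where $\widetilde A_1$ is given by the formula in (a) and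 $$\widetilde A_4=\sup_{t\in(0,\infty)}\left(\int_0^t w(s)\,ds\right)^{\frac1q}\left(\int_t^{\infty}\left(\int_t^z u(y)\,dy\right)^{\frac m{1-m}}u(z)\operatorname*{ess\,sup}_{y\in(z,\infty)}v(y)^{-\frac m{1-m}}\,dz\right)^{\frac{1-m}m}.$$ (d) Let $0<m<1$ and $0<q<1$. Then $C\approx\widetilde A_3+\widetilde A_5$, where $\widetilde A_3$ is given by the formula in (b) and $$\widetilde A_5=\left(\int_0^{\infty}\left(\int_0^t w(s)\,ds\right)^{-q'}w(t)\left(\int_t^{\infty}\left(\int_t^z u(y)\,dy\right)^{\frac m{1-m}}u(z)\operatorname*{ess\,sup}_{y\in(z,\infty)}v(y)^{-\frac m{1-m}}\,dz\right)^{-\frac{q'(1-m)}m}dt\right)^{-\frac1{q'}}.$$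
   Context: $\mathfrak M_+$ is the cone of all non-negative measurable functions on $(0,\infty)$. A weight is a measurable non-negative function on $(0,\infty)$. For $q\in(0,1)\cup(1,\infty)$, $q'=\frac{q}{q-1}$; note that $q'<0$ if $q<1$. The pair of weights $(u,w)$ is admissible with respect to $(m,q)$ if the function $$\varphi(t)=\left(\int_0^{t}\left(\int_s^t u(y)\,dy\right)^{\frac{q}{m}}w(s)\,ds\right)^{\frac1q}$$ satisfies $0<\varphi(t)<\infty$ for every $t\in(0,\infty)$. $A\lesssim B$ means $A\le cB$ with a constant $c\in(0,\infty)$ that may depend only on the exponents $m,q$ (not on the weights); $A\approx B$ means $A\lesssim B$ and $B\lesssim A$. All quantities take values in $[0,\infty]$. Conventions: $0\cdot\infty=0$, $\frac00=0$, $a^0=1$ for all $a\in[0,\infty]$ (and, as usual, $0$ to a negative power is $\infty$, $\infty$ to a negative power is $0$). The number $C\in[0,\infty]$ is the optimal (least) constant in the inequality "numerator $\le C\cdot$ denominator" required for all $h\in\mathfrak M_+$. *)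

theory Defs
  imports "HOL-Analysis.Analysis" "HOL-Probability.Essential_Supremum"
begin

text \<open>Real powers on \<open>[0,\<infinity>]\<close>, with \<open>a\<^sup>0 = 1\<close> for every \<open>a\<close>. The remaining conventions
  \<open>0 \<cdot> \<infinity> = 0\<close>, \<open>0 / 0 = 0\<close> and \<open>a / 0 = \<infinity>\<close> for \<open>a \<noteq> 0\<close> are those of \<^typ>\<open>ennreal\<close>.\<close>

definition epowr :: "ennreal \<Rightarrow> real \<Rightarrow> ennreal"  (infixr "epowr" 80) where
  "a epowr p =
     (if p = 0 then 1
      else if a = 0 then (if p > 0 then 0 else \<infinity>)
      else if a = \<infinity> then (if p > 0 then \<infinity> else 0)
      else ennreal (enn2real a powr p))"

definition conj_exp :: "real \<Rightarrow> real" where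
  "conj_exp q = q / (q - 1)"

text \<open>The cone of non-negative Lebesgue measurable functions on \<open>(0,\<infinity>)\<close>, with \<open>\<infinity>\<close> allowed as a
  value. Values at non-positive arguments are never used. Weights are the members of this cone.\<close>

definition Mplus :: "(real \<Rightarrow> ennreal) set" where
  "Mplus = borel_measurable (lebesgue_on {0<..})"

definition integ :: "(real \<Rightarrow> ennreal) \<Rightarrow> real \<Rightarrow> real \<Rightarrow> ennreal" where
  "integ f s t = (\<integral>\<^sup>+ y\<in>{s<..<t}. f y \<partial>lebesgue)"

definition integ_inf :: "(real \<Rightarrow> ennreal) \<Rightarrow> real \<Rightarrow> ennreal" where
  "integ_inf f s = (\<integral>\<^sup>+ y\<in>{s<..}. f y \<partial>lebesgue)"

text \<open>Measurability of \<open>f\<close> on \<open>(a,\<infinity>)\<close> is required for \<^const>\<open>esssup\<close> to have its usual meaning; it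
  holds in all uses below when the weights lie in \<open>Mplus\<close>.\<close>

definition esssup_from :: "real \<Rightarrow> (real \<Rightarrow> ennreal) \<Rightarrow> ennreal" where
  "esssup_from a f = esssup (lebesgue_on {a<..}) f"

definition admissible ::
    "real \<Rightarrow> real \<Rightarrow> (real \<Rightarrow> ennreal) \<Rightarrow> (real \<Rightarrow> ennreal) \<Rightarrow> bool" where
  "admissible m q u w \<longleftrightarrow>
     (\<forall>t>0. let \<phi> = (integ (\<lambda>s. integ u s t epowr (q / m) * w s) 0 t) epowr (1 / q)
            in 0 < \<phi> \<and> \<phi> < \<infinity>)"

definition lhs_norm ::
    "real \<Rightarrow> real \<Rightarrow> (real \<Rightarrow> ennreal) \<Rightarrow> (real \<Rightarrow> ennreal) \<Rightarrow> (real \<Rightarrow> ennreal) \<Rightarrow> ennreal" where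
  "lhs_norm m q u w h =
     (integ_inf (\<lambda>t. (integ_inf (\<lambda>s. integ_inf h s epowr m * u s) t) epowr (q / m) * w t) 0)
       epowr (1 / q)"

definition rhs_norm :: "(real \<Rightarrow> ennreal) \<Rightarrow> (real \<Rightarrow> ennreal) \<Rightarrow> ennreal" where
  "rhs_norm v h = integ_inf (\<lambda>t. h t * v t) 0"

definition opt_const ::
    "real \<Rightarrow> real \<Rightarrow> (real \<Rightarrow> ennreal) \<Rightarrow> (real \<Rightarrow> ennreal) \<Rightarrow> (real \<Rightarrow> ennreal) \<Rightarrow> ennreal" where
  "opt_const m q u w v = (SUP h\<in>Mplus. lhs_norm m q u w h / rhs_norm v h)"

definition A1 ::
    "real \<Rightarrow> real \<Rightarrow> (real \<Rightarrow> ennreal) \<Rightarrow> (real \<Rightarrow> ennreal) \<Rightarrow> (real \<Rightarrow> ennreal) \<Rightarrow> ennreal" where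
  "A1 m q u w v =
     esssup_from 0
       (\<lambda>t. (integ (\<lambda>s. w s * integ u s t epowr (q / m)) 0 t) epowr (1 / q) * (1 / v t))"

definition A2 ::
    "real \<Rightarrow> real \<Rightarrow> (real \<Rightarrow> ennreal) \<Rightarrow> (real \<Rightarrow> ennreal) \<Rightarrow> (real \<Rightarrow> ennreal) \<Rightarrow> ennreal" where
  "A2 m q u w v = (let q' = conj_exp q in
     (integ_inf
       (\<lambda>t. integ w 0 t epowr (- q') * w t *
            esssup_from t (\<lambda>z. integ u t z epowr (- q' / m) * v z epowr q')) 0)
       epowr (- 1 / q'))"

definition A3 ::
    "real \<Rightarrow> real \<Rightarrow> (real \<Rightarrow> ennreal) \<Rightarrow> (real \<Rightarrow> ennreal) \<Rightarrow> (real \<Rightarrow> ennreal) \<Rightarrow> ennreal" where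
  "A3 m q u w v = (let q' = conj_exp q in
     (integ_inf
       (\<lambda>t. (integ (\<lambda>s. w s * integ u s t epowr (q / m)) 0 t) epowr (- q') * w t *
            esssup_from t (\<lambda>z. integ u t z epowr (q / m) * v z epowr q')) 0)
       epowr (- 1 / q'))"

definition A4 ::
    "real \<Rightarrow> real \<Rightarrow> (real \<Rightarrow> ennreal) \<Rightarrow> (real \<Rightarrow> ennreal) \<Rightarrow> (real \<Rightarrow> ennreal) \<Rightarrow> ennreal" where
  "A4 m q u w v =
     (SUP t\<in>{0<..}. integ w 0 t epowr (1 / q) *
        (integ_inf
          (\<lambda>z. integ u t z epowr (m / (1 - m)) * u z *
               esssup_from z (\<lambda>y. v y epowr (- m / (1 - m)))) t)
          epowr ((1 - m) / m))"

definition A5 ::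
    "real \<Rightarrow> real \<Rightarrow> (real \<Rightarrow> ennreal) \<Rightarrow> (real \<Rightarrow> ennreal) \<Rightarrow> (real \<Rightarrow> ennreal) \<Rightarrow> ennreal" where
  "A5 m q u w v = (let q' = conj_exp q in
     (integ_inf
       (\<lambda>t. integ w 0 t epowr (- q') * w t *
            (integ_inf
              (\<lambda>z. integ u t z epowr (m / (1 - m)) * u z *
                   esssup_from z (\<lambda>y. v y epowr (- m / (1 - m)))) t)
              epowr (- (q' * (1 - m)) / m)) 0)
       epowr (- 1 / q'))"

text \<open>\<open>C \<approx> A\<close> for every admissible choice of weights. The constant \<open>c\<close> is chosen before the
  weights, so it depends only on \<open>m\<close> and \<open>q\<close>.\<close>

definition opt_const_equiv ::
    "real \<Rightarrow> real \<Rightarrow>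
     ((real \<Rightarrow> ennreal) \<Rightarrow> (real \<Rightarrow> ennreal) \<Rightarrow> (real \<Rightarrow> ennreal) \<Rightarrow> ennreal) \<Rightarrow> bool" where
  "opt_const_equiv m q A \<longleftrightarrow>
     (\<exists>c::real. c > 0 \<and>
       (\<forall>u\<in>Mplus. \<forall>w\<in>Mplus. \<forall>v\<in>Mplus. admissible m q u w \<longrightarrow>
          opt_const m q u w v \<le> ennreal c * A u w v \<and>
          A u w v \<le> ennreal c * opt_const m q u w v))"

end

theory Submission
  imports Defs "HOL-Probability.Distribution_Functions"
begin

text \<open>Every one of the four characterisations is \<open>C \<approx> A + S\<close>, where \<open>A\<close> (\<open>A1\<close> or \<open>A3\<close>) belongs to a
  Hardy inequality and \<open>S\<close> is built from \<open>B t\<close>, the best constant of the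
  inner inequality \<open>(\<integral>\<^sub>t\<^sup>\<infinity> H\<^sup>m u)\<^sup>1\<^sup>/\<^sup>m \<le> B t \<cdot> \<integral> h v\<close> with \<open>H s = \<integral>\<^sub>s\<^sup>\<infinity> h\<close>: for \<open>q \<ge> 1\<close>,
  \<open>S = sup W\<^sup>1\<^sup>/\<^sup>q B\<close>, which is at most \<open>A1\<close> when \<open>m \<ge> 1\<close>; for \<open>q < 1\<close>, \<open>S\<close> is the weighted integral of
  \<open>W\<^sup>r B\<^sup>r\<close>, \<open>r = q / (1 - q)\<close>. Both ingredients are instances of the Hardy inequality
  \<open>(\<integral> H\<^sup>q d\<mu>)\<^sup>1\<^sup>/\<^sup>q \<le> C \<integral> h v\<close> for an arbitrary measure \<open>\<mu>\<close>: \<open>B\<close> comes from \<open>\<mu> = u\<close> on \<open>(t, \<infinity>)\<close>, and \<open>A\<close>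
  from a purely atomic \<open>\<mu>\<close>. To reduce to them, cut \<open>(0, t 0]\<close> at points where \<open>W\<close> halves. Since the
  weights \<open>W (t k)\<close> decay geometrically, sums over all later blocks are controlled by one block, and on
  one block \<open>H\<close> splits into its value at the right end (the atomic part) and the mass inside the
  block (the part governed by \<open>B\<close>).\<close>

section \<open>Powers and sums in the extended non-negative reals\<close>

text \<open>The measures in the Hardy inequalities may have atoms, so the distribution function
  \<open>\<Phi>\<close> jumps. Differentiation and integration by parts are therefore replaced by a
  cut at half of a mass: the set where a tail, or \<open>\<Phi>\<close>, is at least half of its
  total carries at least half of that total. Most powers of 2 in the constants come from such cuts.
  For q < 1 the exponent r = q / (1 - q) is - q'. As q' < 0, powers of v become positive powers of
  \<open>inverse (v y)\<close>, and sums of suprema over test functions are bounded by selecting one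
  test function per block. Two degeneracies shape the statements. Nothing is known to be finite
  beforehand: recursions are absorbed on partial sums, and each direction of the equivalence is
  proved when its right-hand side is finite. Admissibility does not make W finite either: W t =
  \<infinity> can occur, but then u vanishes almost everywhere beyond t and such t contribute
  nothing.\<close>

lemma ennreal_trichotomy:
  fixes a :: ennreal
  obtains "a = 0" | "a = \<infinity>" | x where "0 < x" "a = ennreal x"
  by (metis ennreal_cases ennreal_0 infinity_ennreal_def less_eq_real_def)

lemma epowr_ennreal: "0 < x \<Longrightarrow> ennreal x epowr p = ennreal (x powr p)"
  by (auto simp: epowr_def)

lemma epowr_zero_right [simp]: "a epowr 0 = 1"
  by (simp add: epowr_def)

lemma epowr_zero [simp]: "0 < p \<Longrightarrow> 0 epowr p = 0"
  by (simp add: epowr_def)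

lemma epowr_top [simp]: "0 < p \<Longrightarrow> top epowr p = top"
  by (simp add: epowr_def)

lemma epowr_one [simp]: "1 epowr p = 1"
  using epowr_ennreal[of 1 p] by simp

lemma epowr_one_right [simp]: "a epowr 1 = a"
  by (cases a rule: ennreal_trichotomy) (auto simp: epowr_ennreal epowr_def)

lemma epowr_epowr: "(a epowr p) epowr s = a epowr (p * s)"
  by (cases a rule: ennreal_trichotomy)
     (auto simp: epowr_ennreal epowr_def powr_powr zero_less_mult_iff)

text \<open>The sign condition matters only at 0 * \<infinity>: for p < 0 the left side is
  \<infinity> there and the right side is 0.\<close>

lemma epowr_mult: "0 \<le> p \<Longrightarrow> (a * b) epowr p = a epowr p * b epowr p"
proof (cases "p = 0")
  case False
  moreover assume "0 \<le> p"
  ultimately have p: "0 < p" by simp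
  show ?thesis
    by (cases a rule: ennreal_trichotomy; cases b rule: ennreal_trichotomy)
       (auto simp: p epowr_ennreal ennreal_mult[symmetric] powr_mult ennreal_mult_top ennreal_top_mult)
qed simp

lemma epowr_add: "0 \<le> p \<Longrightarrow> 0 \<le> s \<Longrightarrow> a epowr (p + s) = a epowr p * a epowr s"
proof (cases "p = 0 \<or> s = 0")
  case False
  moreover assume "0 \<le> p" "0 \<le> s"
  ultimately have p: "0 < p" "0 < s" by auto
  show ?thesis
    by (cases a rule: ennreal_trichotomy)
       (use p in \<open>auto simp: epowr_ennreal ennreal_mult[symmetric] powr_add add_pos_pos\<close>)
qed auto

text \<open>Valid at 0 and \<infinity> as well, since \<open>inverse\<close> exchanges them. The
  negative powers of v in the statement are removed through this identity.\<close>

lemma epowr_minus: "a epowr (- p) = inverse (a epowr p)"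
  by (cases a rule: ennreal_trichotomy)
     (auto simp: epowr_ennreal epowr_def powr_minus inverse_ennreal)

lemma inverse_epowr: "inverse a epowr p = inverse (a epowr p)"
  by (cases a rule: ennreal_trichotomy)
     (auto simp: epowr_ennreal epowr_def inverse_ennreal inverse_powr)

lemma epowr_mono: "a \<le> b \<Longrightarrow> 0 \<le> p \<Longrightarrow> a epowr p \<le> b epowr p"
  by (cases a rule: ennreal_trichotomy; cases b rule: ennreal_trichotomy; cases "p = 0")
     (auto simp: epowr_ennreal powr_mono2 top_unique ennreal_le_iff2)

lemma epowr_le_iff: "0 < p \<Longrightarrow> a epowr p \<le> b epowr p \<longleftrightarrow> a \<le> b"
  using epowr_mono[of a b p] epowr_mono[of "a epowr p" "b epowr p" "1 / p"]
  by (auto simp: epowr_epowr)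

lemma epowr_le_swap: "0 < p \<Longrightarrow> a epowr p \<le> b \<longleftrightarrow> a \<le> b epowr (1 / p)"
  using epowr_le_iff[of p a "b epowr (1 / p)"] by (simp add: epowr_epowr)

lemma epowr_eq_0_iff [simp]: "0 < p \<Longrightarrow> a epowr p = 0 \<longleftrightarrow> a = 0"
  by (cases a rule: ennreal_trichotomy) (auto simp: epowr_ennreal)

lemma epowr_eq_top_iff [simp]: "0 < p \<Longrightarrow> a epowr p = top \<longleftrightarrow> a = top"
  by (cases a rule: ennreal_trichotomy) (auto simp: epowr_ennreal)

lemma epowr_less_top [simp]: "0 \<le> p \<Longrightarrow> a < top \<Longrightarrow> a epowr p < top"
  by (cases "p = 0") (auto simp: less_top[symmetric])

lemma epowr_measurable [measurable]: "(\<lambda>x. x epowr p) \<in> borel_measurable borel"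
  unfolding epowr_def by measurable

text \<open>Comparison with twice the maximum is crude, but serves p < 1 and p \<ge> 1
  alike.\<close>

lemma epowr_add_le:
  assumes "0 \<le> p" shows "(a + b) epowr p \<le> 2 epowr p * (a epowr p + b epowr p)"
proof -
  have "(a + b) epowr p \<le> (2 * max a b) epowr p"
    by (intro epowr_mono assms) (auto simp: mult_2 intro!: add_mono)
  also have "\<dots> = 2 epowr p * (max a b) epowr p" by (rule epowr_mult[OF assms])
  also have "\<dots> \<le> 2 epowr p * (a epowr p + b epowr p)"
    by (intro mult_left_mono) (auto simp: max_def)
  finally show ?thesis .
qed

lemma epowr_superadd:
  assumes "1 \<le> p" shows "a epowr p + b epowr p \<le> (a + b) epowr p"
proof -
  have *: "c epowr p = c * c epowr (p - 1)" for c
    using epowr_add[of 1 "p - 1" c] assms by simp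
  have "a epowr p + b epowr p \<le> a * (a + b) epowr (p - 1) + b * (a + b) epowr (p - 1)"
    unfolding *[of a] *[of b] using assms by (intro add_mono mult_left_mono epowr_mono) auto
  then show ?thesis unfolding *[of "a + b"] by (simp add: distrib_right)
qed

lemma epowr_sum_le:
  assumes "1 \<le> p" "finite F" shows "(\<Sum>i\<in>F. a i epowr p) \<le> (\<Sum>i\<in>F. a i) epowr p"
  using assms(2)
proof (induction F rule: finite_induct)
  case (insert x F)
  then have "(\<Sum>i\<in>insert x F. a i epowr p) \<le> a x epowr p + (\<Sum>i\<in>F. a i) epowr p"
    by (simp add: add_left_mono)
  also have "\<dots> \<le> (\<Sum>i\<in>insert x F. a i) epowr p"
    using insert epowr_superadd[OF assms(1)] by simp
  finally show ?case .
qed (use assms in auto)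

text \<open>The embedding of l^1 into l^p. For q \<ge> 1 the contributions of separate blocks are
  added in this way.\<close>

lemma epowr_suminf_le:
  assumes "1 \<le> p" shows "(\<Sum>i. a i epowr p) \<le> (\<Sum>i. a i :: ennreal) epowr p"
proof (rule suminf_le_const)
  show "summable (\<lambda>i. a i epowr p)" by simp
  fix n show "(\<Sum>i<n. a i epowr p) \<le> (\<Sum>i. a i) epowr p"
    using assms by (intro order_trans[OF epowr_sum_le epowr_mono]) (auto intro: sum_le_suminf)
qed

lemma ennreal_inverse_mono': "x \<le> y \<Longrightarrow> inverse y \<le> inverse (x::ennreal)"
  by (cases x rule: ennreal_trichotomy; cases y rule: ennreal_trichotomy)
     (auto simp: inverse_ennreal ennreal_le_iff2 top_unique)

lemma ennreal_le_cancel_right: "c < top \<Longrightarrow> a + c \<le> b + c \<Longrightarrow> a \<le> (b::ennreal)"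
  by (metis add.commute ennreal_add_left_cancel_le infinity_ennreal_def less_irrefl)

lemma ennreal_inverse_inverse [simp]: "inverse (inverse x) = (x::ennreal)"
  using one_divide_one_divide_ennreal[of x] by (simp add: divide_ennreal_def)

lemma SUP_epowr_le:
  fixes f :: "'a \<Rightarrow> ennreal"
  assumes "0 < r" shows "(SUP x\<in>A. f x) epowr r \<le> (SUP x\<in>A. f x epowr r)"
proof -
  have "(SUP x\<in>A. f x) \<le> (SUP x\<in>A. f x epowr r) epowr (1 / r)"
    using assms by (intro SUP_least) (auto simp: epowr_le_swap[symmetric] intro: SUP_upper)
  then show ?thesis using assms by (simp add: epowr_le_swap)
qed

lemma ennreal_inverse_mult_self:
  fixes a :: ennreal assumes "0 < a" "a < top" shows "inverse a * a = 1"
  using assms by (cases a rule: ennreal_trichotomy) (auto simp: inverse_ennreal ennreal_mult[symmetric])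

lemma ennreal_mult_inverse_le: "a * inverse a \<le> (1::ennreal)"
  by (cases a rule: ennreal_trichotomy) (auto simp: inverse_ennreal ennreal_mult[symmetric])

text \<open>Applied with a an essential supremum: a strictly smaller level l is exceeded on a set of
  positive measure, where a test function can be placed.\<close>

lemma mult_le_if_less_le:
  fixes a c K :: ennreal
  assumes "\<And>l. l < a \<Longrightarrow> c * l \<le> K" shows "c * a \<le> K"
proof -
  have "c * a = c * (SUP l\<in>{..<a}. l)" by simp
  also have "\<dots> = (SUP l\<in>{..<a}. c * l)" by (rule SUP_mult_left_ennreal)
  also have "\<dots> \<le> K" using assms by (intro SUP_least) auto
  finally show ?thesis .
qed

text \<open>Replacing both factors by their maximum decouples them; a mixed term of two neighbouring
  atoms becomes two diagonal terms.\<close>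

lemma mult_epowr_le_max:
  assumes "0 \<le> r" shows "a * b epowr r \<le> a epowr (1 + r) + b epowr (1 + r)"
proof -
  have "a * b epowr r \<le> max a b * max a b epowr r"
    using assms by (intro mult_mono epowr_mono) auto
  also have "\<dots> = max a b epowr (1 + r)" using assms by (simp add: epowr_add)
  also have "\<dots> \<le> a epowr (1 + r) + b epowr (1 + r)" by (simp add: max_def)
  finally show ?thesis .
qed

lemma epowr_add3_le:
  assumes "0 \<le> r" shows "(a + b + c) epowr r \<le> 4 epowr r * (a epowr r + b epowr r + c epowr r)"
proof -
  have "(a + b + c) epowr r \<le> 2 epowr r * ((a + b) epowr r + c epowr r)" by (rule epowr_add_le[OF assms])
  also have "\<dots> \<le> 2 epowr r * (2 epowr r * (a epowr r + b epowr r) + 2 epowr r * c epowr r)"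
  proof (intro mult_left_mono add_mono epowr_add_le assms)
    show "c epowr r \<le> 2 epowr r * c epowr r"
      using mult_right_mono[OF epowr_mono[of 1 2 r], of "c epowr r"] assms by simp
  qed auto
  also have "\<dots> = (2 * 2) epowr r * (a epowr r + b epowr r + c epowr r)"
    unfolding epowr_mult[OF assms] by (simp add: distrib_left mult.assoc)
  finally show ?thesis by simp
qed

section \<open>Absorption, selection from suprema and saturation\<close>

lemma suminf_Suc_le: "(\<Sum>k. f (Suc k)) \<le> (\<Sum>k. f k :: ennreal)"
  using suminf_offset[of f 1] by simp

text \<open>The coefficient \<open>3 / 2\<close> is what lets a recursion against weights that halve at each step be
  absorbed.\<close>

lemma epowr_add_le_absorb:
  assumes "0 < p"
  shows "\<exists>C::ennreal. 1 \<le> C \<and> C < top \<and> (\<forall>x y. 2 * (x + y) epowr p \<le> 3 * x epowr p + 2 * C * y epowr p)"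
proof -
  \<comment> \<open>Chosen so that (1 + d)^p = 3/2: if y is at most d * x, the sum costs the factor
    3/2; otherwise x is absorbed into y.\<close>
  define d where "d = (3/2::real) powr (1/p) - 1"
  have "(3/2::real) powr 0 < (3/2) powr (1/p)" using assms by (intro powr_less_mono) auto
  then have d: "d > 0" by (simp add: d_def)
  define C where "C = ennreal (1 + 1/d) epowr p"
  have one: "1 epowr p \<le> C" unfolding C_def using assms d
    by (intro epowr_mono) (auto simp: ennreal_1[symmetric] simp del: ennreal_1)
  have fin: "C < top" unfolding C_def using assms by auto
  have "2 * (x + y) epowr p \<le> 3 * x epowr p + 2 * C * y epowr p" for x y
  proof (cases "y \<le> ennreal d * x")
    case True
    then have "x + y \<le> ennreal (1 + d) * x"
      using d by (simp add: distrib_right add_left_mono ennreal_plus del: ennreal_plus_if)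
    then have "(x + y) epowr p \<le> (ennreal (1 + d) * x) epowr p"
      using assms by (intro epowr_mono) auto
    also have "\<dots> = ennreal (1 + d) epowr p * x epowr p" using assms by (intro epowr_mult) auto
    also have "ennreal (1 + d) epowr p = ennreal (3/2)"
      using assms d by (subst epowr_ennreal) (auto simp: d_def powr_powr)
    finally have "2 * (x + y) epowr p \<le> ennreal 2 * (ennreal (3/2) * x epowr p)"
      by (auto intro: mult_left_mono)
    also have "\<dots> = 3 * x epowr p"
      by (subst mult.assoc[symmetric], subst ennreal_mult[symmetric]) auto
    finally show ?thesis by (rule order_trans) simp
  next
    case False
    then have "ennreal (1/d) * (ennreal d * x) \<le> ennreal (1/d) * y"
      by (intro mult_left_mono) auto
    then have "x \<le> ennreal (1/d) * y"
      using d by (simp add: mult.assoc[symmetric] ennreal_mult[symmetric])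
    then have "x + y \<le> ennreal (1 + 1/d) * y"
      using d by (simp add: distrib_right add_right_mono ennreal_plus add.commute del: ennreal_plus_if)
    then have "(x + y) epowr p \<le> (ennreal (1 + 1/d) * y) epowr p"
      using assms by (intro epowr_mono) auto
    also have "\<dots> = C * y epowr p" unfolding C_def using assms by (intro epowr_mult) auto
    finally have "2 * (x + y) epowr p \<le> 2 * (C * y epowr p)" by (intro mult_left_mono) auto
    also have "\<dots> \<le> 3 * x epowr p + 2 * C * y epowr p" by (simp add: mult.assoc)
    finally show ?thesis .
  qed
  then show ?thesis using one fin by auto
qed

definition absorb_const :: "real \<Rightarrow> ennreal" where
  "absorb_const p = (SOME C. 1 \<le> C \<and> C < top \<and>
     (\<forall>x y. 2 * (x + y) epowr p \<le> 3 * x epowr p + 2 * C * y epowr p))"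

lemma absorb_const:
  assumes "0 < p"
  shows "1 \<le> absorb_const p" "absorb_const p < top"
    "2 * (x + y) epowr p \<le> 3 * x epowr p + 2 * absorb_const p * y epowr p"
  using someI_ex[OF epowr_add_le_absorb[OF assms]] unfolding absorb_const_def by auto

text \<open>Halving w turns the coefficient 3/2 into 3/4, so the products \<open>w k * x k\<close>
  obey a recursion with ratio 3/4, and 4 = 1 / (1 - 3/4). The \<open>x k\<close> may be infinite;
  hence nothing is subtracted, and partial sums are bounded by induction.\<close>

lemma halving_weights_sum_le:
  fixes w x e :: "nat \<Rightarrow> ennreal"
  assumes w: "\<And>k. 2 * w (Suc k) = w k"
    and x0: "x 0 \<le> e 0" and x: "\<And>k. 2 * x (Suc k) \<le> 3 * x k + 2 * e (Suc k)"
  shows "(\<Sum>k. w k * x k) \<le> 4 * (\<Sum>k. w k * e k)"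
proof (rule suminf_le_const)
  have w2: "w k * (2 * y) = 4 * (w (Suc k) * y)" for k y
  proof -
    have "w k * (2 * y) = (2 * 2) * (w (Suc k) * y)"
      by (subst w[of k, symmetric]) (simp only: ac_simps)
    then show ?thesis by simp
  qed
  have *: "(\<Sum>k\<le>n. w k * x k) \<le> 4 * (\<Sum>k\<le>n. w k * e k)" for n
  proof (induction n)
    case 0
    have "w 0 * x 0 \<le> w 0 * e 0" by (intro mult_left_mono x0) auto
    also have "\<dots> \<le> 4 * (w 0 * e 0)" using mult_right_mono[of 1 4 "w 0 * e 0"] by simp
    finally show ?case by simp
  next
    case (Suc n)
    let ?P = "\<Sum>k\<le>n. w k * x k" and ?Q = "\<Sum>k\<le>n. w k * e k"
    let ?S = "\<Sum>k\<le>n. w (Suc k) * e (Suc k)"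
    have "4 * (\<Sum>k\<le>Suc n. w k * x k) = 4 * (w 0 * x 0) + (\<Sum>k\<le>n. 4 * (w (Suc k) * x (Suc k)))"
      by (simp only: sum.atMost_Suc_shift distrib_left sum_distrib_left)
    also have "(\<Sum>k\<le>n. 4 * (w (Suc k) * x (Suc k))) = (\<Sum>k\<le>n. w k * (2 * x (Suc k)))"
      by (simp add: w2)
    also have "\<dots> \<le> (\<Sum>k\<le>n. w k * (3 * x k + 2 * e (Suc k)))"
      by (intro sum_mono mult_left_mono x) auto
    also have "\<dots> = 3 * ?P + 4 * ?S"
      by (simp add: distrib_left w2 sum.distrib sum_distrib_left mult.left_commute)
    also have "4 * (w 0 * x 0) \<le> 4 * (w 0 * e 0)" by (intro mult_left_mono x0) auto
    finally have "4 * (\<Sum>k\<le>Suc n. w k * x k) \<le> 4 * (w 0 * e 0) + (3 * ?P + 4 * ?S)"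
      by (simp add: add_right_mono)
    also have "\<dots> = 3 * ?P + 4 * (w 0 * e 0 + ?S)"
      by (simp add: distrib_left ac_simps)
    also have "w 0 * e 0 + ?S = (\<Sum>k\<le>Suc n. w k * e k)"
      by (simp only: sum.atMost_Suc_shift)
    also have "3 * ?P \<le> 12 * ?Q" using mult_left_mono[OF Suc.IH, of 3] by (simp add: mult.assoc[symmetric])
    also have "12 * ?Q \<le> 12 * (\<Sum>k\<le>Suc n. w k * e k)"
      by (intro mult_left_mono) auto
    finally have "4 * (\<Sum>k\<le>Suc n. w k * x k) \<le> 12 * (\<Sum>k\<le>Suc n. w k * e k) + 4 * (\<Sum>k\<le>Suc n. w k * e k)"
      by (auto intro: add_right_mono order_trans)
    also have "\<dots> = 4 * (4 * (\<Sum>k\<le>Suc n. w k * e k))"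
      by (simp only: mult.assoc[symmetric] distrib_right[symmetric]) simp
    finally show ?case by (subst (asm) ennreal_mult_le_mult_iff) auto
  qed
  fix n
  have "(\<Sum>k<n. w k * x k) \<le> (\<Sum>k\<le>n. w k * x k)" by (intro sum_mono2) auto
  also note *
  also have "4 * (\<Sum>k\<le>n. w k * e k) \<le> 4 * (\<Sum>k. w k * e k)"
    by (intro mult_left_mono sum_le_suminf) auto
  finally show "(\<Sum>k<n. w k * x k) \<le> 4 * (\<Sum>k. w k * e k)" .
qed simp

text \<open>The suprema are taken over independent choices, so a bound uniform over all selections z
  suffices. The summand c collects the terms whose points are already fixed; an empty
  \<open>A k\<close> has supremum 0 and takes no part in the selection.\<close>

lemma sum_SUP_le:
  fixes g :: "nat \<Rightarrow> 'b \<Rightarrow> ennreal"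
  assumes "\<And>z. (\<And>k. k < n \<Longrightarrow> A k \<noteq> {} \<Longrightarrow> z k \<in> A k) \<Longrightarrow> (\<Sum>k | k < n \<and> A k \<noteq> {}. g k (z k)) + c \<le> K"
  shows "(\<Sum>k<n. SUP z\<in>A k. g k z) + c \<le> K"
  using assms
proof (induction n arbitrary: c)
  case (Suc n)
  show ?case
  proof (cases "A n = {}")
    case True
    have "{k. k < Suc n \<and> A k \<noteq> {}} = {k. k < n \<and> A k \<noteq> {}}" using True by (auto simp: less_Suc_eq)
    then have "(\<Sum>k<n. SUP z\<in>A k. g k z) + c \<le> K"
    proof (intro Suc.IH)
      fix z assume "\<And>k. k < n \<Longrightarrow> A k \<noteq> {} \<Longrightarrow> z k \<in> A k"
      then show "(\<Sum>k | k < n \<and> A k \<noteq> {}. g k (z k)) + c \<le> K"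
        using Suc.prems[of z] True \<open>{k. k < Suc n \<and> A k \<noteq> {}} = _\<close> by (auto simp: less_Suc_eq)
    qed
    then show ?thesis using True by (simp add: bot_ennreal)
  next
    case False
    have set: "{k. k < Suc n \<and> A k \<noteq> {}} = insert n {k. k < n \<and> A k \<noteq> {}}" using False by (auto simp: less_Suc_eq)
    have "(\<Sum>k<n. SUP z\<in>A k. g k z) + (g n y + c) \<le> K" if y: "y \<in> A n" for y
    proof (rule Suc.IH)
      fix z assume z: "\<And>k. k < n \<Longrightarrow> A k \<noteq> {} \<Longrightarrow> z k \<in> A k"
      have "(\<Sum>k | k < Suc n \<and> A k \<noteq> {}. g k ((z(n := y)) k)) + c \<le> K"
        by (rule Suc.prems) (use z y in \<open>auto simp: less_Suc_eq\<close>)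
      moreover have "(\<Sum>k | k < n \<and> A k \<noteq> {}. g k ((z(n := y)) k)) = (\<Sum>k | k < n \<and> A k \<noteq> {}. g k (z k))"
        by (intro sum.cong) auto
      ultimately show "(\<Sum>k | k < n \<and> A k \<noteq> {}. g k (z k)) + (g n y + c) \<le> K"
        unfolding set by (simp add: ac_simps)
    qed
    then have "(SUP y\<in>A n. g n y + ((\<Sum>k<n. SUP z\<in>A k. g k z) + c)) \<le> K"
      by (intro SUP_least) (simp add: ac_simps)
    then show ?thesis using False by (subst (asm) ennreal_SUP_add_left) (auto simp: ac_simps)
  qed
qed auto

text \<open>Testing with \<open>\<alpha> i = (\<gamma> i / e i) epowr (1 / (1 - q))\<close>, the extremal of Hoelder's inequality.\<close>

lemma saturation:
  fixes \<gamma> e :: "'i \<Rightarrow> ennreal"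
  assumes q: "0 < q" "q < 1" and r: "r = q / (1 - q)" and F: "finite F"
    and fin: "\<And>i. i \<in> F \<Longrightarrow> \<gamma> i < top" "\<And>i. i \<in> F \<Longrightarrow> e i < top"
    and z: "\<And>i. i \<in> F \<Longrightarrow> e i = 0 \<Longrightarrow> \<gamma> i = 0"
    and test: "\<And>\<alpha>. (\<And>i. i \<in> F \<Longrightarrow> \<alpha> i < top) \<Longrightarrow>
       (\<Sum>i\<in>F. \<gamma> i * \<alpha> i epowr q) \<le> K * (\<Sum>i\<in>F. \<alpha> i * e i) epowr q"
  shows "(\<Sum>i\<in>F. \<gamma> i epowr (1 + r) * inverse (e i) epowr r) \<le> K epowr (1 + r)"
proof -
  have r0: "0 < r" using q by (simp add: r)
  have r1: "(1 + r) * q = r" "(1 - q) * (1 + r) = 1" using q by (auto simp: r field_simps)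
  define \<alpha> where "\<alpha> i = (\<gamma> i * inverse (e i)) epowr (1 + r)" for i
  define s where "s i = \<gamma> i epowr (1 + r) * inverse (e i) epowr r" for i
  let ?S = "\<Sum>i\<in>F. s i"
  \<comment> \<open>With this \<alpha> the i-th terms on both sides of the test are the same number
    \<open>s i\<close>, so that the test reads S \<le> K * S^q for their sum S.\<close>
  have a: "\<alpha> i < top \<and> \<gamma> i * \<alpha> i epowr q = s i \<and> \<alpha> i * e i = s i \<and> s i < top" if i: "i \<in> F" for i
  proof (cases "\<gamma> i = 0")
    case True then show ?thesis using r0 q by (simp add: \<alpha>_def s_def)
  next
    case False
    then obtain g where g: "\<gamma> i = ennreal g" "g > 0" using fin(1)[OF i]
      by (cases "\<gamma> i" rule: ennreal_trichotomy) auto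
    obtain d where d: "e i = ennreal d" "d > 0" using fin(2)[OF i] z[OF i] False
      by (cases "e i" rule: ennreal_trichotomy) auto
    have al: "\<alpha> i = ennreal ((g / d) powr (1 + r))"
      unfolding \<alpha>_def g d using g d
      by (simp add: inverse_ennreal ennreal_mult[symmetric] epowr_ennreal field_simps)
    have si: "s i = ennreal (g powr (1 + r) * (1/d) powr r)"
      unfolding s_def g d using g d
      by (simp add: inverse_ennreal ennreal_mult[symmetric] epowr_ennreal field_simps)
    have "((g / d) powr (1 + r)) powr q = (g / d) powr r"
      by (simp only: powr_powr r1)
    then have "g * ((g / d) powr (1 + r)) powr q = g powr (1 + r) * (1/d) powr r"
      using g d by (simp add: powr_divide powr_add)
    moreover have "(g / d) powr (1 + r) * d = g powr (1 + r) * (1/d) powr r"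
      using g d by (simp add: powr_divide powr_add field_simps)
    ultimately show ?thesis unfolding al si g d using g d q
      by (simp add: ennreal_mult[symmetric] epowr_ennreal)
  qed
  have "?S = (\<Sum>i\<in>F. \<gamma> i * \<alpha> i epowr q)" using a by (intro sum.cong) auto
  also have "\<dots> \<le> K * (\<Sum>i\<in>F. \<alpha> i * e i) epowr q" by (rule test) (use a in auto)
  also have "(\<Sum>i\<in>F. \<alpha> i * e i) = ?S" using a by (intro sum.cong) auto
  finally have le: "?S \<le> K * ?S epowr q" .
  \<comment> \<open>Finiteness permits division by S^q, which leaves S^(1 - q) \<le> K.\<close>
  have S: "?S < top" using F a by (auto simp: less_top)
  have "?S \<le> K epowr (1 + r)"
  proof (cases "?S = 0")
    case False
    then obtain x where x: "?S = ennreal x" "x > 0" using S by (cases ?S rule: ennreal_trichotomy) auto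
    have "ennreal (x powr - q) * ennreal x \<le> ennreal (x powr - q) * (K * ennreal (x powr q))"
      using le x by (intro mult_left_mono) (auto simp: epowr_ennreal)
    also have "\<dots> = K * ennreal (x powr - q * x powr q)" by (simp add: ennreal_mult ac_simps)
    also have "x powr - q * x powr q = 1" using x by (simp add: powr_minus field_simps)
    also have "ennreal (x powr - q) * ennreal x = ennreal (x powr (1 - q))"
      using x by (subst ennreal_mult[symmetric]) (auto simp: powr_minus powr_diff field_simps)
    finally have "ennreal (x powr (1 - q)) epowr (1 + r) \<le> K epowr (1 + r)"
      using r0 by (intro epowr_mono) auto
    then show ?thesis using x r1 by (simp add: epowr_ennreal powr_powr)
  qed simp
  then show ?thesis by (simp add: s_def)
qed

section \<open>Integrals over the half-line\<close>

abbreviation Lpos :: "real measure" where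
  "Lpos \<equiv> lebesgue_on {0<..}"

lemma space_Lpos [simp]: "space Lpos = {0<..}"
  by simp

lemma borel_measurable_Lpos: "f \<in> borel_measurable borel \<Longrightarrow> f \<in> borel_measurable Lpos"
  by (intro measurable_restrict_space1) (auto intro: borel_measurable_subalgebra[of lborel] measurable_completion)

lemma ident_Lpos [measurable]: "(\<lambda>x. x) \<in> Lpos \<rightarrow>\<^sub>M borel"
  by (intro borel_measurable_Lpos) simp

lemma sigma_finite_Lpos: "sigma_finite_measure Lpos"
proof
  let ?A = "range (\<lambda>n::nat. {0<..real n})"
  have "emeasure Lpos {0<..real n} \<noteq> \<infinity>" for n
    using emeasure_restrict_space[of "{0<..}" lebesgue "{0<..real n}"] by (simp add: subset_iff)
  moreover have "\<Union>?A = {0<..}" using real_arch_simple by auto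
  moreover have "?A \<subseteq> sets Lpos" by (auto simp: sets_restrict_space_iff)
  ultimately show "\<exists>A. countable A \<and> A \<subseteq> sets Lpos \<and> \<Union>A = space Lpos \<and> (\<forall>a\<in>A. emeasure Lpos a \<noteq> \<infinity>)"
    by (intro exI[of _ ?A] conjI) (auto simp del: emeasure_completion)
qed

text \<open>Points are null, so open and closed end points may be exchanged.\<close>

lemma AE_Lpos_neq: "AE y in Lpos. y \<noteq> c"
proof -
  have "AE y in lborel. y \<noteq> c" by (rule AE_lborel_singleton)
  then have "AE y in lebesgue. y \<noteq> c" by (rule AE_completion)
  then show ?thesis by (subst AE_restrict_space_iff) (auto elim: eventually_mono)
qed

lemma integ_Lpos: "0 \<le> s \<Longrightarrow> integ f s t = (\<integral>\<^sup>+y. f y * indicator {s<..<t} y \<partial>Lpos)"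
  unfolding integ_def
  by (subst nn_integral_restrict_space) (auto intro!: nn_integral_cong split: split_indicator)

text \<open>Integrating over \<open>Lpos\<close> makes \<open>tail h\<close> a non-increasing
  function on the whole line, constant to the left of 0, so that it can be integrated against Borel
  measures on the line.\<close>

definition tail :: "(real \<Rightarrow> ennreal) \<Rightarrow> real \<Rightarrow> ennreal" where
  "tail h x = (\<integral>\<^sup>+y. h y * indicator {x<..} y \<partial>Lpos)"

lemma integ_inf_eq_tail: "0 \<le> x \<Longrightarrow> integ_inf h x = tail h x"
  unfolding integ_inf_def tail_def
  by (subst nn_integral_restrict_space) (auto intro!: nn_integral_cong split: split_indicator)

lemma integ_inf_0: "integ_inf f 0 = nn_integral Lpos f"
  unfolding integ_inf_def
  by (subst nn_integral_restrict_space) (auto)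

lemma tail_cong: "(\<And>y. x < y \<Longrightarrow> 0 < y \<Longrightarrow> f y = g y) \<Longrightarrow> tail f x = tail g x"
  unfolding tail_def by (intro nn_integral_cong) (auto split: split_indicator)

lemma tail_antimono: "x \<le> y \<Longrightarrow> tail h y \<le> tail h x"
  unfolding tail_def by (intro nn_integral_mono mult_left_mono) (auto split: split_indicator)

lemma measurable_mono_on:
  fixes f :: "real \<Rightarrow> ennreal"
  assumes "mono_on {0<..} f" shows "f \<in> borel_measurable Lpos"
proof (rule borel_measurableI_greater)
  fix c
  have "is_interval {x \<in> {0<..}. c < f x}"
    unfolding is_interval_1
  proof safe
    fix a b x :: real assume "0 < a" "c < f a" "a \<le> x"
    then show "c < f x" using mono_onD[OF assms, of a x] by auto
  qed auto
  then have "{x \<in> {0<..}. c < f x} \<in> sets lebesgue"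
    by (intro sets_completionI_sets) (simp add: real_interval_borel_measurable)
  then show "{x \<in> space Lpos. c < f x} \<in> sets Lpos"
    by (subst sets_restrict_space_iff) auto
qed

lemma measurable_antimono_on:
  fixes f :: "real \<Rightarrow> ennreal"
  assumes "antimono_on {0<..} f" shows "f \<in> borel_measurable Lpos"
proof -
  have "(\<lambda>x. inverse (f x)) \<in> borel_measurable Lpos"
    by (intro measurable_mono_on monotone_onI ennreal_inverse_mono' monotone_onD[OF assms]) auto
  then have "(\<lambda>x. inverse (inverse (f x))) \<in> borel_measurable Lpos" by measurable
  then show ?thesis by simp
qed

lemma measurable_mono_ennreal:
  fixes f :: "real \<Rightarrow> ennreal"
  assumes "mono f" shows "f \<in> borel_measurable borel"
proof (rule borel_measurableI_greater)
  fix c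
  have "is_interval {x. c < f x}"
    unfolding is_interval_1
  proof safe
    fix a b x :: real assume "c < f a" "a \<le> x"
    then show "c < f x" using monoD[OF assms, of a x] by auto
  qed
  then show "{x \<in> space borel. c < f x} \<in> sets borel"
    using real_interval_borel_measurable by simp
qed

lemma measurable_antimono_ennreal:
  fixes f :: "real \<Rightarrow> ennreal"
  assumes "antimono f" shows "f \<in> borel_measurable borel"
proof -
  have "(\<lambda>x. inverse (f x)) \<in> borel_measurable borel"
    by (intro measurable_mono_ennreal monoI ennreal_inverse_mono' monotoneD[OF assms])
  then have "(\<lambda>x. inverse (inverse (f x))) \<in> borel_measurable borel" by measurable
  then show ?thesis by simp
qed

lemma tail_measurable [measurable]: "tail h \<in> borel_measurable borel"
  by (intro measurable_antimono_ennreal) (auto simp: monotone_def tail_antimono)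

text \<open>A nonempty down-closed set of reals is a closed or open half-line or everything. Each is
  exhausted by countably many closed half-lines, which makes monotone convergence available on
  sublevel sets of monotone functions.\<close>

lemma downset_cofinal:
  fixes S :: "real set"
  assumes ne: "S \<noteq> {}" and down: "\<And>x y. x \<in> S \<Longrightarrow> y \<le> x \<Longrightarrow> y \<in> S"
  shows "\<exists>x::nat \<Rightarrow> real. range x \<subseteq> S \<and> incseq x \<and> S = (\<Union>n. {..x n})"
proof (cases "bdd_above S")
  case False
  have "real n \<in> S" for n
  proof -
    obtain z where "z \<in> S" "\<not> z \<le> real n" using False unfolding bdd_above_def by blast
    then show ?thesis using down[of z "real n"] by simp
  qed
  moreover have "\<exists>n. y \<le> real n" for y by (rule real_arch_simple)
  ultimately show ?thesis using down
    by (intro exI[of _ real]) (auto simp: incseq_def)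
next
  case True
  show ?thesis
  proof (cases "Sup S \<in> S")
    case True
    then show ?thesis using down cSup_upper[OF _ \<open>bdd_above S\<close>]
      by (intro exI[of _ "\<lambda>_. Sup S"]) (auto simp: incseq_def)
  next
    case False
    let ?x = "\<lambda>n. Sup S - 1 / (Suc n)"
    have "?x n \<in> S" for n
    proof -
      have "?x n < Sup S" by simp
      then obtain z where "z \<in> S" "?x n < z" using less_cSup_iff[OF ne \<open>bdd_above S\<close>] by blast
      then show ?thesis using down by auto
    qed
    moreover have "\<exists>n. y \<le> ?x n" if y: "y \<in> S" for y
    proof -
      have "y < Sup S" using cSup_upper[OF y \<open>bdd_above S\<close>] False y by (cases "y = Sup S") auto
      then obtain n where "1 / (Suc n) < Sup S - y"
        using reals_Archimedean[of "Sup S - y"] by (auto simp: inverse_eq_divide)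
      then show ?thesis by (intro exI[of _ n]) auto
    qed
    moreover have "incseq ?x" by (auto simp: incseq_def frac_le)
    ultimately show ?thesis using down by (intro exI[of _ ?x]) auto
  qed
qed

lemma nn_integral_downset_le:
  fixes S :: "real set" and f :: "real \<Rightarrow> ennreal"
  assumes down: "\<And>x y. x \<in> S \<Longrightarrow> y \<le> x \<Longrightarrow> y \<in> S"
    and [measurable]: "f \<in> borel_measurable M" "(\<lambda>x. x) \<in> M \<rightarrow>\<^sub>M borel"
    and le: "\<And>x. x \<in> S \<Longrightarrow> (\<integral>\<^sup>+y. f y * indicator {..x} y \<partial>M) \<le> K"
  shows "(\<integral>\<^sup>+y. f y * indicator S y \<partial>M) \<le> K"
proof (cases "S = {}")
  case False
  obtain x :: "nat \<Rightarrow> real" where x: "range x \<subseteq> S" "incseq x" "S = (\<Union>n. {..x n})"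
    using downset_cofinal[OF False] down by metis
  have inc: "incseq (\<lambda>n y. f y * indicator {..x n} y)"
    using x(2) by (auto simp: incseq_def le_fun_def intro!: mult_left_mono split: split_indicator dest: order_trans)
  have "f y * indicator S y = (SUP n. f y * indicator {..x n} y)" for y
  proof (rule antisym)
    show "f y * indicator S y \<le> (SUP n. f y * indicator {..x n} y)"
      by (subst x(3)) (auto split: split_indicator intro: SUP_upper2)
    show "(SUP n. f y * indicator {..x n} y) \<le> f y * indicator S y"
      by (subst x(3)) (auto split: split_indicator intro!: SUP_least)
  qed
  then have "(\<integral>\<^sup>+y. f y * indicator S y \<partial>M) = (\<integral>\<^sup>+y. (SUP n. f y * indicator {..x n} y) \<partial>M)"
    by simp
  also have "\<dots> = (SUP n. \<integral>\<^sup>+y. f y * indicator {..x n} y \<partial>M)"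
    by (intro nn_integral_monotone_convergence_SUP inc) measurable
  also have "\<dots> \<le> K" using x(1) by (intro SUP_least le) auto
  finally show ?thesis .
qed simp

lemma upset_cofinal:
  fixes S :: "real set"
  assumes ne: "S \<noteq> {}" and up: "\<And>x y. x \<in> S \<Longrightarrow> x \<le> y \<Longrightarrow> y \<in> S"
  shows "\<exists>x::nat \<Rightarrow> real. range x \<subseteq> S \<and> decseq x \<and> S = (\<Union>n. {x n..})"
proof -
  have down: "\<And>x y. x \<in> uminus ` S \<Longrightarrow> y \<le> x \<Longrightarrow> y \<in> uminus ` S"
    using up by (metis (no_types, lifting) image_iff minus_le_iff minus_minus)
  obtain x :: "nat \<Rightarrow> real" where x: "range x \<subseteq> uminus ` S" "incseq x" "uminus ` S = (\<Union>n. {..x n})"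
    using downset_cofinal[of "uminus ` S"] down ne by (metis image_is_empty)
  have S: "S = (\<Union>n. {- x n..})"
  proof (rule set_eqI)
    fix y
    have "y \<in> S \<longleftrightarrow> - y \<in> uminus ` S" by force
    also have "\<dots> \<longleftrightarrow> (\<exists>n. - y \<le> x n)" by (subst x(3)) auto
    finally show "y \<in> S \<longleftrightarrow> y \<in> (\<Union>n. {- x n..})" by (auto simp: minus_le_iff)
  qed
  have "- x n \<in> S" for n using S by (metis UNIV_I UN_iff atLeast_iff order_refl)
  moreover have "decseq (\<lambda>n. - x n)" using x(2) by (auto simp: incseq_def decseq_def)
  ultimately show ?thesis using S by (intro exI[of _ "\<lambda>n. - x n"]) auto
qed

lemma nn_integral_upset_le:
  fixes S :: "real set" and f :: "real \<Rightarrow> ennreal"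
  assumes up: "\<And>x y. x \<in> S \<Longrightarrow> x \<le> y \<Longrightarrow> y \<in> S"
    and [measurable]: "f \<in> borel_measurable M" "(\<lambda>x. x) \<in> M \<rightarrow>\<^sub>M borel"
    and le: "\<And>x. x \<in> S \<Longrightarrow> (\<integral>\<^sup>+y. f y * indicator {x..} y \<partial>M) \<le> K"
  shows "(\<integral>\<^sup>+y. f y * indicator S y \<partial>M) \<le> K"
proof (cases "S = {}")
  case False
  obtain x :: "nat \<Rightarrow> real" where x: "range x \<subseteq> S" "decseq x" "S = (\<Union>n. {x n..})"
    using upset_cofinal[OF False] up by metis
  have inc: "incseq (\<lambda>n y. f y * indicator {x n..} y)"
    using x(2) by (auto simp: incseq_def decseq_def le_fun_def intro!: mult_left_mono split: split_indicator dest: order_trans)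
  have "f y * indicator S y = (SUP n. f y * indicator {x n..} y)" for y
  proof (rule antisym)
    show "f y * indicator S y \<le> (SUP n. f y * indicator {x n..} y)"
      by (subst x(3)) (auto split: split_indicator intro: SUP_upper2)
    show "(SUP n. f y * indicator {x n..} y) \<le> f y * indicator S y"
      by (subst x(3)) (auto split: split_indicator intro!: SUP_least)
  qed
  then have "(\<integral>\<^sup>+y. f y * indicator S y \<partial>M) = (\<integral>\<^sup>+y. (SUP n. f y * indicator {x n..} y) \<partial>M)"
    by simp
  also have "\<dots> = (SUP n. \<integral>\<^sup>+y. f y * indicator {x n..} y \<partial>M)"
    by (intro nn_integral_monotone_convergence_SUP inc) measurable
  also have "\<dots> \<le> K" using x(1) by (intro SUP_least le) auto
  finally show ?thesis .
qed simp

lemma downset_borel: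
  fixes S :: "real set"
  shows "(\<And>x y. x \<in> S \<Longrightarrow> y \<le> x \<Longrightarrow> y \<in> S) \<Longrightarrow> S \<in> sets borel"
  by (rule real_interval_borel_measurable) (auto simp: is_interval_1)

text \<open>Continuity of the measure from below. Applied to the set where \<open>\<Phi>\<close> is
  at most l, it bounds the mass below level l by l even where \<open>\<Phi>\<close> jumps over
  l.\<close>

lemma emeasure_distribution_le:
  fixes \<mu> :: "real measure"
  assumes [measurable_cong, simp]: "sets \<mu> = sets borel"
    and down: "\<And>x y. x \<in> S \<Longrightarrow> y \<le> x \<Longrightarrow> y \<in> S"
    and le: "\<And>x. x \<in> S \<Longrightarrow> emeasure \<mu> {..x} \<le> l"
  shows "emeasure \<mu> S \<le> l"
proof -
  have S: "S \<in> sets \<mu>" using downset_borel[of S] down by auto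
  have [measurable]: "(\<lambda>x. x) \<in> \<mu> \<rightarrow>\<^sub>M borel"
    by (simp add: measurable_def sets_eq_imp_space_eq[OF assms(1)])
  have "(\<integral>\<^sup>+y. 1 * indicator S y \<partial>\<mu>) \<le> l"
    by (rule nn_integral_downset_le[OF down]) (use le in auto)
  then show ?thesis using S by simp
qed

lemma tail_atLeast: "(\<integral>\<^sup>+y. h y * indicator {x..} y \<partial>Lpos) = tail h x"
  unfolding tail_def
  by (intro nn_integral_cong_AE eventually_mono[OF AE_Lpos_neq[of x]]) (auto split: split_indicator)

text \<open>Takes the place of the chain rule for the q-th power of H = \<open>tail h\<close>. Let l
  be half of H x. The points with H < l form a right half-line of mass at most l, so beyond x the
  set H \<ge> l carries mass at least l; there H^(q - 1) \<ge> l^(q - 1) because q \<ge> 1, and (2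
  l)^q gives the constant.\<close>

lemma tail_power_le:
  assumes h[measurable]: "h \<in> borel_measurable Lpos" and q: "1 \<le> q" and fin: "tail h x < top"
  shows "tail h x epowr q \<le> 2 epowr q * (\<integral>\<^sup>+y. tail h y epowr (q - 1) * h y * indicator {x<..} y \<partial>Lpos)"
proof -
  obtain t where t: "0 \<le> t" "tail h x = ennreal t" using fin by (cases "tail h x") auto
  define l where "l = ennreal (t / 2)"
  have l: "tail h x = l + l" "l < top"
    using t by (auto simp: l_def ennreal_plus[symmetric] simp del: ennreal_plus)
  have ac: "tail h x = (\<integral>\<^sup>+y. h y * indicator {y. x < y \<and> l \<le> tail h y} y \<partial>Lpos)
       + (\<integral>\<^sup>+y. h y * indicator {y. x < y \<and> tail h y < l} y \<partial>Lpos)"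
    unfolding tail_def[of h x]
    by (subst nn_integral_add[symmetric]) (auto intro!: nn_integral_cong split: split_indicator)
  have small: "(\<integral>\<^sup>+y. h y * indicator {y. x < y \<and> tail h y < l} y \<partial>Lpos) \<le> l"
  proof (rule nn_integral_upset_le)
    show "y' \<in> {y. x < y \<and> tail h y < l}" if "y \<in> {y. x < y \<and> tail h y < l}" "y \<le> y'" for y y'
      using that tail_antimono[of y y' h] by auto
  qed (auto simp: tail_atLeast)
  have "l + l \<le> (\<integral>\<^sup>+y. h y * indicator {y. x < y \<and> l \<le> tail h y} y \<partial>Lpos) + l"
    unfolding l(1)[symmetric] by (subst ac) (rule add_left_mono[OF small])
  then have G: "l \<le> (\<integral>\<^sup>+y. h y * indicator {y. x < y \<and> l \<le> tail h y} y \<partial>Lpos)"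
    by (rule ennreal_le_cancel_right[OF l(2)])
  have "tail h x epowr q = 2 epowr q * l epowr q"
    using q by (simp add: l(1) epowr_mult mult_2[symmetric])
  also have "l epowr q = l epowr (q - 1) * l" using epowr_add[of "q - 1" 1 l] q by simp
  also have "\<dots> \<le> l epowr (q - 1) * (\<integral>\<^sup>+y. h y * indicator {y. x < y \<and> l \<le> tail h y} y \<partial>Lpos)"
    by (intro mult_left_mono G) auto
  also have "\<dots> = (\<integral>\<^sup>+y. l epowr (q - 1) * (h y * indicator {y. x < y \<and> l \<le> tail h y} y) \<partial>Lpos)"
    by (subst nn_integral_cmult) auto
  also have "\<dots> \<le> (\<integral>\<^sup>+y. tail h y epowr (q - 1) * h y * indicator {x<..} y \<partial>Lpos)"
    using q by (intro nn_integral_mono)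
       (auto split: split_indicator intro!: mult_right_mono epowr_mono)
  finally show ?thesis by (simp add: mult_left_mono)
qed

text \<open>Normalising both integrals to 1 reduces the inequality to Young's.\<close>

lemma nn_integral_Holder:
  assumes [measurable]: "f \<in> borel_measurable M" "g \<in> borel_measurable M" and q: "0 < q" "q < 1"
  shows "(\<integral>\<^sup>+x. f x epowr q * g x epowr (1 - q) \<partial>M) \<le> (\<integral>\<^sup>+x. f x \<partial>M) epowr q * (\<integral>\<^sup>+x. g x \<partial>M) epowr (1 - q)"
proof -
  have young: "a epowr q * b epowr (1 - q) \<le> ennreal q * a + ennreal (1 - q) * b" for a b :: ennreal
  proof (cases a rule: ennreal_trichotomy)
    case 2 then show ?thesis using q by (simp add: ennreal_mult_top)
  next
    case (3 x)
    then show ?thesis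
    proof (cases b rule: ennreal_trichotomy)
      case 2 then show ?thesis using q by (simp add: ennreal_mult_top)
    next
      case (3 y)
      then show ?thesis using \<open>0 < x\<close> \<open>a = ennreal x\<close> q Youngs_inequality_0[of q "1 - q" x y]
        by (simp add: epowr_ennreal ennreal_mult[symmetric] ennreal_plus[symmetric] del: ennreal_plus)
    qed (use q in auto)
  qed (use q in auto)
  let ?A = "\<integral>\<^sup>+x. f x \<partial>M" and ?B = "\<integral>\<^sup>+x. g x \<partial>M"
  show ?thesis
  proof (cases "?A = 0 \<or> ?B = 0")
    case True
    then have "AE x in M. f x epowr q * g x epowr (1 - q) = 0"
      using q by (auto simp: nn_integral_0_iff_AE elim!: eventually_mono)
    then have "(\<integral>\<^sup>+x. f x epowr q * g x epowr (1 - q) \<partial>M) = (\<integral>\<^sup>+x. 0 \<partial>M)"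
      by (intro nn_integral_cong_AE) auto
    then show ?thesis by simp
  next
    case nz: False
    show ?thesis
    proof (cases "?A = top \<or> ?B = top")
      case True
      then have "?A epowr q * ?B epowr (1 - q) = top"
        using nz q by (auto simp: ennreal_mult_top ennreal_top_mult)
      then show ?thesis by (simp only: top_greatest)
    next
      case fin: False
      let ?c = "?A epowr q * ?B epowr (1 - q)"
      have cc: "?A * inverse ?A = 1" "?B * inverse ?B = 1"
        using nz fin by (auto simp: ennreal_divide_self[unfolded divide_ennreal_def] less_top)
      have "f x epowr q * g x epowr (1 - q) \<le> ?c * (ennreal q * (f x * inverse ?A) + ennreal (1 - q) * (g x * inverse ?B))" for x
      proof -
        have "f x epowr q * g x epowr (1 - q) = ?c * ((f x * inverse ?A) epowr q * (g x * inverse ?B) epowr (1 - q))"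
        proof -
          have "f x = ?A * (f x * inverse ?A)" "g x = ?B * (g x * inverse ?B)"
            using cc by (metis mult.commute mult.left_commute mult_1)+
          then have "f x epowr q = ?A epowr q * (f x * inverse ?A) epowr q"
            "g x epowr (1 - q) = ?B epowr (1 - q) * (g x * inverse ?B) epowr (1 - q)"
            using q by (metis epowr_mult less_eq_real_def, metis epowr_mult less_eq_real_def diff_gt_0_iff_gt)
          then show ?thesis by (simp add: ac_simps)
        qed
        also have "\<dots> \<le> ?c * (ennreal q * (f x * inverse ?A) + ennreal (1 - q) * (g x * inverse ?B))"
          by (intro mult_left_mono young) auto
        finally show ?thesis .
      qed
      then have "(\<integral>\<^sup>+x. f x epowr q * g x epowr (1 - q) \<partial>M) \<le>
         (\<integral>\<^sup>+x. ?c * (ennreal q * (f x * inverse ?A) + ennreal (1 - q) * (g x * inverse ?B)) \<partial>M)"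
        by (intro nn_integral_mono)
      also have "\<dots> = ?c * (ennreal q * (?A * inverse ?A) + ennreal (1 - q) * (?B * inverse ?B))"
        by (simp add: nn_integral_cmult nn_integral_add nn_integral_multc)
      also have "\<dots> = ?c" using q cc by (simp add: ennreal_plus[symmetric] del: ennreal_plus)
      finally show ?thesis .
    qed
  qed
qed

lemma suminf_Holder:
  fixes f g :: "nat \<Rightarrow> ennreal"
  assumes "0 < q" "q < 1"
  shows "(\<Sum>k. f k epowr q * g k epowr (1 - q)) \<le> (\<Sum>k. f k) epowr q * (\<Sum>k. g k) epowr (1 - q)"
  using nn_integral_Holder[of f "count_space UNIV" g q] assms by (simp add: nn_integral_count_space_nat)

section \<open>Hardy inequalities for a measure on the half-line\<close>

lemma mult_esssup_le:
  fixes f :: "'a \<Rightarrow> ennreal"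
  assumes f: "f \<in> borel_measurable M" and c: "c < top" and le: "AE x in M. c * f x \<le> K"
  shows "c * esssup M f \<le> K"
proof (cases "c = 0")
  case False
  have cc: "c * inverse c = 1" "inverse c * c = 1"
    using c False by (cases c rule: ennreal_trichotomy; auto simp: inverse_ennreal ennreal_mult[symmetric])+
  have "esssup M f \<le> inverse c * K"
  proof (rule esssup_I[OF f])
    show "AE x in M. f x \<le> inverse c * K"
      using le
    proof (rule eventually_mono)
      fix x assume "c * f x \<le> K"
      then have "inverse c * (c * f x) \<le> inverse c * K" by (intro mult_left_mono) auto
      then show "f x \<le> inverse c * K" by (simp add: mult.assoc[symmetric] cc)
    qed
  qed
  then have "c * esssup M f \<le> c * (inverse c * K)" by (intro mult_left_mono) auto
  then show ?thesis by (simp add: mult.assoc[symmetric] cc)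
qed simp

lemma esssup_epowr:
  fixes f :: "'a \<Rightarrow> ennreal"
  assumes f: "f \<in> borel_measurable M" and s: "0 < s"
  shows "esssup M (\<lambda>x. f x epowr s) = esssup M f epowr s"
proof (rule antisym)
  have fs: "(\<lambda>x. f x epowr s) \<in> borel_measurable M" by (rule measurable_compose[OF f epowr_measurable])
  show "esssup M (\<lambda>x. f x epowr s) \<le> esssup M f epowr s"
    using s by (intro esssup_I[OF fs] eventually_mono[OF esssup_AE[of f M]] epowr_mono) auto
  have "esssup M f \<le> esssup M (\<lambda>x. f x epowr s) epowr (1 / s)"
    using s by (intro esssup_I[OF f] eventually_mono[OF esssup_AE[of "\<lambda>x. f x epowr s" M]])
      (simp add: epowr_le_swap)
  then show "esssup M f epowr s \<le> esssup M (\<lambda>x. f x epowr s)" using s by (simp add: epowr_le_swap)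
qed

section \<open>Essential suprema over right half-lines\<close>

lemma measurable_from: "f \<in> Mplus \<Longrightarrow> 0 \<le> z \<Longrightarrow> f \<in> borel_measurable (lebesgue_on {z<..})"
  unfolding Mplus_def by (erule measurable_restrict_mono) auto

lemma AE_from_iff:
  "0 \<le> z \<Longrightarrow> (AE y in lebesgue_on {z<..}. P y) \<longleftrightarrow> (AE y in Lpos. z < y \<longrightarrow> P y)"
  by (simp add: AE_restrict_space_iff) (rule AE_cong, auto)

text \<open>The reciprocal of the essential infimum of v on (z, \<infinity>). Moving mass of h to
  the right only enlarges \<open>tail h\<close>, so this infimum, and not v z, is the true price of
  mass at z.\<close>

definition rho :: "(real \<Rightarrow> ennreal) \<Rightarrow> real \<Rightarrow> ennreal" where
  "rho v z = esssup_from z (\<lambda>y. inverse (v y))"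

lemma rho_antimono: "x \<le> y \<Longrightarrow> rho v y \<le> rho v x"
proof -
  assume xy: "x \<le> y"
  let ?f = "\<lambda>y. inverse (v y)"
  show ?thesis
  proof (cases "?f \<in> borel_measurable (lebesgue_on {x<..})")
    case True
    have "?f \<in> borel_measurable (lebesgue_on {y<..})"
      by (rule measurable_restrict_mono[OF True]) (use xy in auto)
    moreover have "AE z in lebesgue_on {x<..}. ?f z \<le> esssup (lebesgue_on {x<..}) ?f"
      by (rule esssup_AE)
    then have "AE z in lebesgue_on {y<..}. ?f z \<le> esssup (lebesgue_on {x<..}) ?f"
      using xy by (auto simp: AE_restrict_space_iff elim!: eventually_mono)
    ultimately show ?thesis unfolding rho_def esssup_from_def by (rule esssup_I)
  next
    case False
    then show ?thesis unfolding rho_def esssup_from_def by (subst (2) esssup_non_measurable) auto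
  qed
qed

lemma rho_measurable [measurable]: "rho v \<in> borel_measurable borel"
  by (intro measurable_antimono_ennreal) (auto simp: monotone_def rho_antimono)

lemma AE_inverse_le_rho_from:
  fixes v :: "real \<Rightarrow> ennreal"
  assumes "0 \<le> z" shows "AE y in Lpos. z < y \<longrightarrow> inverse (v y) \<le> rho v z"
  using esssup_AE[of "\<lambda>y. inverse (v y)" "lebesgue_on {z<..}"]
  unfolding rho_def esssup_from_def by (simp add: AE_from_iff[OF assms])

lemma rho_le:
  assumes "v \<in> Mplus" "0 \<le> z" "AE y in Lpos. z < y \<longrightarrow> inverse (v y) \<le> c"
  shows "rho v z \<le> c"
  unfolding rho_def esssup_from_def
proof (rule esssup_I)
  show "(\<lambda>y. inverse (v y)) \<in> borel_measurable (lebesgue_on {z<..})"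
    using measurable_from[OF assms(1,2)] by (rule borel_measurable_inverse_ennreal)
  show "AE y in lebesgue_on {z<..}. inverse (v y) \<le> c"
    unfolding AE_from_iff[OF assms(2)] by (rule assms(3))
qed

text \<open>For fixed z the bound by \<open>rho v z\<close> holds almost everywhere beyond z, but
  here z = y ranges over uncountably many points. Rational levels c restore countability: the set
  \<open>rho v y < c\<close> is closed to the right, hence a countable union of half-lines starting
  at points \<open>x n\<close>, and on each of them \<open>inverse (v y)\<close> is almost
  everywhere at most \<open>rho v (x n)\<close>, which is below c.\<close>

lemma AE_inverse_le_rho: "AE y in Lpos. inverse (v y) \<le> rho v y"
proof -
  have "AE y in Lpos. rho v y < ennreal (real_of_rat c) \<longrightarrow> inverse (v y) \<le> ennreal (real_of_rat c)" for c
  proof (cases "{y. 0 < y \<and> rho v y < ennreal (real_of_rat c)} = {}")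
    case True
    then have "AE y in Lpos. \<not> rho v y < ennreal (real_of_rat c)"
      by (intro AE_I2) auto
    then show ?thesis by (rule eventually_mono) simp
  next
    case False
    let ?S = "{y. 0 < y \<and> rho v y < ennreal (real_of_rat c)}"
    have up: "y \<in> ?S" if "x \<in> ?S" "x \<le> y" for x y
      using that rho_antimono[of x y v] by auto
    have "\<exists>x::nat \<Rightarrow> real. range x \<subseteq> ?S \<and> decseq x \<and> ?S = (\<Union>n. {x n..})"
      by (rule upset_cofinal[OF False]) (rule up)
    then obtain x :: "nat \<Rightarrow> real" where x: "range x \<subseteq> ?S" "?S = (\<Union>n. {x n..})"
      by (elim exE conjE) (rule that)
    have "AE y in Lpos. x n \<le> y \<longrightarrow> inverse (v y) \<le> ennreal (real_of_rat c)" for n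
    proof -
      have "x n \<in> ?S" using x(1) by (rule subsetD) simp
      then have "AE y in Lpos. x n < y \<longrightarrow> inverse (v y) \<le> rho v (x n)" "rho v (x n) < ennreal (real_of_rat c)"
        by (auto intro: AE_inverse_le_rho_from)
      then show ?thesis using AE_Lpos_neq[of "x n"]
        by (auto elim!: eventually_elim2)
    qed
    then have "AE y in Lpos. \<forall>n. x n \<le> y \<longrightarrow> inverse (v y) \<le> ennreal (real_of_rat c)"
      unfolding AE_all_countable by (intro allI)
    then have "AE y in Lpos. 0 < y \<longrightarrow> rho v y < ennreal (real_of_rat c) \<longrightarrow> inverse (v y) \<le> ennreal (real_of_rat c)"
    proof (rule eventually_mono, intro impI)
      fix y assume *: "\<forall>n. x n \<le> y \<longrightarrow> inverse (v y) \<le> ennreal (real_of_rat c)"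
        "0 < y" "rho v y < ennreal (real_of_rat c)"
      then have "y \<in> ?S" by simp
      then have "y \<in> (\<Union>n. {x n..})" unfolding x(2) .
      then have "\<exists>n. x n \<le> y" by simp
      then show "inverse (v y) \<le> ennreal (real_of_rat c)" using * by auto
    qed
    moreover have "AE y in Lpos. 0 < y" by (rule AE_I2) simp
    ultimately show ?thesis by (auto elim!: eventually_elim2)
  qed
  then have "AE y in Lpos. \<forall>c. rho v y < ennreal (real_of_rat c) \<longrightarrow> inverse (v y) \<le> ennreal (real_of_rat c)"
    unfolding AE_all_countable by (intro allI)
  then show ?thesis
  proof (rule eventually_mono)
    fix y assume *: "\<forall>c. rho v y < ennreal (real_of_rat c) \<longrightarrow> inverse (v y) \<le> ennreal (real_of_rat c)"
    show "inverse (v y) \<le> rho v y"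
    proof (rule ccontr)
      assume "\<not> inverse (v y) \<le> rho v y"
      then have "rho v y < inverse (v y)" by simp
      from ennreal_rat_dense[OF this] obtain c
        where c: "rho v y < ennreal (real_of_rat c)" "ennreal (real_of_rat c) < inverse (v y)" by blast
      from c(1) * have "inverse (v y) \<le> ennreal (real_of_rat c)" by blast
      with c(2) show False by simp
    qed
  qed
qed

definition cost :: "(real \<Rightarrow> ennreal) \<Rightarrow> (real \<Rightarrow> ennreal) \<Rightarrow> ennreal" where
  "cost v h = (\<integral>\<^sup>+y. h y * v y \<partial>Lpos)"

text \<open>\<open>h\<close> replaces the unit mass just to the right of \<open>a\<close>, where \<open>v\<close> is close to its essential
  infimum.\<close>

lemma approx_point_mass:
  assumes v: "v \<in> Mplus" and a: "0 \<le> a" and l: "l < rho v a"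
  shows "\<exists>h\<in>Mplus. (\<forall>x\<le>a. 1 \<le> tail h x) \<and> cost v h \<le> inverse l"
proof -
  have [measurable]: "v \<in> borel_measurable Lpos" using v by (simp add: Mplus_def)
  \<comment> \<open>The cap at n makes the measure of \<open>E n\<close> finite, so that its
    indicator can be normalised to mass 1; for some n the measure is positive because l lies below
    the essential supremum.\<close>
  define E where "E n = {y \<in> space Lpos. a < y \<and> y \<le> real n \<and> l < inverse (v y)}" for n
  have E[measurable]: "E n \<in> sets Lpos" for n unfolding E_def by measurable
  have "\<exists>n. emeasure Lpos (E n) \<noteq> 0"
  proof (rule ccontr)
    assume "\<not> ?thesis"
    then have "AE y in Lpos. \<forall>n. y \<notin> E n" unfolding AE_all_countable
      by (intro allI AE_not_in) (auto simp: null_sets_def)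
    then have "AE y in Lpos. a < y \<longrightarrow> inverse (v y) \<le> l"
    proof (rule AE_mp, intro AE_I2 impI)
      fix y assume y: "y \<in> space Lpos" "\<forall>n. y \<notin> E n" "a < y"
      obtain n where "y \<le> real n" using real_arch_simple by blast
      then have "\<not> l < inverse (v y)" using y by (auto simp: E_def)
      then show "inverse (v y) \<le> l" by simp
    qed
    then have "rho v a \<le> l" by (rule rho_le[OF v a])
    then show False using l by simp
  qed
  then obtain n where n: "emeasure Lpos (E n) \<noteq> 0" by blast
  have "emeasure Lpos (E n) \<le> emeasure Lpos {0<..real n}"
    using a by (intro emeasure_mono) (auto simp: E_def sets_restrict_space_iff)
  also have "\<dots> = ennreal (real n)"
    using emeasure_restrict_space[of "{0<..}" lebesgue "{0<..real n}"] by (simp add: subset_iff)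
  finally have fin: "emeasure Lpos (E n) < top" by (auto simp: less_top[symmetric] top_unique)
  define c where "c = inverse (emeasure Lpos (E n))"
  have c: "c * emeasure Lpos (E n) = 1"
    using n fin ennreal_divide_self[of "emeasure Lpos (E n)"] by (simp add: c_def divide_ennreal_def mult.commute)
  let ?h = "\<lambda>y. c * indicator (E n) y"
  have "?h \<in> Mplus" unfolding Mplus_def by measurable
  moreover have "1 \<le> tail ?h x" if "x \<le> a" for x
  proof -
    have "tail ?h x = (\<integral>\<^sup>+y. c * indicator (E n) y \<partial>Lpos)" unfolding tail_def
      using that by (intro nn_integral_cong) (auto simp: E_def split: split_indicator)
    then show ?thesis using c by (simp add: nn_integral_cmult)
  qed
  moreover have "cost v ?h \<le> inverse l"
  proof -
    have "v y \<le> inverse l" if "y \<in> E n" for y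
      using that ennreal_inverse_mono'[of l "inverse (v y)"] by (auto simp: E_def)
    then have "cost v ?h \<le> (\<integral>\<^sup>+y. (inverse l * c) * indicator (E n) y \<partial>Lpos)"
      unfolding cost_def by (intro nn_integral_mono) (auto split: split_indicator simp: mult.commute intro: mult_left_mono)
    also have "\<dots> = inverse l * (c * emeasure Lpos (E n))"
      by (subst nn_integral_cmult) (auto simp: mult.assoc)
    finally show ?thesis by (simp add: c)
  qed
  ultimately show ?thesis by blast
qed

text \<open>Beyond z the weight v is infinite almost everywhere, and finite cost forces h to vanish
  there.\<close>

lemma tail_eq_0_if_rho_eq_0:
  assumes [measurable]: "h \<in> borel_measurable Lpos" "v \<in> borel_measurable Lpos"
    and z: "0 \<le> z" "rho v z = 0" and fin: "cost v h < top"
  shows "tail h z = 0"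
proof -
  have "AE y in Lpos. h y * v y \<noteq> \<infinity>"
    using fin unfolding cost_def by (intro nn_integral_PInf_AE) auto
  with AE_inverse_le_rho_from[OF z(1), of v] have "AE y in Lpos. h y * indicator {z<..} y = 0"
    by (rule eventually_elim2) (auto simp: z ennreal_mult_top split: split_indicator if_splits)
  then show ?thesis unfolding tail_def by (subst nn_integral_0_iff_AE) auto
qed

section \<open>Finite combinations of test functions and the optimal ratio\<close>

lemma cost_combination:
  fixes h :: "nat \<Rightarrow> real \<Rightarrow> ennreal"
  assumes "\<And>i. i \<in> F \<Longrightarrow> h i \<in> Mplus" "v \<in> Mplus"
  shows "cost v (\<lambda>y. \<Sum>i\<in>F. \<alpha> i * h i y) = (\<Sum>i\<in>F. \<alpha> i * cost v (h i))"
proof -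
  have [measurable]: "h i \<in> borel_measurable Lpos" if "i \<in> F" for i using assms that by (auto simp: Mplus_def)
  have [measurable]: "v \<in> borel_measurable Lpos" using assms by (simp add: Mplus_def)
  have "cost v (\<lambda>y. \<Sum>i\<in>F. \<alpha> i * h i y) = (\<integral>\<^sup>+y. (\<Sum>i\<in>F. \<alpha> i * (h i y * v y)) \<partial>Lpos)"
    by (simp add: cost_def sum_distrib_right mult.assoc)
  also have "\<dots> = (\<Sum>i\<in>F. \<integral>\<^sup>+y. \<alpha> i * (h i y * v y) \<partial>Lpos)" by (rule nn_integral_sum) measurable
  also have "\<dots> = (\<Sum>i\<in>F. \<alpha> i * cost v (h i))"
    unfolding cost_def by (intro sum.cong refl nn_integral_cmult) measurable
  finally show ?thesis .
qed

lemma combination_Mplus: "(\<And>i. i \<in> F \<Longrightarrow> h i \<in> Mplus) \<Longrightarrow> (\<lambda>y. \<Sum>i\<in>F. \<alpha> i * h i y) \<in> Mplus"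
  unfolding Mplus_def by (intro borel_measurable_sum borel_measurable_times_ennreal) auto

lemma tail_combination_ge:
  assumes "finite F" "i \<in> F" "h i \<in> Mplus"
  shows "\<alpha> i * tail (h i) x \<le> tail (\<lambda>y. \<Sum>i\<in>F. \<alpha> i * h i y) x"
proof -
  have [measurable]: "h i \<in> borel_measurable Lpos" using assms by (simp add: Mplus_def)
  have "\<alpha> i * tail (h i) x = (\<integral>\<^sup>+y. \<alpha> i * (h i y * indicator {x<..} y) \<partial>Lpos)"
    unfolding tail_def by (intro nn_integral_cmult[symmetric]) measurable
  also have "\<dots> \<le> tail (\<lambda>y. \<Sum>i\<in>F. \<alpha> i * h i y) x" unfolding tail_def
  proof (intro nn_integral_mono)
    fix y
    have "\<alpha> i * h i y \<le> (\<Sum>i\<in>F. \<alpha> i * h i y)" using assms by (intro member_le_sum) auto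
    then show "\<alpha> i * (h i y * indicator {x<..} y) \<le> (\<Sum>i\<in>F. \<alpha> i * h i y) * indicator {x<..} y"
      by (simp add: indicator_def)
  qed
  finally show ?thesis .
qed

text \<open>Infinite cost is harmless since x / \<infinity> = 0, and at cost 0 the hypothesis gives
  0 / 0 = 0.\<close>

lemma SUP_ratio_le:
  assumes "\<And>h. h \<in> Mplus \<Longrightarrow> cost v h < top \<Longrightarrow> F h \<le> K * cost v h"
  shows "(SUP h\<in>Mplus. F h / cost v h) \<le> K"
proof (rule SUP_least)
  fix h assume h: "h \<in> Mplus"
  show "F h / cost v h \<le> K"
  proof (cases "cost v h = top")
    case False
    then have "F h / cost v h \<le> K * cost v h / cost v h"
      using h by (intro divide_right_mono_ennreal assms) (auto simp: less_top)
    also have "\<dots> \<le> K * 1" unfolding divide_ennreal_def mult.assoc by (intro mult_left_mono ennreal_mult_inverse_le) simp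
    finally show ?thesis by simp
  qed simp
qed

text \<open>Finiteness of S matters at cost 0: there \<open>F h > 0\<close> would make the ratio
  infinite.\<close>

lemma le_SUP_ratio:
  assumes S: "(SUP h\<in>Mplus. F h / cost v h) = S" "S < top" and h: "h \<in> Mplus" "cost v h < top"
  shows "F h \<le> S * cost v h"
proof -
  have le: "F h / cost v h \<le> S" unfolding S(1)[symmetric] using h by (intro SUP_upper) auto
  show ?thesis
  proof (cases "cost v h = 0")
    case True
    then have "F h = 0" using le S(2) by (cases "F h = 0") (auto simp: top_unique)
    then show ?thesis by simp
  next
    case False
    then have "F h = F h / cost v h * cost v h"
      using h ennreal_inverse_mult_self[of "cost v h"] by (simp add: divide_ennreal_def mult.assoc zero_less_iff_neq_zero)
    also have "\<dots> \<le> S * cost v h" by (intro mult_right_mono le) auto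
    finally show ?thesis .
  qed
qed

text \<open>Selection joined with saturation: one h is chosen from each \<open>A k\<close>, the
  coefficients \<alpha> are optimised, and the bound is uniform in the choice. Testing with a single
  function first shows that \<open>\<gamma> k h\<close> is finite and vanishes when the cost does,
  as saturation requires.\<close>

lemma sum_SUP_saturation_le:
  fixes A :: "nat \<Rightarrow> (real \<Rightarrow> ennreal) set"
  assumes q: "0 < q" "q < 1" and r: "r = q / (1 - q)" and v: "v \<in> Mplus" and K: "K < top"
    and A: "\<And>k h. h \<in> A k \<Longrightarrow> h \<in> Mplus \<and> cost v h < top"
    and test: "\<And>F h \<alpha>. finite F \<Longrightarrow> (\<And>k. k \<in> F \<Longrightarrow> h k \<in> A k) \<Longrightarrow> cost v (\<lambda>y. \<Sum>k\<in>F. \<alpha> k * h k y) < top \<Longrightarrow>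
      (\<Sum>k\<in>F. \<gamma> k (h k) * \<alpha> k epowr q) \<le> K * cost v (\<lambda>y. \<Sum>k\<in>F. \<alpha> k * h k y) epowr q"
  shows "(\<Sum>k<n. SUP h\<in>A k. \<gamma> k h epowr (1 + r) * inverse (cost v h) epowr r) \<le> K epowr (1 + r)"
proof -
  have single: "\<gamma> k h \<le> K * cost v h epowr q" if "h \<in> A k" for k h
    using test[of "{k}" "\<lambda>_. h" "\<lambda>_. 1"] that A[OF that] by simp
  have "(\<Sum>k<n. SUP h\<in>A k. \<gamma> k h epowr (1 + r) * inverse (cost v h) epowr r) + 0 \<le> K epowr (1 + r)"
  proof (rule sum_SUP_le)
    fix h assume "\<And>k. k < n \<Longrightarrow> A k \<noteq> {} \<Longrightarrow> h k \<in> A k"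
    then have h: "h k \<in> A k" if "k \<in> {k. k < n \<and> A k \<noteq> {}}" for k using that by simp
    have "(\<Sum>k | k < n \<and> A k \<noteq> {}. \<gamma> k (h k) epowr (1 + r) * inverse (cost v (h k)) epowr r) \<le> K epowr (1 + r)"
    proof (rule saturation[OF q r])
      fix k assume "k \<in> {k. k < n \<and> A k \<noteq> {}}"
      then have "h k \<in> A k" by (rule h)
      then have k: "\<gamma> k (h k) \<le> K * cost v (h k) epowr q" "cost v (h k) < top" using single A by blast+
      show "cost v (h k) < top" by (rule k)
      have "K * cost v (h k) epowr q < top" using K k q by (simp add: ennreal_mult_less_top)
      with k show "\<gamma> k (h k) < top" by (auto intro: le_less_trans)
      show "\<gamma> k (h k) = 0" if "cost v (h k) = 0" using k q that by simp
    next
      fix \<alpha> :: "nat \<Rightarrow> ennreal" assume al: "\<And>k. k \<in> {k. k < n \<and> A k \<noteq> {}} \<Longrightarrow> \<alpha> k < top"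
      have eq: "cost v (\<lambda>y. \<Sum>k | k < n \<and> A k \<noteq> {}. \<alpha> k * h k y) = (\<Sum>k | k < n \<and> A k \<noteq> {}. \<alpha> k * cost v (h k))"
        using A[OF h] by (intro cost_combination v) blast
      show "(\<Sum>k | k < n \<and> A k \<noteq> {}. \<gamma> k (h k) * \<alpha> k epowr q) \<le> K * (\<Sum>k | k < n \<and> A k \<noteq> {}. \<alpha> k * cost v (h k)) epowr q"
        unfolding eq[symmetric]
      proof (rule test[OF _ h])
        show "cost v (\<lambda>y. \<Sum>k | k < n \<and> A k \<noteq> {}. \<alpha> k * h k y) < top"
          unfolding eq using al A[OF h] by (auto simp: less_top ennreal_mult_less_top)
      qed auto
    qed simp
    then show "(\<Sum>k | k < n \<and> A k \<noteq> {}. \<gamma> k (h k) epowr (1 + r) * inverse (cost v (h k)) epowr r) + 0 \<le> K epowr (1 + r)"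
      by simp
  qed
  then show ?thesis by simp
qed

text \<open>Covers absolutely continuous and purely atomic measures alike; the total mass may be
  infinite, and the last condition confines the measure to (0, \<infinity>).\<close>

locale pos_distribution =
  fixes \<mu> :: "real measure"
  assumes sets_\<mu> [measurable_cong, simp]: "sets \<mu> = sets borel"
    and finite_\<mu>: "emeasure \<mu> {..x} < top"
    and pos_\<mu>: "emeasure \<mu> {..0} = 0"
begin

definition \<Phi> :: "real \<Rightarrow> ennreal" where
  "\<Phi> x = emeasure \<mu> {..x}"

lemma space_\<mu> [simp]: "space \<mu> = UNIV"
  using sets_eq_imp_space_eq[OF sets_\<mu>] by simp

lemma ident_\<mu> [measurable]: "(\<lambda>x. x) \<in> \<mu> \<rightarrow>\<^sub>M borel"
  by (simp add: measurable_def)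

lemma \<Phi>_mono: "x \<le> y \<Longrightarrow> \<Phi> x \<le> \<Phi> y"
  unfolding \<Phi>_def by (intro emeasure_mono) auto

lemma \<Phi>_measurable [measurable]: "\<Phi> \<in> borel_measurable borel"
  by (intro measurable_mono_ennreal monoI \<Phi>_mono)

lemma \<Phi>_less_top: "\<Phi> x < top"
  using finite_\<mu> by (simp add: \<Phi>_def)

lemma \<Phi>_eq_0: "x \<le> 0 \<Longrightarrow> \<Phi> x = 0"
  using \<Phi>_mono[of x 0] pos_\<mu> by (simp add: \<Phi>_def)

lemma emeasure_\<Phi>_le: "emeasure \<mu> {x. \<Phi> x \<le> l} \<le> l"
  by (rule emeasure_distribution_le) (auto simp: \<Phi>_def[symmetric] intro: order_trans[OF \<Phi>_mono])

lemma emeasure_\<Phi>_less: "emeasure \<mu> {x. \<Phi> x < l} \<le> l"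
  by (rule emeasure_distribution_le) (auto simp: \<Phi>_def[symmetric] intro: order.strict_trans1[OF \<Phi>_mono])

lemma AE_\<Phi>_pos: "AE x in \<mu>. 0 < \<Phi> x"
  using emeasure_\<Phi>_le[of 0] by (intro AE_I[of _ _ "{x. \<Phi> x \<le> 0}"]) auto

lemma sigma_finite_\<mu>: "sigma_finite_measure \<mu>"
proof
  let ?A = "range (\<lambda>n::nat. {..real n})"
  have "\<Union>?A = UNIV" using real_arch_simple by auto
  then show "\<exists>A. countable A \<and> A \<subseteq> sets \<mu> \<and> \<Union>A = space \<mu> \<and> (\<forall>a\<in>A. emeasure \<mu> a \<noteq> \<infinity>)"
    using finite_\<mu> by (intro exI[of _ ?A] conjI) (auto simp: less_top)
qed

lemma emeasure_lessThan_le: "emeasure \<mu> {..<y} \<le> \<Phi> y"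
  unfolding \<Phi>_def by (intro emeasure_mono) auto

text \<open>The second measure N stays general: it is Lebesgue measure for the tails of h, but
  \<open>\<mu>\<close> itself in the estimate of \<open>R\<close>.\<close>

lemma Tonelli_tail:
  assumes N: "sigma_finite_measure N"
    and id: "(\<lambda>x. x) \<in> N \<rightarrow>\<^sub>M borel" and f: "f \<in> borel_measurable N" and g: "g \<in> borel_measurable borel"
  shows "(\<integral>\<^sup>+x. (\<integral>\<^sup>+y. f y * indicator {x<..} y \<partial>N) * g x \<partial>\<mu>) =
     (\<integral>\<^sup>+y. f y * (\<integral>\<^sup>+x. g x * indicator {..<y} x \<partial>\<mu>) \<partial>N)"
proof -
  have 1: "(\<integral>\<^sup>+y. f y * indicator {x<..} y \<partial>N) * g x = (\<integral>\<^sup>+y. f y * (if x < y then 1 else 0) * g x \<partial>N)" for x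
  proof -
    have "(\<integral>\<^sup>+y. f y * indicator {x<..} y \<partial>N) * g x = (\<integral>\<^sup>+y. f y * indicator {x<..} y * g x \<partial>N)"
      by (intro nn_integral_multc[symmetric] borel_measurable_times_ennreal f measurable_compose[OF id])
         (simp add: borel_measurable_indicator)
    also have "\<dots> = (\<integral>\<^sup>+y. f y * (if x < y then 1 else 0) * g x \<partial>N)"
      by (intro nn_integral_cong) (simp add: indicator_def)
    finally show ?thesis .
  qed
  have 2: "(\<integral>\<^sup>+x. f y * (if x < y then 1 else 0) * g x \<partial>\<mu>) = f y * (\<integral>\<^sup>+x. g x * indicator {..<y} x \<partial>\<mu>)" for y
  proof -
    have "(\<integral>\<^sup>+x. f y * (if x < y then 1 else 0) * g x \<partial>\<mu>) = (\<integral>\<^sup>+x. f y * (g x * indicator {..<y} x) \<partial>\<mu>)"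
      by (intro nn_integral_cong) (simp add: indicator_def)
    also have "\<dots> = f y * (\<integral>\<^sup>+x. g x * indicator {..<y} x \<partial>\<mu>)"
      using g by (intro nn_integral_cmult) simp
    finally show ?thesis .
  qed
  have "(\<integral>\<^sup>+x. (\<integral>\<^sup>+y. f y * indicator {x<..} y \<partial>N) * g x \<partial>\<mu>) = (\<integral>\<^sup>+x. (\<integral>\<^sup>+y. f y * (if x < y then 1 else 0) * g x \<partial>N) \<partial>\<mu>)"
    unfolding 1 ..
  also have "\<dots> = (\<integral>\<^sup>+y. (\<integral>\<^sup>+x. f y * (if x < y then 1 else 0) * g x \<partial>\<mu>) \<partial>N)"
  proof (rule pair_sigma_finite.Fubini'[OF pair_sigma_finite.intro[OF sigma_finite_\<mu> N], symmetric])
    have s: "snd \<in> borel_measurable (\<mu> \<Otimes>\<^sub>M N)"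
      by (rule measurable_compose[OF measurable_snd id])
    have t: "fst \<in> borel_measurable (\<mu> \<Otimes>\<^sub>M N)"
      by (rule measurable_compose[OF measurable_fst ident_\<mu>])
    have "(\<lambda>p. f (snd p)) \<in> borel_measurable (\<mu> \<Otimes>\<^sub>M N)"
      by (rule measurable_compose[OF measurable_snd f])
    moreover have "(\<lambda>p. g (fst p)) \<in> borel_measurable (\<mu> \<Otimes>\<^sub>M N)"
      by (rule measurable_compose[OF t g])
    moreover have "(\<lambda>p. if fst p < snd p then 1 else 0 :: ennreal) \<in> borel_measurable (\<mu> \<Otimes>\<^sub>M N)"
      by (intro measurable_If borel_measurable_const borel_measurable_less t s)
    ultimately show "(\<lambda>(x, y). f y * (if x < y then 1 else 0) * g x) \<in> borel_measurable (\<mu> \<Otimes>\<^sub>M N)"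
      unfolding case_prod_beta' by (intro borel_measurable_times_ennreal)
  qed
  also have "\<dots> = (\<integral>\<^sup>+y. f y * (\<integral>\<^sup>+x. g x * indicator {..<y} x \<partial>\<mu>) \<partial>N)"
    unfolding 2 ..
  finally show ?thesis .
qed

text \<open>Let Q = K * cost and H = \<open>tail h\<close>. The pointwise condition bounds the
  integral of h * \<Phi>^(1/q) by Q and, as \<Phi> increases, also H * \<Phi>^(1/q). After
  \<open>tail_power_le\<close> and Tonelli the integrand is H^(q-1) * h * \<Phi>. It equals (H *
  \<Phi>^(1/q))^(q-1) times h * \<Phi>^(1/q): the first factor is at most Q^(q-1), and the second
  integrates to at most Q.\<close>

lemma Hardy_ge1:
  assumes hv: "h \<in> Mplus" "v \<in> Mplus" and q: "1 \<le> q" and K: "K < top"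
    and le: "AE y in Lpos. \<Phi> y epowr (1 / q) * inverse (v y) \<le> K"
    and fin: "cost v h < top"
  shows "(\<integral>\<^sup>+x. tail h x epowr q \<partial>\<mu>) \<le> 2 epowr q * (K * cost v h) epowr q"
proof -
  have [measurable]: "h \<in> borel_measurable Lpos" "v \<in> borel_measurable Lpos"
    using hv by (auto simp: Mplus_def)
  define Q where "Q = K * cost v h"
  have Q: "Q < top" using K fin by (simp add: Q_def ennreal_mult_less_top)
  have hPhi: "(\<integral>\<^sup>+y. h y * \<Phi> y epowr (1 / q) \<partial>Lpos) \<le> Q"
  proof -
    have "AE y in Lpos. h y * v y \<noteq> \<infinity>" using fin unfolding cost_def by (intro nn_integral_PInf_AE) auto
    then have "AE y in Lpos. h y * \<Phi> y epowr (1 / q) \<le> K * (h y * v y)"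
      using le
    proof (rule eventually_elim2)
      fix y assume hv: "h y * v y \<noteq> \<infinity>" and le: "\<Phi> y epowr (1 / q) * inverse (v y) \<le> K"
      show "h y * \<Phi> y epowr (1 / q) \<le> K * (h y * v y)"
      \<comment> \<open>At v y = 0 the finite K forces \<open>\<Phi> y = 0\<close>; at v y =
        \<infinity> finite cost forces h y = 0.\<close>
      proof (cases "v y" rule: ennreal_trichotomy)
        case 1
        then have "\<Phi> y epowr (1 / q) = 0" using le K by (cases "\<Phi> y epowr (1 / q) = 0") (auto simp: ennreal_mult_top top_unique)
        then show ?thesis by simp
      next
        case 2
        then have "h y = 0" using hv by (cases "h y = 0") (auto simp: ennreal_mult_top)
        then show ?thesis by simp
      next
        case (3 x)
        then have "inverse (v y) * v y = 1"
          by (simp add: inverse_ennreal ennreal_mult[symmetric])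
        then have "h y * \<Phi> y epowr (1 / q) = (\<Phi> y epowr (1 / q) * inverse (v y)) * (h y * v y)"
          by (metis mult.assoc mult.commute mult.left_neutral)
        also have "\<dots> \<le> K * (h y * v y)" by (intro mult_right_mono le) auto
        finally show ?thesis .
      qed
    qed
    then have "(\<integral>\<^sup>+y. h y * \<Phi> y epowr (1 / q) \<partial>Lpos) \<le> (\<integral>\<^sup>+y. K * (h y * v y) \<partial>Lpos)"
      by (rule nn_integral_mono_AE)
    then show ?thesis by (simp add: nn_integral_cmult Q_def cost_def)
  qed
  have key: "tail h x * \<Phi> x epowr (1 / q) \<le> Q" for x
  proof -
    have "tail h x * \<Phi> x epowr (1 / q) = (\<integral>\<^sup>+y. h y * indicator {x<..} y * \<Phi> x epowr (1 / q) \<partial>Lpos)"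
      unfolding tail_def by (subst nn_integral_multc) auto
    also have "\<dots> \<le> (\<integral>\<^sup>+y. h y * \<Phi> y epowr (1 / q) \<partial>Lpos)"
      using q by (intro nn_integral_mono) (auto split: split_indicator intro!: mult_left_mono epowr_mono \<Phi>_mono)
    finally show ?thesis using hPhi by simp
  qed
  have AE_fin: "AE x in \<mu>. tail h x < top"
    using AE_\<Phi>_pos
  proof (rule eventually_mono)
    fix x assume "0 < \<Phi> x"
    then have "\<Phi> x epowr (1 / q) \<noteq> 0" using q by simp
    then show "tail h x < top" using key[of x] Q by (auto simp: less_top[symmetric] ennreal_top_mult top_unique)
  qed
  have "(\<integral>\<^sup>+x. tail h x epowr q \<partial>\<mu>) \<le>
     (\<integral>\<^sup>+x. 2 epowr q * ((\<integral>\<^sup>+y. (tail h y epowr (q - 1) * h y) * indicator {x<..} y \<partial>Lpos) * 1) \<partial>\<mu>)"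
    using AE_fin by (intro nn_integral_mono_AE) (auto elim!: eventually_mono intro: tail_power_le[OF _ q])
  also have "\<dots> = 2 epowr q * (\<integral>\<^sup>+x. (\<integral>\<^sup>+y. (tail h y epowr (q - 1) * h y) * indicator {x<..} y \<partial>Lpos) * 1 \<partial>\<mu>)"
  proof (rule nn_integral_cmult)
    have "antimono (\<lambda>x. \<integral>\<^sup>+y. (tail h y epowr (q - 1) * h y) * indicator {x<..} y \<partial>Lpos)"
      by (intro monotoneI nn_integral_mono mult_left_mono) (auto split: split_indicator)
    then show "(\<lambda>x. (\<integral>\<^sup>+y. (tail h y epowr (q - 1) * h y) * indicator {x<..} y \<partial>Lpos) * 1) \<in> borel_measurable \<mu>"
      using measurable_antimono_ennreal by simp
  qed
  also have "(\<integral>\<^sup>+x. (\<integral>\<^sup>+y. (tail h y epowr (q - 1) * h y) * indicator {x<..} y \<partial>Lpos) * 1 \<partial>\<mu>)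
     = (\<integral>\<^sup>+y. (tail h y epowr (q - 1) * h y) * (\<integral>\<^sup>+x. 1 * indicator {..<y} x \<partial>\<mu>) \<partial>Lpos)"
    by (rule Tonelli_tail[OF sigma_finite_Lpos]) auto
  also have "\<dots> \<le> (\<integral>\<^sup>+y. Q epowr (q - 1) * (h y * \<Phi> y epowr (1 / q)) \<partial>Lpos)"
  proof (intro nn_integral_mono)
    fix y
    have "\<Phi> y = \<Phi> y epowr ((1 / q) * (q - 1)) * \<Phi> y epowr (1 / q)"
      using q by (subst epowr_add[symmetric]) (auto simp: field_simps)
    then have "tail h y epowr (q - 1) * \<Phi> y = (tail h y * \<Phi> y epowr (1 / q)) epowr (q - 1) * \<Phi> y epowr (1 / q)"
      using q by (simp add: epowr_mult epowr_epowr mult.assoc)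
    also have "\<dots> \<le> Q epowr (q - 1) * \<Phi> y epowr (1 / q)"
      using q by (intro mult_right_mono epowr_mono key) auto
    finally have *: "tail h y epowr (q - 1) * \<Phi> y \<le> Q epowr (q - 1) * \<Phi> y epowr (1 / q)" .
    have "tail h y epowr (q - 1) * h y * (\<integral>\<^sup>+x. 1 * indicator {..<y} x \<partial>\<mu>) \<le> tail h y epowr (q - 1) * h y * \<Phi> y"
      using emeasure_lessThan_le by (intro mult_left_mono) auto
    also have "\<dots> = h y * (tail h y epowr (q - 1) * \<Phi> y)" by (simp add: ac_simps)
    also have "\<dots> \<le> h y * (Q epowr (q - 1) * \<Phi> y epowr (1 / q))" by (intro mult_left_mono *) auto
    finally show "tail h y epowr (q - 1) * h y * (\<integral>\<^sup>+x. 1 * indicator {..<y} x \<partial>\<mu>) \<le> Q epowr (q - 1) * (h y * \<Phi> y epowr (1 / q))"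
      by (simp add: ac_simps)
  qed
  also have "\<dots> = Q epowr (q - 1) * (\<integral>\<^sup>+y. h y * \<Phi> y epowr (1 / q) \<partial>Lpos)"
    by (rule nn_integral_cmult) measurable
  also have "\<dots> \<le> Q epowr (q - 1) * Q" by (intro mult_left_mono hPhi) auto
  also have "\<dots> = Q epowr q" using epowr_add[of "q - 1" 1 Q] q by simp
  finally show ?thesis unfolding Q_def by (simp add: mult_left_mono)
qed

text \<open>The least non-increasing majorant of \<Phi> * rho. Its monotonicity lets 1 / R leave the
  integral over \<open>{..<y}\<close> when R serves as the weight in Hoelder's inequality.\<close>

definition R :: "(real \<Rightarrow> ennreal) \<Rightarrow> real \<Rightarrow> ennreal" where
  "R v x = (SUP z\<in>{x..}. \<Phi> z * rho v z)"

lemma R_antimono: "x \<le> y \<Longrightarrow> R v y \<le> R v x"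
  unfolding R_def by (intro SUP_subset_mono) auto

lemma R_measurable [measurable]: "R v \<in> borel_measurable borel"
  by (intro measurable_antimono_ennreal monotoneI R_antimono)

text \<open>If \<Phi> z \<le> 2 * \<Phi> x, the boundary term suffices. Otherwise put l = \<Phi> z /
  2: mass at least l sits at points y of (x, z] with \<Phi> y \<ge> l, and there the integrand is at
  least l^r * rho(z)^r / \<Phi> z. The factor l / \<Phi> z = 1/2 accounts for the exponent r +
  1.\<close>

lemma R_power_le:
  assumes r: "0 < r"
  shows "R v x epowr r \<le> 2 epowr r * (\<Phi> x * rho v x) epowr r +
     2 epowr (r + 1) * (\<integral>\<^sup>+y. \<Phi> y epowr r * rho v y epowr r * inverse (\<Phi> y) * indicator {x<..} y \<partial>\<mu>)"
    (is "_ \<le> ?A + _ * ?I")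
proof -
  have "(\<Phi> z * rho v z) epowr r \<le> ?A + 2 epowr (r + 1) * ?I" if z: "x \<le> z" for z
  proof (cases "\<Phi> z \<le> 2 * \<Phi> x")
    case True
    have "(\<Phi> z * rho v z) epowr r \<le> (2 * (\<Phi> x * rho v x)) epowr r"
      unfolding mult.assoc[symmetric]
      using r by (intro epowr_mono mult_mono True rho_antimono z) auto
    then show ?thesis using r by (simp add: epowr_mult add_increasing2)
  next
    case False
    obtain f where f: "\<Phi> z = ennreal f" "0 < f"
      using False \<Phi>_less_top[of z] by (cases "\<Phi> z" rule: ennreal_trichotomy) auto
    define l where "l = ennreal (f / 2)"
    have l: "\<Phi> z = l + l" "l < top" "2 * l = \<Phi> z" "l * inverse (\<Phi> z) = inverse 2"
      using f by (auto simp: l_def ennreal_plus[symmetric] inverse_ennreal ennreal_mult[symmetric] simp del: ennreal_plus ennreal_half)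
         (auto simp: mult_2 ennreal_plus[symmetric] simp del: ennreal_plus)
    define G where "G = {y. y \<le> z \<and> l \<le> \<Phi> y}"
    have [measurable]: "G \<in> sets borel" unfolding G_def by measurable
    have xG: "x < y" if "y \<in> G" for y
    proof (rule ccontr)
      assume "\<not> x < y"
      then have "\<Phi> y \<le> \<Phi> x" by (intro \<Phi>_mono) auto
      then have "2 * l \<le> 2 * \<Phi> x" using that by (intro mult_left_mono) (auto simp: G_def)
      then show False using False l by simp
    qed
    have "\<Phi> z \<le> emeasure \<mu> (G \<union> {y. \<Phi> y < l})"
      unfolding \<Phi>_def[of z] by (intro emeasure_mono) (auto simp: G_def)
    also have "\<dots> \<le> emeasure \<mu> G + emeasure \<mu> {y. \<Phi> y < l}"
      by (intro emeasure_subadditive) auto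
    also have "\<dots> \<le> emeasure \<mu> G + l" by (intro add_left_mono emeasure_\<Phi>_less)
    finally have G: "l \<le> emeasure \<mu> G" unfolding l(1) by (rule ennreal_le_cancel_right[OF l(2)])
    let ?c = "l epowr r * rho v z epowr r * inverse (\<Phi> z)"
    have "?c * l \<le> ?c * emeasure \<mu> G" by (intro mult_left_mono G) auto
    also have "\<dots> = (\<integral>\<^sup>+y. ?c * indicator G y \<partial>\<mu>)" by (subst nn_integral_cmult_indicator) auto
    also have "\<dots> \<le> ?I"
    proof (intro nn_integral_mono)
      fix y
      show "?c * indicator G y \<le> \<Phi> y epowr r * rho v y epowr r * inverse (\<Phi> y) * indicator {x<..} y"
      proof (cases "y \<in> G")
        case True
        then have "?c \<le> \<Phi> y epowr r * rho v y epowr r * inverse (\<Phi> y)"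
          using r by (intro mult_mono epowr_mono ennreal_inverse_mono' rho_antimono \<Phi>_mono) (auto simp: G_def)
        then show ?thesis using True xG by (simp add: indicator_def)
      qed simp
    qed
    finally have *: "?c * l \<le> ?I" .
    have "(\<Phi> z * rho v z) epowr r = 2 epowr r * (l epowr r * rho v z epowr r)"
      using r unfolding l(3)[symmetric] by (simp add: epowr_mult mult.assoc)
    also have "\<dots> = 2 epowr r * (2 * inverse 2) * (l epowr r * rho v z epowr r)"
      by (simp add: ennreal_divide_self[of 2, unfolded divide_ennreal_def])
    also have "\<dots> = 2 epowr (r + 1) * (?c * l)"
      unfolding l(4)[symmetric] using r by (simp add: epowr_add ac_simps)
    also have "\<dots> \<le> 2 epowr (r + 1) * ?I" by (intro mult_left_mono *) auto
    finally show ?thesis by (simp add: add_increasing)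
  qed
  then have "R v x \<le> (?A + 2 epowr (r + 1) * ?I) epowr (1 / r)"
    unfolding R_def using r by (intro SUP_least) (simp add: epowr_le_swap)
  then show ?thesis using r by (simp add: epowr_le_swap)
qed

text \<open>Tonelli turns the inner integral of \<open>R_power_le\<close> into the mass of
  \<open>{..<y}\<close>, which is at most \<Phi> y and cancels the factor
  \<open>inverse (\<Phi> y)\<close>.\<close>

lemma nn_integral_R_le:
  assumes r: "0 < r"
  shows "(\<integral>\<^sup>+x. R v x epowr r \<partial>\<mu>) \<le> 2 epowr (r + 2) * (\<integral>\<^sup>+x. \<Phi> x epowr r * rho v x epowr r \<partial>\<mu>)"
proof -
  let ?D = "\<integral>\<^sup>+x. \<Phi> x epowr r * rho v x epowr r \<partial>\<mu>"
  let ?g = "\<lambda>y. \<Phi> y epowr r * rho v y epowr r * inverse (\<Phi> y)"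
  have g: "?g \<in> borel_measurable borel" by measurable
  have int: "(\<lambda>x. \<integral>\<^sup>+y. ?g y * indicator {x<..} y \<partial>\<mu>) \<in> borel_measurable borel"
    by (intro measurable_antimono_ennreal monotoneI nn_integral_mono mult_left_mono) (auto split: split_indicator)
  have "(\<integral>\<^sup>+x. R v x epowr r \<partial>\<mu>) \<le>
     (\<integral>\<^sup>+x. 2 epowr r * (\<Phi> x * rho v x) epowr r + 2 epowr (r + 1) * (\<integral>\<^sup>+y. ?g y * indicator {x<..} y \<partial>\<mu>) \<partial>\<mu>)"
    by (intro nn_integral_mono R_power_le r)
  also have "\<dots> = 2 epowr r * ?D + 2 epowr (r + 1) * (\<integral>\<^sup>+x. (\<integral>\<^sup>+y. ?g y * indicator {x<..} y \<partial>\<mu>) \<partial>\<mu>)"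
    using r int by (subst nn_integral_add) (auto simp: nn_integral_cmult epowr_mult)
  also have "(\<integral>\<^sup>+x. (\<integral>\<^sup>+y. ?g y * indicator {x<..} y \<partial>\<mu>) \<partial>\<mu>) = (\<integral>\<^sup>+y. ?g y * (\<integral>\<^sup>+x. 1 * indicator {..<y} x \<partial>\<mu>) \<partial>\<mu>)"
    using Tonelli_tail[OF sigma_finite_\<mu> ident_\<mu>, of ?g "\<lambda>_. 1"] g by simp
  also have "\<dots> \<le> ?D"
  proof (intro nn_integral_mono)
    fix y
    have "?g y * (\<integral>\<^sup>+x. 1 * indicator {..<y} x \<partial>\<mu>) \<le> ?g y * \<Phi> y"
      using emeasure_lessThan_le by (intro mult_left_mono) auto
    also have "\<dots> = \<Phi> y epowr r * rho v y epowr r * (inverse (\<Phi> y) * \<Phi> y)" by (simp add: mult.assoc)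
    also have "\<dots> \<le> \<Phi> y epowr r * rho v y epowr r * 1"
      using \<Phi>_less_top[of y] by (intro mult_left_mono) (cases "\<Phi> y" rule: ennreal_trichotomy; simp add: inverse_ennreal ennreal_mult[symmetric])+
    finally show "?g y * (\<integral>\<^sup>+x. 1 * indicator {..<y} x \<partial>\<mu>) \<le> \<Phi> y epowr r * rho v y epowr r" by simp
  qed
  finally have "(\<integral>\<^sup>+x. R v x epowr r \<partial>\<mu>) \<le> 2 epowr r * ?D + 2 epowr (r + 1) * ?D"
    by (simp add: add_left_mono mult_left_mono)
  also have "\<dots> \<le> 2 epowr (r + 1) * ?D + 2 epowr (r + 1) * ?D"
  proof (intro add_right_mono mult_right_mono)
    have "2 epowr r * 1 \<le> 2 epowr r * 2" by (intro mult_left_mono) auto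
    then show "2 epowr r \<le> 2 epowr (r + 1)" using r by (simp add: epowr_add)
  qed auto
  also have "\<dots> = 2 epowr (r + 2) * ?D"
  proof -
    have "2 epowr (r + 2) = 2 epowr (r + 1) * 2" using r epowr_add[of "r + 1" 1 2] by (simp add: add.assoc)
    then show ?thesis by (simp only: mult_2[symmetric] ac_simps)
  qed
  finally show ?thesis .
qed

lemma inverse_R_le:
  assumes v: "inverse (v y) \<le> rho v y"
  shows "inverse (R v y) * \<Phi> y \<le> v y"
proof -
  have Pr: "\<Phi> y * rho v y \<le> R v y" unfolding R_def by (intro SUP_upper) auto
  show ?thesis
  proof (cases "\<Phi> y = 0 \<or> v y = top \<or> R v y = top")
    case False
    then obtain f where f: "\<Phi> y = ennreal f" "0 < f"
      using \<Phi>_less_top[of y] by (cases "\<Phi> y" rule: ennreal_trichotomy) auto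
    have le: "\<Phi> y * inverse (v y) \<le> R v y"
      using v Pr by (meson mult_left_mono order_trans zero_le)
    have "v y \<noteq> 0" using le f False by (auto simp: ennreal_mult_top top_unique)
    then obtain x where x: "v y = ennreal x" "0 < x"
      using False by (cases "v y" rule: ennreal_trichotomy) auto
    have "R v y \<noteq> 0" using le f x by (auto simp: inverse_ennreal ennreal_mult[symmetric])
    then obtain s where s: "R v y = ennreal s" "0 < s"
      using False by (cases "R v y" rule: ennreal_trichotomy) auto
    show ?thesis using le f x s
      by (auto simp: inverse_ennreal ennreal_mult[symmetric] field_simps)
  qed auto
qed

text \<open>Hoelder's inequality for H^q = (H / R)^q * (R^r)^(1 - q), which is an identity because r
  (1 - q) = q. In the integral of H / R the order of integration is exchanged; since 1 / R
  increases, the inner integral over \<open>{..<y}\<close> is at most \<Phi> y / R y, hence at most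
  v y, and the cost of h appears.\<close>

lemma Hardy_less1:
  assumes hv: "h \<in> Mplus" "v \<in> Mplus" and q: "0 < q" "q < 1" and r: "r = q / (1 - q)"
    and D: "(\<integral>\<^sup>+x. \<Phi> x epowr r * rho v x epowr r \<partial>\<mu>) < top"
    and fin: "cost v h < top"
  shows "(\<integral>\<^sup>+x. tail h x epowr q \<partial>\<mu>) \<le> cost v h epowr q *
     (2 epowr (r + 2) * (\<integral>\<^sup>+x. \<Phi> x epowr r * rho v x epowr r \<partial>\<mu>)) epowr (1 - q)"
proof -
  have [measurable]: "h \<in> borel_measurable Lpos" "v \<in> borel_measurable Lpos"
    using hv by (auto simp: Mplus_def)
  have r0: "0 < r" "r * (1 - q) = q" using q by (auto simp: r)
  have IR: "(\<integral>\<^sup>+x. R v x epowr r \<partial>\<mu>) \<le> 2 epowr (r + 2) * (\<integral>\<^sup>+x. \<Phi> x epowr r * rho v x epowr r \<partial>\<mu>)"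
    by (rule nn_integral_R_le[OF r0(1)])
  also have "\<dots> < top" using D r0 by (intro ennreal_mult_less_top[THEN iffD2]) auto
  finally have "AE x in \<mu>. R v x epowr r \<noteq> \<infinity>" by (intro nn_integral_PInf_AE) auto
  then have "AE x in \<mu>. tail h x epowr q \<le> (tail h x * inverse (R v x)) epowr q * (R v x epowr r) epowr (1 - q)"
    using AE_\<Phi>_pos
  proof (rule eventually_elim2)
    fix x assume Rx: "R v x epowr r \<noteq> \<infinity>" and Phi: "0 < \<Phi> x"
    have x0: "0 < x" using Phi \<Phi>_eq_0[of x] by (cases "x \<le> 0") auto
    show "tail h x epowr q \<le> (tail h x * inverse (R v x)) epowr q * (R v x epowr r) epowr (1 - q)"
    \<comment> \<open>Where R vanishes the factorisation breaks down, but there rho = 0 and the tail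
      itself is 0.\<close>
    proof (cases "R v x = 0")
      case True
      have "\<Phi> x * rho v x \<le> R v x" unfolding R_def by (intro SUP_upper) auto
      then have "rho v x = 0" using True Phi by auto
      then have "tail h x = 0" using x0 fin by (intro tail_eq_0_if_rho_eq_0) auto
      then show ?thesis using q by simp
    next
      case False
      then obtain s where s: "R v x = ennreal s" "0 < s"
        using Rx r0 by (cases "R v x" rule: ennreal_trichotomy) auto
      have "(inverse (R v x)) epowr q * (R v x epowr r) epowr (1 - q) = 1"
        unfolding epowr_epowr r0(2) inverse_epowr using s
        by (simp add: epowr_ennreal inverse_ennreal ennreal_mult[symmetric])
      then show ?thesis using q by (simp add: epowr_mult mult.assoc)
    qed
  qed
  then have "(\<integral>\<^sup>+x. tail h x epowr q \<partial>\<mu>) \<le> (\<integral>\<^sup>+x. (tail h x * inverse (R v x)) epowr q * (R v x epowr r) epowr (1 - q) \<partial>\<mu>)"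
    by (rule nn_integral_mono_AE)
  also have "\<dots> \<le> (\<integral>\<^sup>+x. tail h x * inverse (R v x) \<partial>\<mu>) epowr q * (\<integral>\<^sup>+x. R v x epowr r \<partial>\<mu>) epowr (1 - q)"
    by (rule nn_integral_Holder[OF _ _ q]) measurable
  also have "\<dots> \<le> cost v h epowr q *
     (2 epowr (r + 2) * (\<integral>\<^sup>+x. \<Phi> x epowr r * rho v x epowr r \<partial>\<mu>)) epowr (1 - q)"
  proof (intro mult_mono epowr_mono IR)
    have "(\<integral>\<^sup>+x. tail h x * inverse (R v x) \<partial>\<mu>) = (\<integral>\<^sup>+y. h y * (\<integral>\<^sup>+x. inverse (R v x) * indicator {..<y} x \<partial>\<mu>) \<partial>Lpos)"
      unfolding tail_def by (rule Tonelli_tail[OF sigma_finite_Lpos]) measurable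
    also have "\<dots> \<le> cost v h"
    proof (unfold cost_def, intro nn_integral_mono_AE eventually_mono[OF AE_inverse_le_rho[of v]] mult_left_mono)
      fix y assume y: "inverse (v y) \<le> rho v y"
      have "(\<integral>\<^sup>+x. inverse (R v x) * indicator {..<y} x \<partial>\<mu>) \<le> (\<integral>\<^sup>+x. inverse (R v y) * indicator {..<y} x \<partial>\<mu>)"
        by (intro nn_integral_mono) (auto split: split_indicator intro!: ennreal_inverse_mono' R_antimono)
      also have "\<dots> = inverse (R v y) * emeasure \<mu> {..<y}" by (rule nn_integral_cmult_indicator) simp
      also have "\<dots> \<le> inverse (R v y) * \<Phi> y" by (intro mult_left_mono emeasure_lessThan_le) auto
      also have "\<dots> \<le> v y" by (rule inverse_R_le[OF y])
      finally show "(\<integral>\<^sup>+x. inverse (R v x) * indicator {..<y} x \<partial>\<mu>) \<le> v y" .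
    qed auto
    finally show "(\<integral>\<^sup>+x. tail h x * inverse (R v x) \<partial>\<mu>) \<le> cost v h" .
  qed (use q in auto)
  finally show ?thesis .
qed

end

section \<open>Necessity of the integral condition for q < 1\<close>

context pos_distribution
begin

text \<open>Necessity is tested on dyadic levels of \<open>\<Phi>\<close>: on the level \<open>E i\<close> both \<open>\<mu>\<close> and \<open>\<Phi>\<close> are of size
  \<open>lev i\<close>, and a mass placed in \<open>E i\<close> is seen by a set of measure at least \<open>lev i / 2\<close>.\<close>

lemma Hardy_less1_levels:
  fixes a :: real and N :: nat
  assumes v: "v \<in> Mplus" and q: "0 < q" "q < 1" and r: "r = q / (1 - q)" and C: "C < top"
    and test: "\<And>h. h \<in> Mplus \<Longrightarrow> cost v h < top \<Longrightarrow>
      (\<integral>\<^sup>+x. tail h x epowr q \<partial>\<mu>) \<le> (C * cost v h) epowr q"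
    and a: "0 < a"
  shows "(\<integral>\<^sup>+x. \<Phi> x epowr r * rho v x epowr r * indicator {x. ennreal a \<le> \<Phi> x \<and> \<Phi> x < ennreal (a * 2 ^ N)} x \<partial>\<mu>)
     \<le> 8 epowr (1 + r) * C epowr r"
proof -
  have [measurable]: "v \<in> borel_measurable Lpos" using v by (simp add: Mplus_def)
  have r0: "0 < r" "q * (1 + r) = r" using q by (auto simp: r field_simps)
  define lev where "lev i = ennreal (a * 2 ^ i)" for i :: nat
  have lev: "lev (Suc i) = 2 * lev i" "0 < lev i" "lev i < top" for i
    using a by (auto simp: lev_def ennreal_mult''[symmetric] ennreal_numeral[symmetric] ennreal_mult[symmetric] mult.left_commute simp del: ennreal_numeral)
  have lev_mono: "i \<le> j \<Longrightarrow> lev i \<le> lev j" for i j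
    using a by (auto simp: lev_def intro!: ennreal_leI)
  define E where "E i = {x. lev i \<le> \<Phi> x \<and> \<Phi> x < lev (Suc i)}" for i
  have [measurable]: "E i \<in> sets borel" for i unfolding E_def by measurable
  \<comment> \<open>Test functions for level i: mass at least 1 to the right of some point of
    \<open>E i\<close>, hence a tail of at least 1 everywhere to the left of that point.\<close>
  define A where "A i = {h \<in> Mplus. cost v h < top \<and> (\<exists>y\<in>E i. 1 \<le> tail h y)}" for i
  \<comment> \<open>Approximate unit masses just beyond y have inverse costs arbitrarily close to
    \<open>rho v y\<close>.\<close>
  have rho_SUP: "rho v y epowr r \<le> (SUP h\<in>A i. inverse (cost v h) epowr r)" if y: "y \<in> E i" for y i
  proof -
    let ?S = "SUP h\<in>A i. inverse (cost v h) epowr r"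
    have "0 < \<Phi> y" using y lev(2)[of i] by (auto simp: E_def)
    then have y0: "0 \<le> y" using \<Phi>_eq_0[of y] by (cases "y \<le> 0") auto
    have "rho v y \<le> ?S epowr (1 / r)"
    proof (rule dense_le)
      fix l assume l: "l < rho v y"
      show "l \<le> ?S epowr (1 / r)"
      proof (cases "l = 0")
        case False
        obtain h where h: "h \<in> Mplus" "1 \<le> tail h y" "cost v h \<le> inverse l"
          using approx_point_mass[OF v y0 l] by blast
        have "inverse l < top" using False by (simp add: less_top[symmetric])
        then have "h \<in> A i" using h y by (auto simp: A_def)
        moreover have "l \<le> inverse (cost v h)" using ennreal_inverse_mono'[OF h(3)] by simp
        ultimately have "l epowr r \<le> ?S" using r0 by (intro SUP_upper2 epowr_mono) auto
        then show ?thesis using r0 by (simp add: epowr_le_swap)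
      qed simp
    qed
    then show ?thesis using r0 by (simp add: epowr_le_swap)
  qed
  have int_E: "(\<integral>\<^sup>+x. \<Phi> x epowr r * rho v x epowr r * indicator (E i) x \<partial>\<mu>) \<le>
     (SUP h\<in>A i. 2 epowr (1 + r) * (lev i epowr (1 + r) * inverse (cost v h) epowr r))" for i
  proof -
    let ?S = "SUP h\<in>A i. inverse (cost v h) epowr r"
    have "(\<integral>\<^sup>+x. \<Phi> x epowr r * rho v x epowr r * indicator (E i) x \<partial>\<mu>) \<le>
       (\<integral>\<^sup>+x. lev (Suc i) epowr r * ?S * indicator (E i) x \<partial>\<mu>)"
    proof (intro nn_integral_mono)
      fix x
      show "\<Phi> x epowr r * rho v x epowr r * indicator (E i) x \<le> lev (Suc i) epowr r * ?S * indicator (E i) x"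
      proof (cases "x \<in> E i")
        case True
        then have "\<Phi> x epowr r * rho v x epowr r \<le> lev (Suc i) epowr r * ?S"
          using r0 by (intro mult_mono epowr_mono rho_SUP) (auto simp: E_def)
        then show ?thesis using True by simp
      qed simp
    qed
    also have "\<dots> = lev (Suc i) epowr r * ?S * emeasure \<mu> (E i)"
      by (rule nn_integral_cmult_indicator) simp
    also have "\<dots> \<le> lev (Suc i) epowr r * ?S * lev (Suc i)"
    proof (intro mult_left_mono)
      have "emeasure \<mu> (E i) \<le> emeasure \<mu> {x. \<Phi> x < lev (Suc i)}"
        by (intro emeasure_mono) (auto simp: E_def)
      also have "\<dots> \<le> lev (Suc i)" by (rule emeasure_\<Phi>_less)
      finally show "emeasure \<mu> (E i) \<le> lev (Suc i)" .
    qed simp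
    also have "\<dots> = lev (Suc i) epowr (1 + r) * ?S"
      using r0 by (simp add: epowr_add ac_simps)
    also have "\<dots> = 2 epowr (1 + r) * (lev i epowr (1 + r) * ?S)"
      using r0 by (simp only: lev(1), subst epowr_mult) (auto simp: mult.assoc)
    also have "\<dots> = (SUP h\<in>A i. 2 epowr (1 + r) * (lev i epowr (1 + r) * inverse (cost v h) epowr r))"
      by (simp add: SUP_mult_left_ennreal)
    finally show ?thesis .
  qed
  have choice: "(\<Sum>i\<in>F. lev i * \<alpha> i epowr q) \<le> 4 * C epowr q * cost v g epowr q"
    if F: "finite F" and hA: "\<And>i. i \<in> F \<Longrightarrow> h i \<in> A i" and g: "g = (\<lambda>y. \<Sum>i\<in>F. \<alpha> i * h i y)" and fin: "cost v g < top" for F h \<alpha> g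
  proof -
    have hM: "h i \<in> Mplus" if "i \<in> F" for i using hA[OF that] by (auto simp: A_def)
    have "\<forall>i\<in>F. \<exists>y. y \<in> E i \<and> 1 \<le> tail (h i) y" using hA by (auto simp: A_def)
    then obtain y where y: "\<And>i. i \<in> F \<Longrightarrow> y i \<in> E i" "\<And>i. i \<in> F \<Longrightarrow> 1 \<le> tail (h i) (y i)" by metis
    \<comment> \<open>Half of \<open>lev i\<close>: the set where \<Phi> < \<open>l i\<close> has
      mass at most \<open>l i\<close>, so the cut leaves mass at least \<open>l i\<close> in
      \<open>G i\<close>.\<close>
    define l where "l i = ennreal (a * 2 ^ i / 2)" for i
    have l: "lev i = l i + l i" "0 < l i" "l i < top" for i
      using a by (auto simp: l_def lev_def ennreal_plus[symmetric] simp del: ennreal_plus)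
    define G where "G i = {x. x \<le> y i \<and> l i \<le> \<Phi> x}" for i
    have [measurable]: "G i \<in> sets borel" for i unfolding G_def by measurable
    have emG: "l i \<le> emeasure \<mu> (G i)" if i: "i \<in> F" for i
    proof -
      have "l i + l i \<le> \<Phi> (y i)" using y(1)[OF i] by (simp add: E_def l)
      also have "\<dots> \<le> emeasure \<mu> (G i \<union> {x. \<Phi> x < l i})"
        unfolding \<Phi>_def[of "y i"] by (intro emeasure_mono) (auto simp: G_def)
      also have "\<dots> \<le> emeasure \<mu> (G i) + emeasure \<mu> {x. \<Phi> x < l i}"
        by (intro emeasure_subadditive) auto
      also have "\<dots> \<le> emeasure \<mu> (G i) + l i" by (intro add_left_mono emeasure_\<Phi>_less)
      finally show ?thesis by (rule ennreal_le_cancel_right[OF l(3)])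
    qed
    have tg: "\<alpha> i \<le> tail g x" if i: "i \<in> F" "x \<in> G i" for i x
    proof -
      have "1 \<le> tail (h i) x"
        using y(2)[OF i(1)] tail_antimono[of x "y i" "h i"] i by (auto simp: G_def)
      then have "\<alpha> i * 1 \<le> \<alpha> i * tail (h i) x" by (intro mult_left_mono) auto
      also have "\<dots> \<le> tail g x" unfolding g using F i hM by (intro tail_combination_ge) auto
      finally show ?thesis by simp
    qed
    \<comment> \<open>On \<open>G i\<close> the values of \<Phi> lie between
      \<open>lev i / 2\<close> and \<open>lev (Suc i)\<close>, the latter excluded, so the sets of
      two levels that are two or more apart are disjoint.\<close>
    have overlap: "(\<Sum>i\<in>F. indicator (G i) x) \<le> (2::ennreal)" for x
    proof -
      define T where "T = {i \<in> F. x \<in> G i}"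
      have T: "finite T" using F by (simp add: T_def)
      have near: "j \<le> Suc i" if ij: "i \<in> T" "j \<in> T" for i j
      proof (rule ccontr)
        assume "\<not> j \<le> Suc i"
        then have "lev (Suc (Suc i)) \<le> lev j" by (intro lev_mono) auto
        also have "lev j \<le> 2 * \<Phi> x" using ij by (auto simp: T_def G_def l mult_2 intro: add_mono)
        also have "2 * \<Phi> x \<le> 2 * \<Phi> (y i)" using ij by (intro mult_left_mono \<Phi>_mono) (auto simp: T_def G_def)
        also have "\<dots> < 2 * lev (Suc i)"
          using y(1)[of i] ij by (intro ennreal_mult_strict_left_mono) (auto simp: E_def T_def)
        finally show False by (simp add: lev(1)[of "Suc i"])
      qed
      have "card T \<le> 2"
      proof (cases "T = {}")
        case False
        have "T \<subseteq> {Min T, Suc (Min T)}"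
        proof
          fix j assume j: "j \<in> T"
          then have "Min T \<le> j" "j \<le> Suc (Min T)" using T near[of "Min T" j] False by auto
          then show "j \<in> {Min T, Suc (Min T)}" by auto
        qed
        then have "card T \<le> card {Min T, Suc (Min T)}" by (intro card_mono) auto
        then show ?thesis by simp
      qed simp
      moreover have "(\<Sum>i\<in>F. indicator (G i) x) = (of_nat (card T) :: ennreal)"
      proof -
        have "(\<Sum>i\<in>F. indicator (G i) x) = (\<Sum>i\<in>T. 1::ennreal)"
          using F by (intro sum.mono_neutral_cong_right) (auto simp: T_def split: split_indicator)
        then show ?thesis by simp
      qed
      ultimately show ?thesis by (metis of_nat_le_iff of_nat_numeral)
    qed
    have "(\<Sum>i\<in>F. lev i * \<alpha> i epowr q) \<le> (\<Sum>i\<in>F. 2 * (\<integral>\<^sup>+x. \<alpha> i epowr q * indicator (G i) x \<partial>\<mu>))"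
    proof (intro sum_mono)
      fix i assume i: "i \<in> F"
      have "lev i * \<alpha> i epowr q = 2 * (\<alpha> i epowr q * l i)" by (simp add: l mult_2[symmetric] ac_simps)
      also have "\<dots> \<le> 2 * (\<alpha> i epowr q * emeasure \<mu> (G i))" by (intro mult_left_mono emG i) auto
      also have "\<alpha> i epowr q * emeasure \<mu> (G i) = (\<integral>\<^sup>+x. \<alpha> i epowr q * indicator (G i) x \<partial>\<mu>)"
        by (rule nn_integral_cmult_indicator[symmetric]) simp
      finally show "lev i * \<alpha> i epowr q \<le> 2 * (\<integral>\<^sup>+x. \<alpha> i epowr q * indicator (G i) x \<partial>\<mu>)" .
    qed
    also have "\<dots> \<le> (\<Sum>i\<in>F. 2 * (\<integral>\<^sup>+x. tail g x epowr q * indicator (G i) x \<partial>\<mu>))"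
    proof (intro sum_mono mult_left_mono nn_integral_mono)
      fix i x assume i: "i \<in> F"
      show "\<alpha> i epowr q * indicator (G i) x \<le> tail g x epowr q * indicator (G i) x"
        using epowr_mono[OF tg[OF i], of x q] q by (cases "x \<in> G i") auto
    qed auto
    also have "\<dots> = 2 * (\<integral>\<^sup>+x. (\<Sum>i\<in>F. tail g x epowr q * indicator (G i) x) \<partial>\<mu>)"
      by (subst nn_integral_sum) (auto simp: sum_distrib_left)
    also have "\<dots> \<le> 2 * (\<integral>\<^sup>+x. tail g x epowr q * 2 \<partial>\<mu>)"
      unfolding sum_distrib_left[symmetric] by (intro mult_left_mono nn_integral_mono overlap) auto
    also have "\<dots> = 4 * (\<integral>\<^sup>+x. tail g x epowr q \<partial>\<mu>)"
    proof -
      have "2 * (x * 2) = 4 * x" for x :: ennreal by (simp add: mult.commute[of x] flip: mult.assoc)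
      then show ?thesis by (simp add: nn_integral_multc)
    qed
    also have "\<dots> \<le> 4 * (C * cost v g) epowr q"
      using fin combination_Mplus[of F h \<alpha>] hM unfolding g by (intro mult_left_mono test) auto
    also have "\<dots> = 4 * C epowr q * cost v g epowr q" using q by (simp add: epowr_mult mult.assoc)
    finally show ?thesis .
  qed
  have cover: "ennreal a \<le> p \<Longrightarrow> p < lev n \<Longrightarrow> \<exists>i<n. lev i \<le> p \<and> p < lev (Suc i)" for p n
  proof (induction n)
    case 0
    then show ?case by (simp add: lev_def)
  next
    case (Suc n)
    then show ?case by (cases "p < lev n") (auto simp: less_Suc_eq)
  qed
  have "(\<integral>\<^sup>+x. \<Phi> x epowr r * rho v x epowr r * indicator {x. ennreal a \<le> \<Phi> x \<and> \<Phi> x < ennreal (a * 2 ^ N)} x \<partial>\<mu>)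
    \<le> (\<integral>\<^sup>+x. (\<Sum>i<N. \<Phi> x epowr r * rho v x epowr r * indicator (E i) x) \<partial>\<mu>)"
  proof (intro nn_integral_mono)
    fix x
    show "\<Phi> x epowr r * rho v x epowr r * indicator {x. ennreal a \<le> \<Phi> x \<and> \<Phi> x < ennreal (a * 2 ^ N)} x
       \<le> (\<Sum>i<N. \<Phi> x epowr r * rho v x epowr r * indicator (E i) x)"
    proof (cases "ennreal a \<le> \<Phi> x \<and> \<Phi> x < ennreal (a * 2 ^ N)")
      case True
      then obtain i where i: "i < N" "x \<in> E i" using cover[of "\<Phi> x" N] by (auto simp: lev_def E_def)
      have "\<Phi> x epowr r * rho v x epowr r * indicator (E i) x \<le> (\<Sum>i<N. \<Phi> x epowr r * rho v x epowr r * indicator (E i) x)"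
        using i by (intro member_le_sum) auto
      then show ?thesis using True i by simp
    qed simp
  qed
  also have "\<dots> = (\<Sum>i<N. \<integral>\<^sup>+x. \<Phi> x epowr r * rho v x epowr r * indicator (E i) x \<partial>\<mu>)"
    by (rule nn_integral_sum) measurable
  also have "\<dots> \<le> (\<Sum>i<N. 2 epowr (1 + r) * (SUP h\<in>A i. lev i epowr (1 + r) * inverse (cost v h) epowr r))"
    using int_E by (intro sum_mono) (simp add: SUP_mult_left_ennreal)
  also have "\<dots> = 2 epowr (1 + r) * (\<Sum>i<N. SUP h\<in>A i. lev i epowr (1 + r) * inverse (cost v h) epowr r)"
    by (rule sum_distrib_left[symmetric])
  also have "\<dots> \<le> 2 epowr (1 + r) * (4 * C epowr q) epowr (1 + r)"
  proof (intro mult_left_mono sum_SUP_saturation_le[OF q r v])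
    show "4 * C epowr q < top" using C q by (simp add: ennreal_mult_less_top)
    show "h \<in> Mplus \<and> cost v h < top" if "h \<in> A k" for k h using that by (simp add: A_def)
  qed (auto intro: choice)
  also have "\<dots> = (2 * (4 * C epowr q)) epowr (1 + r)" using r0 by (intro epowr_mult[symmetric]) auto
  also have "\<dots> = (8 * C epowr q) epowr (1 + r)" by (simp flip: mult.assoc)
  also have "\<dots> = 8 epowr (1 + r) * C epowr r" using r0 by (simp add: epowr_mult epowr_epowr)
  finally show ?thesis .
qed

text \<open>The set \<Phi> > 0 is exhausted by 2^(-n) \<le> \<Phi> < 2^n, that is by 2 n doublings
  of the lowest level, with a constant independent of n. Where \<Phi> = 0 the integrand
  vanishes.\<close>

lemma Hardy_less1_necessary:
  assumes v: "v \<in> Mplus" and q: "0 < q" "q < 1" and r: "r = q / (1 - q)" and C: "C < top"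
    and test: "\<And>h. h \<in> Mplus \<Longrightarrow> cost v h < top \<Longrightarrow>
      (\<integral>\<^sup>+x. tail h x epowr q \<partial>\<mu>) \<le> (C * cost v h) epowr q"
  shows "(\<integral>\<^sup>+x. \<Phi> x epowr r * rho v x epowr r \<partial>\<mu>) \<le> 8 epowr (1 + r) * C epowr r"
proof -
  have r0: "0 < r" using q by (simp add: r)
  define S where "S n = {x. ennreal ((1/2) ^ n) \<le> \<Phi> x \<and> \<Phi> x < ennreal (2 ^ n)}" for n :: nat
  have [measurable]: "S n \<in> sets borel" for n unfolding S_def by measurable
  have S_mono: "S i \<subseteq> S j" if "i \<le> j" for i j
  proof -
    have "ennreal ((1/2) ^ j) \<le> ennreal ((1/2) ^ i)" "ennreal (2 ^ i) \<le> ennreal (2 ^ j)"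
      using that by (auto intro!: ennreal_leI power_decreasing)
    then show ?thesis unfolding S_def Collect_mono_iff by (meson order_trans less_le_trans)
  qed
  have int_S: "(\<integral>\<^sup>+x. \<Phi> x epowr r * rho v x epowr r * indicator (S n) x \<partial>\<mu>) \<le> 8 epowr (1 + r) * C epowr r" for n
  proof -
    have "(1/2) ^ n * 2 ^ (2 * n) = (2::real) ^ n" by (simp add: mult_2 power_add power_one_over)
    then show ?thesis
      using Hardy_less1_levels[OF v q r C test, of "(1/2) ^ n" "2 * n"] unfolding S_def by simp
  qed
  have "(\<integral>\<^sup>+x. \<Phi> x epowr r * rho v x epowr r \<partial>\<mu>) \<le> (\<integral>\<^sup>+x. (SUP n. \<Phi> x epowr r * rho v x epowr r * indicator (S n) x) \<partial>\<mu>)"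
  proof (intro nn_integral_mono)
    fix x
    show "\<Phi> x epowr r * rho v x epowr r \<le> (SUP n. \<Phi> x epowr r * rho v x epowr r * indicator (S n) x)"
    proof (cases "\<Phi> x = 0")
      case False
      then obtain p where p: "\<Phi> x = ennreal p" "0 < p"
        using \<Phi>_less_top[of x] by (cases "\<Phi> x" rule: ennreal_trichotomy) auto
      obtain n where n: "p < 2 ^ n" using real_arch_pow[of 2 p] by auto
      obtain k where k: "(1/2) ^ k < p" using real_arch_pow_inv[of p "1/2"] p by auto
      have "p < 2 ^ max n k" using n by (rule order.strict_trans2) simp
      moreover have "(1/2) ^ max n k \<le> p" using k
        by (intro order_trans[OF power_decreasing[of k "max n k"]]) auto
      ultimately have "x \<in> S (max n k)"
        unfolding S_def mem_Collect_eq p using p by (intro conjI ennreal_leI ennreal_lessI) auto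
      then show ?thesis by (intro SUP_upper2[of "max n k"]) auto
    qed (use r0 in simp)
  qed
  also have "\<dots> = (SUP n. \<integral>\<^sup>+x. \<Phi> x epowr r * rho v x epowr r * indicator (S n) x \<partial>\<mu>)"
    using S_mono by (intro nn_integral_monotone_convergence_SUP)
      (auto simp: incseq_def le_fun_def intro!: mult_left_mono split: split_indicator)
  also have "\<dots> \<le> 8 epowr (1 + r) * C epowr r" by (intro SUP_least int_S)
  finally show ?thesis .
qed

end

section \<open>The best constant of the inner inequality\<close>

lemma integ_Ioc: "0 \<le> s \<Longrightarrow> integ f s t = (\<integral>\<^sup>+y. f y * indicator {s<..t} y \<partial>Lpos)"
  unfolding integ_Lpos
  by (intro nn_integral_cong_AE eventually_mono[OF AE_Lpos_neq[of t]]) (auto split: split_indicator)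

lemma integ_mono: "0 \<le> s' \<Longrightarrow> s' \<le> s \<Longrightarrow> t \<le> t' \<Longrightarrow> integ f s t \<le> integ f s' t'"
  by (auto simp: integ_Ioc intro!: nn_integral_mono split: split_indicator)

lemma integ_empty: "0 \<le> s \<Longrightarrow> t \<le> s \<Longrightarrow> integ f s t = 0"
  by (simp add: integ_Ioc)

lemma integ_split:
  assumes [measurable]: "f \<in> borel_measurable Lpos" and "0 \<le> a" "a \<le> b" "b \<le> c"
  shows "integ f a c = integ f a b + integ f b c"
proof -
  have "integ f a c = (\<integral>\<^sup>+y. f y * indicator {a<..b} y + f y * indicator {b<..c} y \<partial>Lpos)"
    using assms by (subst integ_Ioc) (auto intro!: nn_integral_cong split: split_indicator)
  also have "\<dots> = integ f a b + integ f b c"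
    using assms by (subst nn_integral_add) (auto simp: integ_Ioc)
  finally show ?thesis .
qed

lemma integ_measurable_left [measurable]: "(\<lambda>s. integ f s t) \<in> borel_measurable Lpos"
  by (intro measurable_antimono_on monotone_onI integ_mono) auto

lemma integ_measurable_right: "0 \<le> s \<Longrightarrow> (\<lambda>t. integ f s t) \<in> borel_measurable Lpos"
  by (intro measurable_mono_on monotone_onI integ_mono) auto

text \<open>The density is only Lebesgue measurable; the image under the identity is a Borel
  measure, to which the Hardy inequalities apply.\<close>

definition dens :: "(real \<Rightarrow> ennreal) \<Rightarrow> real \<Rightarrow> real measure" where
  "dens f t = distr (density Lpos (\<lambda>y. f y * indicator {t<..} y)) borel (\<lambda>x. x)"

lemma sets_dens [simp]: "sets (dens f t) = sets borel"
  by (simp add: dens_def)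

lemma space_dens [simp]: "space (dens f t) = UNIV"
  by (simp add: dens_def)

lemma nn_integral_dens:
  assumes [measurable]: "f \<in> borel_measurable Lpos" "g \<in> borel_measurable borel"
  shows "(\<integral>\<^sup>+x. g x \<partial>dens f t) = (\<integral>\<^sup>+y. f y * indicator {t<..} y * g y \<partial>Lpos)"
  unfolding dens_def
  by (subst nn_integral_distr) (auto simp: nn_integral_density)

lemma emeasure_dens:
  assumes f: "f \<in> borel_measurable Lpos" and t: "0 \<le> t"
  shows "emeasure (dens f t) {..x} = integ f t x"
proof -
  have "emeasure (dens f t) {..x} = (\<integral>\<^sup>+y. indicator {..x} y \<partial>dens f t)" by simp
  also have "\<dots> = (\<integral>\<^sup>+y. f y * indicator {t<..} y * indicator {..x} y \<partial>Lpos)"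
    by (rule nn_integral_dens[OF f]) simp
  also have "\<dots> = integ f t x"
    using t by (auto simp: integ_Ioc intro!: nn_integral_cong split: split_indicator)
  finally show ?thesis .
qed

lemma pos_distribution_dens:
  assumes f: "f \<in> borel_measurable Lpos" and t: "0 \<le> t" and fin: "\<And>x. integ f t x < top"
  shows "pos_distribution (dens f t)"
  by standard (use t fin in \<open>auto simp: emeasure_dens[OF f t] integ_empty\<close>)

text \<open>The measure with density f on (0, x] has no atoms, so its distribution function is
  continuous and attains half of its total. Cutting f off at x makes this measure finite.\<close>

lemma integ_halving:
  assumes f[measurable]: "f \<in> borel_measurable Lpos" and x: "0 < x"
    and fin: "integ f 0 x < top" and pos: "0 < integ f 0 x"
  shows "\<exists>y. 0 < y \<and> y < x \<and> 2 * integ f 0 y = integ f 0 x"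
proof -
  define M where "M = dens (\<lambda>y. f y * indicator {..x} y) 0"
  have g: "(\<lambda>y. f y * indicator {..x} y) \<in> borel_measurable Lpos" by measurable
  have em: "emeasure M {..y} = integ f 0 y" if "y \<le> x" for y
    unfolding M_def emeasure_dens[OF g order_refl] using that
    by (auto simp: integ_Ioc intro!: nn_integral_cong split: split_indicator)
  have "emeasure M UNIV = (\<integral>\<^sup>+y. 1 \<partial>M)" by (simp add: M_def)
  also have "\<dots> = (\<integral>\<^sup>+y. f y * indicator {..x} y * indicator {0<..} y * 1 \<partial>Lpos)"
    unfolding M_def by (rule nn_integral_dens[OF g]) simp
  also have "\<dots> = integ f 0 x" by (auto simp: integ_Ioc intro!: nn_integral_cong split: split_indicator)
  finally have emU: "emeasure M UNIV = integ f 0 x" .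
  interpret finite_measure M
    by standard (use emU fin in \<open>auto simp: M_def dens_def less_top\<close>)
  interpret finite_borel_measure M by standard (simp add: M_def)
  have "emeasure M {y} = 0" for y
  proof -
    have "emeasure M {y} = (\<integral>\<^sup>+z. indicator {y} z \<partial>M)" by (simp add: M_def)
    also have "\<dots> = (\<integral>\<^sup>+z. f z * indicator {..x} z * indicator {0<..} z * indicator {y} z \<partial>Lpos)"
      unfolding M_def by (rule nn_integral_dens[OF g]) simp
    also have "\<dots> = (\<integral>\<^sup>+z. 0 \<partial>Lpos)"
      by (intro nn_integral_cong_AE eventually_mono[OF AE_Lpos_neq[of y]]) auto
    finally show ?thesis by simp
  qed
  then have "isCont (cdf M) y" for y by (simp add: isCont_cdf measure_def)
  then have cont: "continuous_on {0..x} (cdf M)" by (simp add: continuous_at_imp_continuous_on)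
  have cdf: "ennreal (cdf M y) = integ f 0 y" if "y \<le> x" for y
    using em[OF that] by (simp add: cdf_def emeasure_eq_measure[symmetric])
  have c0: "cdf M 0 = 0" using cdf[of 0] x cdf_nonneg[of 0] by (auto simp: integ_empty ennreal_eq_0_iff)
  have cx: "0 < cdf M x" using cdf[of x] pos by (metis ennreal_eq_0_iff not_le order.refl order_less_irrefl)
  obtain y where y: "0 \<le> y" "y \<le> x" "cdf M y = cdf M x / 2"
    using IVT'[of "cdf M" 0 "cdf M x / 2" x, OF _ _ _ cont] c0 cx x by auto
  have "y \<noteq> 0" "y \<noteq> x" using y c0 cx by auto
  moreover have "2 * integ f 0 y = integ f 0 x"
    using y cx cdf[OF y(2)] cdf[of x] by (simp add: ennreal_mult[symmetric] ennreal_numeral[symmetric] del: ennreal_numeral flip: cdf)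
  ultimately show ?thesis using y by (intro exI[of _ y]) auto
qed

section \<open>Exponents, admissible weights and the suprema C and B\<close>

locale exponents =
  fixes m q :: real
  assumes m: "0 < m" and q: "0 < q"
begin

abbreviation "p \<equiv> q / m"

lemma p: "0 < p" using m q by simp

end

locale weights = exponents +
  fixes u w v :: "real \<Rightarrow> ennreal"
  assumes u: "u \<in> Mplus" and w: "w \<in> Mplus" and v: "v \<in> Mplus"
    and adm: "admissible m q u w"
begin

abbreviation "U \<equiv> integ u"
abbreviation "W \<equiv> integ w 0"
abbreviation "I \<equiv> cost v"

definition phi :: "real \<Rightarrow> ennreal" where
  "phi t = integ (\<lambda>s. U s t epowr p * w s) 0 t"

definition loc :: "(real \<Rightarrow> ennreal) \<Rightarrow> real \<Rightarrow> ennreal" where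
  "loc h t = tail (\<lambda>s. tail h s epowr m * u s) t"

lemma meas [measurable]: "u \<in> borel_measurable Lpos" "w \<in> borel_measurable Lpos" "v \<in> borel_measurable Lpos"
  using u w v by (auto simp: Mplus_def)

lemma phi_bounds: "0 < t \<Longrightarrow> 0 < phi t" "0 < t \<Longrightarrow> phi t < top"
  using adm q unfolding admissible_def Let_def phi_def
  by (auto simp: less_top[symmetric] zero_less_iff_neq_zero)

lemma phi_mono: "0 < t \<Longrightarrow> t \<le> t' \<Longrightarrow> phi t \<le> phi t'"
  unfolding phi_def integ_Ioc[OF order_refl] using p
  by (intro nn_integral_mono) (auto split: split_indicator intro!: mult_right_mono epowr_mono integ_mono)

lemma phi_measurable [measurable]: "phi \<in> borel_measurable Lpos"
  by (intro measurable_mono_on monotone_onI phi_mono) auto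

text \<open>For s \<le> b the inner integral \<open>U s c\<close> is at least \<open>U b c\<close>.
  The finiteness of U and W is drawn from admissibility through this estimate.\<close>

lemma le_phi:
  assumes "0 \<le> a" "a \<le> b" "b \<le> c"
  shows "U b c epowr p * integ w a b \<le> phi c"
proof -
  have "U b c epowr p * integ w a b = (\<integral>\<^sup>+y. U b c epowr p * (w y * indicator {a<..b} y) \<partial>Lpos)"
    using assms by (simp add: integ_Ioc nn_integral_cmult)
  also have "\<dots> \<le> phi c" unfolding phi_def integ_Ioc[OF order_refl] using assms p
    by (intro nn_integral_mono) (auto split: split_indicator intro!: mult_right_mono epowr_mono integ_mono)
  finally show ?thesis .
qed

lemma W_pos: assumes "0 < t" shows "0 < W t"
proof (rule ccontr)
  assume "\<not> 0 < W t"
  then have "W t = 0" by (simp add: not_gr_zero)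
  then have "AE y in Lpos. w y * indicator {0<..t} y = 0"
    by (simp add: integ_Ioc nn_integral_0_iff_AE)
  then have "phi t = (\<integral>\<^sup>+y. 0 \<partial>Lpos)"
    unfolding phi_def integ_Ioc[OF order_refl]
    by (intro nn_integral_cong_AE) (auto elim!: eventually_mono split: split_indicator)
  then show False using phi_bounds(1)[OF assms] by simp
qed

lemma U_finite: assumes "0 < s" shows "U s t < top"
proof (cases "s < t")
  case True
  have "U s t epowr p * W s \<le> phi t" using True assms by (intro le_phi) auto
  also have "\<dots> < top" using True assms by (intro phi_bounds) auto
  finally show ?thesis using W_pos[OF assms] p
    by (cases "U s t = top") (auto simp: ennreal_top_mult less_top[symmetric] split: if_splits)
qed (use assms in \<open>simp add: integ_empty\<close>)

text \<open>Admissibility controls W s only through its product with a power of U s t, so W s may be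
  infinite where u vanishes beyond s.\<close>

lemma W_finite: assumes "0 < s" "0 < U s t" shows "W s < top"
proof -
  have "s < t" using assms integ_empty[of s t u] by (cases "s < t") auto
  then have "U s t epowr p * W s \<le> phi t" "phi t < top"
    using assms by (intro le_phi phi_bounds; simp)+
  then have "U s t epowr p * W s < top" by (rule le_less_trans)
  then show ?thesis using assms p by (cases "W s = top") (auto simp: ennreal_mult_top less_top[symmetric] split: if_splits)
qed

text \<open>The functions of \<open>approx_point_mass\<close> cost at most 1 / l for any l <
  \<open>rho v a\<close>, so testing with them gives c * l \<le> K.\<close>

lemma point_test:
  assumes a: "0 \<le> a" and K: "K < top"
    and le: "\<And>h. h \<in> Mplus \<Longrightarrow> I h < top \<Longrightarrow> (\<And>x. x \<le> a \<Longrightarrow> 1 \<le> tail h x) \<Longrightarrow> c \<le> K * I h"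
  shows "c * rho v a \<le> K"
proof (rule mult_le_if_less_le)
  fix l assume l: "l < rho v a"
  show "c * l \<le> K"
  proof (cases "l = 0")
    case False
    obtain h where h: "h \<in> Mplus" "\<forall>x\<le>a. 1 \<le> tail h x" "I h \<le> inverse l"
      using approx_point_mass[OF v a l] by blast
    have "inverse l < top" using False by (simp add: less_top[symmetric])
    then have "c \<le> K * I h" using h by (intro le) auto
    also have "\<dots> \<le> K * inverse l" by (intro mult_left_mono h) simp
    finally have "c * l \<le> K * inverse l * l" by (intro mult_right_mono) auto
    also have "\<dots> \<le> K"
    proof -
      have "l < top" using l by (rule order_less_le_trans) simp
      then have "inverse l * l = 1" using False by (cases l rule: ennreal_trichotomy) (auto simp: inverse_ennreal ennreal_mult[symmetric])
      then show ?thesis by (simp add: mult.assoc)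
    qed
    finally show ?thesis .
  qed simp
qed

lemma loc_ge:
  assumes "0 \<le> t" "\<And>x. x \<le> a \<Longrightarrow> c \<le> tail h x"
  shows "c epowr m * U t a \<le> loc h t"
proof -
  have "c epowr m * U t a = (\<integral>\<^sup>+y. c epowr m * (u y * indicator {t<..a} y) \<partial>Lpos)"
    using assms by (simp add: integ_Ioc nn_integral_cmult)
  also have "\<dots> \<le> loc h t" unfolding loc_def tail_def[of _ t] using m assms(2)
    by (intro nn_integral_mono) (auto split: split_indicator intro!: mult_right_mono epowr_mono)
  finally show ?thesis .
qed

lemma loc_antimono: "t \<le> t' \<Longrightarrow> loc h t' \<le> loc h t"
  unfolding loc_def by (rule tail_antimono)

lemma loc_measurable [measurable]: "loc h \<in> borel_measurable borel"
  by (intro measurable_antimono_ennreal monotoneI loc_antimono)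

lemma nn_integral_tail_dens: "(\<integral>\<^sup>+x. tail h x epowr m \<partial>dens u t) = loc h t"
  unfolding loc_def tail_def[of _ t]
  by (subst nn_integral_dens) (auto intro!: nn_integral_cong simp: ac_simps)

lemma loc_eq_0: assumes "0 < t" "\<And>z. U t z = 0" shows "loc h t = 0"
proof -
  have "emeasure (dens u t) UNIV \<le> 0"
    by (rule emeasure_distribution_le) (use assms emeasure_dens[of u t] in \<open>auto\<close>)
  then have "AE x in dens u t. False" by (intro AE_I[of _ _ UNIV]) (auto simp: dens_def)
  then have "(\<integral>\<^sup>+x. tail h x epowr m \<partial>dens u t) = (\<integral>\<^sup>+x. 0 \<partial>dens u t)"
    by (intro nn_integral_cong_AE) (auto elim: eventually_mono)
  then show ?thesis by (simp add: nn_integral_tail_dens)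
qed

text \<open>The q-th power of \<open>lhs_norm\<close>. The suprema C and B below use the same
  division conventions as \<open>opt_const\<close>.\<close>

definition N :: "(real \<Rightarrow> ennreal) \<Rightarrow> ennreal" where
  "N h = (\<integral>\<^sup>+y. loc h y epowr p * w y \<partial>Lpos)"

definition C :: ennreal where
  "C = (SUP h\<in>Mplus. N h epowr (1 / q) / I h)"

definition B :: "real \<Rightarrow> ennreal" where
  "B t = (SUP h\<in>Mplus. loc h t epowr (1 / m) / I h)"

lemmas N_le = le_SUP_ratio[OF C_def[symmetric]]

lemmas loc_le_B = le_SUP_ratio[OF B_def[symmetric]]

lemma B_antimono: "t \<le> t' \<Longrightarrow> B t' \<le> B t"
  unfolding B_def using m by (intro SUP_mono' divide_right_mono_ennreal epowr_mono loc_antimono) auto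

lemma B_measurable [measurable]: "B \<in> borel_measurable borel"
  by (intro measurable_antimono_ennreal monotoneI B_antimono)

lemma U_eq_0: "0 < y \<Longrightarrow> W y = top \<Longrightarrow> U y z = 0"
  using W_finite[of y z] by (auto simp: zero_less_iff_neq_zero)

lemma B_eq_0: "0 < t \<Longrightarrow> W t = top \<Longrightarrow> B t = 0"
  using m loc_eq_0[OF _ U_eq_0, of t] unfolding B_def by (intro antisym SUP_least) simp_all

text \<open>A unit mass just beyond a has tail at least 1 on (t, a], which contributes
  \<open>U t a\<close> to the inner integral.\<close>

lemma U_rho_le_B:
  assumes t: "0 \<le> t" and a: "0 \<le> a" and fin: "B t < top"
  shows "U t a epowr (1 / m) * rho v a \<le> B t"
proof (rule point_test[OF a fin])
  fix h assume h: "h \<in> Mplus" "I h < top" "\<And>x. x \<le> a \<Longrightarrow> 1 \<le> tail h x"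
  have "U t a \<le> loc h t" using loc_ge[of t a 1 h] t h by simp
  then have "U t a epowr (1 / m) \<le> loc h t epowr (1 / m)" using m by (intro epowr_mono) auto
  also have "\<dots> \<le> B t * I h" by (rule loc_le_B[OF fin]) fact+
  finally show "U t a epowr (1 / m) \<le> B t * I h" .
qed

text \<open>\<open>loc h\<close> is non-increasing, so on (0, t] the outer integrand is at least its
  value at t.\<close>

lemma W_loc_le_N: "W t * loc h t epowr p \<le> N h"
proof -
  have "W t * loc h t epowr p = (\<integral>\<^sup>+y. (w y * indicator {0<..t} y) * loc h t epowr p \<partial>Lpos)"
    by (simp add: integ_Ioc nn_integral_multc)
  also have "\<dots> \<le> N h" unfolding N_def using p
    by (intro nn_integral_mono) (auto split: split_indicator simp: mult.commute[of "w _"] intro!: mult_right_mono epowr_mono loc_antimono)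
  finally show ?thesis .
qed

lemma W_B_le: "W t epowr (1 / q) * B t \<le> C"
  unfolding B_def C_def SUP_mult_left_ennreal
proof (rule SUP_mono')
  fix h
  have "W t epowr (1 / q) * loc h t epowr (1 / m) = (W t * loc h t epowr p) epowr (1 / q)"
    using q p by (simp add: epowr_mult epowr_epowr)
  also have "\<dots> \<le> N h epowr (1 / q)" using q by (intro epowr_mono W_loc_le_N) auto
  finally show "W t epowr (1 / q) * (loc h t epowr (1 / m) / I h) \<le> N h epowr (1 / q) / I h"
    unfolding ennreal_times_divide by (rule divide_right_mono_ennreal)
qed

text \<open>A unit mass just beyond a makes the inner integral at least \<open>U y a\<close> for y
  below a, and hence the outer one at least \<open>phi a\<close>.\<close>

lemma phi_rho_le:
  assumes C: "C < top" and a: "0 \<le> a"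
  shows "phi a epowr (1 / q) * rho v a \<le> C"
proof (rule point_test[OF a C])
  fix h assume h: "h \<in> Mplus" "I h < top" "\<And>x. x \<le> a \<Longrightarrow> 1 \<le> tail h x"
  have "phi a = (\<integral>\<^sup>+y. U y a epowr p * w y * indicator {0<..a} y \<partial>Lpos)"
    by (simp add: phi_def integ_Ioc)
  also have "\<dots> \<le> N h" unfolding N_def using p h(3) loc_ge[of _ a 1 h]
    by (intro nn_integral_mono) (auto split: split_indicator intro!: mult_right_mono epowr_mono)
  finally have "phi a epowr (1 / q) \<le> N h epowr (1 / q)" using q by (intro epowr_mono) auto
  also have "\<dots> \<le> C * I h" by (rule N_le[OF C]) fact+
  finally show "phi a epowr (1 / q) \<le> C * I h" .
qed

end

section \<open>Discretisation\<close>

text \<open>Two families of atoms: the second will sit at the block ends, the first at freely chosen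
  points, which the lower bounds use. Taking the image of a weighted index set counts masses
  correctly when points coincide.\<close>

definition atoms :: "(nat \<Rightarrow> ennreal) \<Rightarrow> (nat \<Rightarrow> real) \<Rightarrow> (nat \<Rightarrow> ennreal) \<Rightarrow> (nat \<Rightarrow> real) \<Rightarrow> real measure" where
  "atoms b \<tau> c \<sigma> = distr (density (count_space UNIV) (\<lambda>(f, k). if f then b k else c k)) borel
     (\<lambda>(f, k). if f then \<tau> k else \<sigma> k)"

lemma sets_atoms [simp]: "sets (atoms b \<tau> c \<sigma>) = sets borel"
  by (simp add: atoms_def)

lemma nn_integral_atoms:
  assumes "g \<in> borel_measurable borel"
  shows "(\<integral>\<^sup>+x. g x \<partial>atoms b \<tau> c \<sigma>) = (\<Sum>k. b k * g (\<tau> k)) + (\<Sum>k. c k * g (\<sigma> k))"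
proof -
  have "(\<integral>\<^sup>+x. g x \<partial>atoms b \<tau> c \<sigma>) =
    (\<integral>\<^sup>+z. (case z of (f, k) \<Rightarrow> (if f then b k else c k) * g (if f then \<tau> k else \<sigma> k)) \<partial>count_space UNIV)"
    unfolding atoms_def using assms
    by (subst nn_integral_distr) (auto simp: nn_integral_density case_prod_beta' intro!: nn_integral_cong)
  also have "\<dots> = (\<integral>\<^sup>+f. \<integral>\<^sup>+k. (if f then b k else c k) * g (if f then \<tau> k else \<sigma> k) \<partial>count_space UNIV \<partial>count_space UNIV)"
    by (subst nn_integral_fst_count_space[symmetric]) simp
  also have "\<dots> = (\<Sum>k. b k * g (\<tau> k)) + (\<Sum>k. c k * g (\<sigma> k))"
    by (subst nn_integral_count_space_finite) (auto simp: UNIV_bool nn_integral_count_space_nat add.commute)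
  finally show ?thesis .
qed

lemma emeasure_atoms:
  "emeasure (atoms b \<tau> c \<sigma>) {..y} = (\<Sum>k. b k * indicator {..y} (\<tau> k)) + (\<Sum>k. c k * indicator {..y} (\<sigma> k))"
proof -
  have "emeasure (atoms b \<tau> c \<sigma>) {..y} = (\<integral>\<^sup>+x. indicator {..y} x \<partial>atoms b \<tau> c \<sigma>)" by simp
  also have "\<dots> = (\<Sum>k. b k * indicator {..y} (\<tau> k)) + (\<Sum>k. c k * indicator {..y} (\<sigma> k))" by (rule nn_integral_atoms) simp
  finally show ?thesis .
qed

lemma mult_rho_power_le:
  assumes v: "v \<in> Mplus" and a: "0 \<le> a" and c: "c < top" and r: "0 < r"
    and le: "AE z in Lpos. a < z \<longrightarrow> c * inverse (v z) epowr r \<le> K"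
  shows "c * rho v a epowr r \<le> K"
proof -
  define d where "d = c epowr (1 / r)"
  have d: "d epowr r = c" "d < top" using r c by (auto simp: d_def epowr_epowr)
  have le_iff: "d * x \<le> K epowr (1 / r) \<longleftrightarrow> c * x epowr r \<le> K" for x
    using r epowr_le_swap[of r "d * x" K] by (simp add: epowr_mult d)
  have "d * rho v a \<le> K epowr (1 / r)"
    unfolding rho_def esssup_from_def
  proof (rule mult_esssup_le[OF _ d(2)])
    show "(\<lambda>y. inverse (v y)) \<in> borel_measurable (lebesgue_on {a<..})"
      using measurable_from[OF v a] by (rule borel_measurable_inverse_ennreal)
    show "AE x in lebesgue_on {a<..}. d * inverse (v x) \<le> K epowr (1 / r)"
      unfolding AE_from_iff[OF a] le_iff by (rule le)
  qed
  then show ?thesis by (simp add: le_iff)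
qed

context weights
begin

text \<open>The points with W x < \<infinity> are closed to the left, and up to each of them blocks
  exist. Beyond them u vanishes, which in the applications makes the integrand 0.\<close>

lemma exhaust_le:
  assumes g: "g \<in> borel_measurable Lpos"
    and le: "\<And>x. 0 < x \<Longrightarrow> W x < top \<Longrightarrow> (\<integral>\<^sup>+y. g y * indicator {0<..x} y \<partial>Lpos) \<le> K"
    and zero: "\<And>y. 0 < y \<Longrightarrow> W y = top \<Longrightarrow> g y = 0"
  shows "(\<integral>\<^sup>+y. g y \<partial>Lpos) \<le> K"
proof -
  have "(\<integral>\<^sup>+y. g y * indicator {x. W x < top} y \<partial>Lpos) \<le> K"
  proof (rule nn_integral_downset_le[OF _ g ident_Lpos])
    fix x y assume "x \<in> {x. W x < top}" "y \<le> x"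
    then show "y \<in> {x. W x < top}" using integ_mono[of 0 0 y x w] by auto
  next
    fix x assume x: "x \<in> {x. W x < top}"
    have eq: "(\<integral>\<^sup>+y. g y * indicator {..x} y \<partial>Lpos) = (\<integral>\<^sup>+y. g y * indicator {0<..x} y \<partial>Lpos)"
      by (intro nn_integral_cong) (auto split: split_indicator)
    show "(\<integral>\<^sup>+y. g y * indicator {..x} y \<partial>Lpos) \<le> K"
      unfolding eq using le[of x] x by (cases "0 < x") auto
  qed
  also have "(\<integral>\<^sup>+y. g y * indicator {x. W x < top} y \<partial>Lpos) = (\<integral>\<^sup>+y. g y \<partial>Lpos)"
    using zero by (intro nn_integral_cong) (auto split: split_indicator simp: less_top[symmetric])
  finally show ?thesis .
qed

end

section \<open>Blocks on which W halves\<close>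

locale blocks = weights +
  fixes t :: "nat \<Rightarrow> real"
  assumes t_pos: "0 < t k" and t_dec: "t (Suc k) < t k"
    and W_t0: "integ w 0 (t 0) < top" and W_half: "2 * integ w 0 (t (Suc k)) = integ w 0 (t k)"
    and t_lim: "0 < x \<Longrightarrow> \<exists>k. t k < x"
begin

text \<open>Indices grow towards 0, so \<open>t (Suc k)\<close> is the left end.\<close>

definition J :: "nat \<Rightarrow> real set" where "J k = {t (Suc k)<..t k}"

lemma J_borel [measurable]: "J k \<in> sets borel" by (simp add: J_def)

abbreviation "\<omega> k \<equiv> integ w 0 (t k)"

lemma t_antimono: "i \<le> j \<Longrightarrow> t j \<le> t i"
  by (rule lift_Suc_antimono_le[of t, OF less_imp_le[OF t_dec]])

lemma \<omega>_bounds: "0 < \<omega> k" "\<omega> k < top"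
proof -
  show "0 < \<omega> k" by (rule W_pos[OF t_pos])
  have "\<omega> k \<le> \<omega> 0" by (intro integ_mono t_antimono) auto
  then show "\<omega> k < top" using W_t0 by (rule le_less_trans)
qed

text \<open>As W halves, a block carries as much mass of w as everything to its left.\<close>

lemma integ_w_block: "integ w (t (Suc k)) (t k) = \<omega> (Suc k)"
proof -
  have "\<omega> k = \<omega> (Suc k) + integ w (t (Suc k)) (t k)"
    using t_pos t_dec by (intro integ_split) (auto intro: less_imp_le)
  then have "\<omega> (Suc k) + \<omega> (Suc k) = \<omega> (Suc k) + integ w (t (Suc k)) (t k)"
    unfolding W_half[of k, symmetric] mult_2 .
  then show ?thesis using \<omega>_bounds(2)[of "Suc k"] by (auto simp: ennreal_add_left_cancel)
qed

lemma nn_integral_w_block: "(\<integral>\<^sup>+y. w y * indicator (J k) y \<partial>Lpos) = \<omega> (Suc k)"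
  using t_pos[of "Suc k"] by (simp add: integ_w_block[symmetric] integ_Ioc J_def)

lemma disjoint_J: "disjoint_family J"
proof -
  have "J i \<inter> J j = {}" if "i < j" for i j
    using t_antimono[of "Suc i" j] that by (auto simp: J_def)
  then show ?thesis unfolding disjoint_family_on_def by (metis Int_commute linorder_neqE_nat)
qed

lemma UN_J: "(\<Union>k. J k) = {0<..t 0}"
proof (rule set_eqI, safe)
  fix x k assume "x \<in> J k"
  then show "x \<in> {0<..t 0}" using t_pos[of "Suc k"] t_antimono[of 0 k] by (auto simp: J_def)
next
  fix x assume x: "x \<in> {0<..t 0}"
  obtain n where n: "t n < x" using t_lim[of x] x by auto
  have "\<exists>k. x \<in> J k" using n
  proof (induction n)
    case 0 then show ?case using x by simp
  next
    case (Suc n) then show ?case by (cases "t n < x") (auto simp: J_def)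
  qed
  then show "x \<in> (\<Union>k. J k)" by blast
qed

lemma nn_integral_blocks:
  assumes "g \<in> borel_measurable Lpos"
  shows "(\<integral>\<^sup>+y. g y * indicator {0<..t 0} y \<partial>Lpos) = (\<Sum>k. \<integral>\<^sup>+y. g y * indicator (J k) y \<partial>Lpos)"
proof -
  have J: "J k \<in> sets Lpos" for k
    using t_pos[of "Suc k"] by (auto simp: sets_restrict_space_iff J_def)
  show ?thesis unfolding UN_J[symmetric]
    by (rule nn_integral_disjoint_family[OF assms J disjoint_J])
qed

lemma block_le:
  assumes "\<And>y. y \<in> J k \<Longrightarrow> g y \<le> c"
  shows "(\<integral>\<^sup>+y. g y * w y * indicator (J k) y \<partial>Lpos) \<le> c * \<omega> (Suc k)"
proof -
  have "(\<integral>\<^sup>+y. g y * w y * indicator (J k) y \<partial>Lpos) \<le> (\<integral>\<^sup>+y. c * (w y * indicator (J k) y) \<partial>Lpos)"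
    using assms by (intro nn_integral_mono) (auto split: split_indicator intro!: mult_right_mono)
  then show ?thesis by (simp add: nn_integral_cmult nn_integral_w_block)
qed

lemma block_ge:
  assumes "\<And>y. y \<in> J k \<Longrightarrow> c \<le> g y"
  shows "c * \<omega> (Suc k) \<le> (\<integral>\<^sup>+y. g y * w y * indicator (J k) y \<partial>Lpos)"
proof -
  have "(\<integral>\<^sup>+y. c * (w y * indicator (J k) y) \<partial>Lpos) \<le> (\<integral>\<^sup>+y. g y * w y * indicator (J k) y \<partial>Lpos)"
    using assms by (intro nn_integral_mono) (auto split: split_indicator intro!: mult_right_mono)
  then show ?thesis by (simp add: nn_integral_cmult nn_integral_w_block)
qed

lemma blocks_shift: "blocks m q u w v (\<lambda>i. t (k + i))"
proof unfold_locales
  show "0 < t (k + i)" for i by (rule t_pos)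
  show "t (k + Suc i) < t (k + i)" for i using t_dec[of "k + i"] by simp
  show "\<omega> (k + 0) < top" using \<omega>_bounds(2)[of k] by simp
  show "2 * \<omega> (k + Suc i) = \<omega> (k + i)" for i using W_half[of "k + i"] by simp
  show "\<exists>i. t (k + i) < x" if x: "0 < x" for x
  proof -
    obtain n where "t n < x" using t_lim[OF x] by blast
    then show ?thesis using t_antimono[of n "k + n"] by (intro exI[of _ n]) auto
  qed
qed

lemma \<omega>_mult: "\<omega> k * x = 2 * (x * \<omega> (Suc k))"
  by (subst W_half[of k, symmetric]) (simp only: ac_simps)

text \<open>On \<open>J k\<close> the non-increasing \<open>loc h\<close> is at least its value at
  the right end \<open>t k\<close>, and \<open>J k\<close> has mass
  \<open>\<omega> k / 2\<close>.\<close>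

lemma sum_loc_le_N:
  "(\<Sum>k. \<omega> k * loc h (t k) epowr p) \<le> 2 * N h"
proof -
  have "(\<Sum>k. \<omega> k * loc h (t k) epowr p) = (\<Sum>k. 2 * (loc h (t k) epowr p * \<omega> (Suc k)))"
    by (intro suminf_cong) (simp only: \<omega>_mult)
  also have "\<dots> \<le> (\<Sum>k. 2 * (\<integral>\<^sup>+y. loc h y epowr p * w y * indicator (J k) y \<partial>Lpos))"
    using p by (intro suminf_le mult_left_mono block_ge epowr_mono loc_antimono) (auto simp: J_def)
  also have "\<dots> = 2 * (\<integral>\<^sup>+y. loc h y epowr p * w y * indicator {0<..t 0} y \<partial>Lpos)"
    by (subst nn_integral_blocks) auto
  also have "\<dots> \<le> 2 * N h" unfolding N_def
    by (intro mult_left_mono nn_integral_mono) (auto split: split_indicator)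
  finally show ?thesis .
qed

text \<open>The mass of the atom at \<open>t k\<close>. A tail of height 1 at \<open>t k\<close> is
  at least 1 on \<open>J k\<close>; there it adds \<open>U (t (Suc k)) (t k)\<close> to the inner
  integral, and this is felt on all of (0, \<open>t (Suc k)\<close>], whose mass is
  \<open>\<omega> (Suc k)\<close>.\<close>

definition \<beta> :: "nat \<Rightarrow> ennreal" where
  "\<beta> k = \<omega> (Suc k) * U (t (Suc k)) (t k) epowr p"

text \<open>Each \<open>\<beta> k\<close> is charged to the next block on the left,
  \<open>J (Suc k)\<close>: it has half the mass \<open>\<omega> (Suc k)\<close>, and for x in it
  \<open>U x y\<close> is at least \<open>U (t (Suc k)) (t k)\<close>. These blocks are disjoint, so
  the charges add up inside \<open>phi y\<close>.\<close>

lemma sum_\<beta>_le_phi: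
  assumes "0 < y"
  shows "(\<Sum>k. \<beta> k * indicator {..y} (t k)) \<le> 2 * phi y"
proof -
  define A where "A k = (if t k \<le> y then J (Suc k) else {})" for k
  have A_borel[measurable]: "A k \<in> sets borel" for k by (simp add: A_def)
  have disj: "disjoint_family A"
    using disjoint_J unfolding disjoint_family_on_def A_def by (metis Int_empty_left Int_empty_right UNIV_I nat.inject)
  have AL: "A k \<in> sets Lpos" for k
    using t_pos[of "Suc (Suc k)"] by (auto simp: sets_restrict_space_iff J_def A_def)
  have sub: "(\<Union>k. A k) \<subseteq> {0<..y}"
  proof (safe)
    fix x k assume "x \<in> A k"
    then have "t k \<le> y" "x \<in> J (Suc k)" by (auto simp: A_def split: if_splits)
    then show "x \<in> {0<..y}" using t_pos[of "Suc (Suc k)"] t_dec[of k] by (auto simp: J_def)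
  qed
  have "\<beta> k * indicator {..y} (t k) \<le> 2 * (\<integral>\<^sup>+x. U x y epowr p * w x * indicator (A k) x \<partial>Lpos)" for k
  proof (cases "t k \<le> y")
    case True
    have "U (t (Suc k)) (t k) epowr p * \<omega> (Suc (Suc k)) \<le> (\<integral>\<^sup>+x. U x y epowr p * w x * indicator (J (Suc k)) x \<partial>Lpos)"
      using True p t_pos[of "Suc (Suc k)"] by (intro block_ge epowr_mono integ_mono) (auto simp: J_def)
    then have "2 * (U (t (Suc k)) (t k) epowr p * \<omega> (Suc (Suc k))) \<le> 2 * (\<integral>\<^sup>+x. U x y epowr p * w x * indicator (A k) x \<partial>Lpos)"
      using True by (intro mult_left_mono) (auto simp: A_def)
    then show ?thesis using True by (simp add: \<beta>_def W_half[of "Suc k", symmetric] ac_simps)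
  qed simp
  then have "(\<Sum>k. \<beta> k * indicator {..y} (t k)) \<le> (\<Sum>k. 2 * (\<integral>\<^sup>+x. U x y epowr p * w x * indicator (A k) x \<partial>Lpos))"
    by (intro suminf_le) auto
  also have "\<dots> = 2 * (\<integral>\<^sup>+x. U x y epowr p * w x * indicator (\<Union>k. A k) x \<partial>Lpos)"
    by (subst nn_integral_disjoint_family[OF _ AL disj]) auto
  also have "\<dots> \<le> 2 * phi y"
    unfolding phi_def integ_Ioc[OF order_refl]
    using subsetD[OF sub] by (intro mult_left_mono nn_integral_mono) (auto simp: indicator_def)
  finally show ?thesis .
qed

lemma pos_distribution_atoms:
  assumes b: "\<And>k. b k < top" "\<And>k. k < n \<Longrightarrow> 0 < \<tau> k" "\<And>k. n \<le> k \<Longrightarrow> b k = 0"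
  shows "pos_distribution (atoms b \<tau> \<beta> t)"
proof
  have 1: "(\<Sum>k. b k * indicator {..x} (\<tau> k)) = (\<Sum>k<n. b k * indicator {..x} (\<tau> k))" for x
    using b(3) by (intro suminf_finite) auto
  have 0: "emeasure (atoms b \<tau> \<beta> t) {..0} = 0"
    unfolding emeasure_atoms 1 using b(2) t_pos by (force simp: not_le intro!: sum.neutral)
  show "emeasure (atoms b \<tau> \<beta> t) {..x} < top" for x
  proof (cases "0 < x")
    case True
    have "(\<Sum>k<n. b k * indicator {..x} (\<tau> k)) + (\<Sum>k. \<beta> k * indicator {..x} (t k)) \<le> (\<Sum>k<n. b k) + 2 * phi x"
      by (intro add_mono sum_mono sum_\<beta>_le_phi True) (auto split: split_indicator)
    also have "\<dots> < top" using b(1) phi_bounds(2)[OF True] by (auto simp: ennreal_mult_less_top)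
    finally show ?thesis unfolding emeasure_atoms 1 .
  next
    case False
    then have "emeasure (atoms b \<tau> \<beta> t) {..x} \<le> emeasure (atoms b \<tau> \<beta> t) {..0}" by (intro emeasure_mono) auto
    then show ?thesis using 0 by simp
  qed
  show "emeasure (atoms b \<tau> \<beta> t) {..0} = 0" by (rule 0)
qed simp

lemma sum_\<beta>_tail_le_N: "(\<Sum>k. \<beta> k * tail h (t k) epowr q) \<le> 2 * N h"
proof -
  have "(\<Sum>k. \<beta> k * tail h (t k) epowr q) \<le> (\<Sum>k. \<omega> (Suc k) * loc h (t (Suc k)) epowr p)"
  proof (intro suminf_le)
    fix k
    have "tail h (t k) epowr m * U (t (Suc k)) (t k) \<le> loc h (t (Suc k))"
      using t_pos by (intro loc_ge) (auto intro: less_imp_le tail_antimono)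
    then have "(tail h (t k) epowr m * U (t (Suc k)) (t k)) epowr p \<le> loc h (t (Suc k)) epowr p"
      using p by (intro epowr_mono) auto
    then have "tail h (t k) epowr q * U (t (Suc k)) (t k) epowr p \<le> loc h (t (Suc k)) epowr p"
      using p m by (simp add: epowr_mult epowr_epowr)
    then show "\<beta> k * tail h (t k) epowr q \<le> \<omega> (Suc k) * loc h (t (Suc k)) epowr p"
      unfolding \<beta>_def by (simp add: mult.assoc mult.commute[of "U _ _ epowr p"] mult_left_mono)
  qed auto
  also have "\<dots> \<le> (\<Sum>k. \<omega> k * loc h (t k) epowr p)"
    using suminf_offset[of "\<lambda>k. \<omega> k * loc h (t k) epowr p" 1] by simp
  also have "\<dots> \<le> 2 * N h" by (rule sum_loc_le_N)
  finally show ?thesis .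
qed

text \<open>For s in a late block \<open>U s (t k)\<close> extends over all blocks in between.
  Written as a recursion in i and absorbed against the halving \<omega>, it leaves a single block
  integral per term, which is what \<beta> contains. With \<open>sum_\<beta>_le_phi\<close>, the
  atoms have a distribution function comparable to \<open>phi\<close> at the points
  \<open>t k\<close>.\<close>

lemma phi_le_sum_\<beta>: "phi (t k) \<le> 4 * absorb_const p * (\<Sum>i. \<beta> (k + i))"
proof -
  interpret S: blocks m q u w v "\<lambda>i. t (k + i)" by (rule blocks_shift)
  let ?g = "absorb_const p"
  have "phi (t k) = (\<Sum>i. \<integral>\<^sup>+s. U s (t k) epowr p * w s * indicator (S.J i) s \<partial>Lpos)"
    using S.nn_integral_blocks[of "\<lambda>s. U s (t k) epowr p * w s"] by (simp add: phi_def integ_Ioc)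
  also have "\<dots> \<le> (\<Sum>i. \<omega> (k + Suc i) * U (t (k + Suc i)) (t k) epowr p)"
  proof (intro suminf_le)
    fix i
    have "(\<integral>\<^sup>+s. U s (t k) epowr p * w s * indicator (S.J i) s \<partial>Lpos) \<le> U (t (k + Suc i)) (t k) epowr p * \<omega> (k + Suc i)"
      using p t_pos[of "k + Suc i"] by (intro S.block_le epowr_mono integ_mono) (auto simp: S.J_def)
    then show "(\<integral>\<^sup>+s. U s (t k) epowr p * w s * indicator (S.J i) s \<partial>Lpos) \<le> \<omega> (k + Suc i) * U (t (k + Suc i)) (t k) epowr p"
      by (simp add: mult.commute)
  qed auto
  also have "\<dots> \<le> 4 * (\<Sum>i. \<omega> (k + Suc i) * (?g * U (t (k + Suc i)) (t (k + i)) epowr p))"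
  proof (rule halving_weights_sum_le)
    show "2 * \<omega> (k + Suc (Suc i)) = \<omega> (k + Suc i)" for i using W_half[of "k + Suc i"] by simp
    show "U (t (k + Suc 0)) (t k) epowr p \<le> ?g * U (t (k + Suc 0)) (t (k + 0)) epowr p"
      using mult_right_mono[OF absorb_const(1)[OF p]] by fastforce
    fix i
    have "U (t (k + Suc (Suc i))) (t k) = U (t (k + Suc (Suc i))) (t (k + Suc i)) + U (t (k + Suc i)) (t k)"
      using t_pos[of "k + Suc (Suc i)"] t_dec[of "k + Suc i"] t_antimono[of k "k + Suc i"] by (intro integ_split) auto
    then show "2 * U (t (k + Suc (Suc i))) (t k) epowr p \<le> 3 * U (t (k + Suc i)) (t k) epowr p
       + 2 * (?g * U (t (k + Suc (Suc i))) (t (k + Suc i)) epowr p)"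
      using absorb_const(3)[OF p, of "U (t (k + Suc i)) (t k)" "U (t (k + Suc (Suc i))) (t (k + Suc i))"]
      by (simp add: add.commute mult.assoc)
  qed
  also have "\<dots> = 4 * ?g * (\<Sum>i. \<beta> (k + i))"
    by (simp add: \<beta>_def mult.assoc mult.left_commute[of _ ?g])
  finally show ?thesis .
qed

end

text \<open>Halving is iterated from X. The points tend to 0 because 2^k * W (t k) stays equal to W
  X, which is finite, while W x > 0 for every x > 0.\<close>

lemma (in weights) blocks_exist:
  assumes X: "0 < X" "W X < top"
  shows "\<exists>t. t 0 = X \<and> blocks m q u w v t"
proof -
  have "\<exists>t. \<forall>n. (0 < t n \<and> W (t n) < top \<and> (n = 0 \<longrightarrow> t n = X)) \<and> (t (Suc n) < t n \<and> 2 * W (t (Suc n)) = W (t n))"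
  proof (rule dependent_nat_choice)
    show "\<exists>x. 0 < x \<and> W x < top \<and> ((0::nat) = 0 \<longrightarrow> x = X)" using X by blast
    fix x and n :: nat assume x: "0 < x \<and> W x < top \<and> (n = 0 \<longrightarrow> x = X)"
    then obtain y where y: "0 < y" "y < x" "2 * W y = W x"
      using integ_halving[of w x] W_pos[of x] by auto
    then have "W y < top" using x integ_mono[of 0 0 y x w] by (auto intro: le_less_trans)
    then show "\<exists>y. (0 < y \<and> W y < top \<and> (Suc n = 0 \<longrightarrow> y = X)) \<and> y < x \<and> 2 * W y = W x"
      using y by blast
  qed
  then obtain t where t: "\<And>n. 0 < t n" "t 0 = X" "\<And>n. t (Suc n) < t n" "\<And>n. 2 * W (t (Suc n)) = W (t n)"
    by metis
  have pow: "2 ^ k * W (t k) = W X" for k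
  proof (induction k)
    case (Suc k)
    then show ?case using t(4)[of k] by (simp add: mult.assoc mult.commute[of 2] mult.left_commute)
  qed (simp add: t)
  have "\<exists>k. t k < x" if x: "0 < x" for x
  proof (rule ccontr)
    assume "\<not> (\<exists>k. t k < x)"
    then have le: "W x \<le> W (t k)" for k by (intro integ_mono) (auto simp: not_less)
    obtain a where a: "W X = ennreal a" "0 < a" using X W_pos[OF X(1)] by (cases "W X" rule: ennreal_trichotomy) auto
    have "W x \<le> W X" using le[of 0] t by simp
    then obtain b where b: "W x = ennreal b" "0 < b" using a W_pos[OF x] by (cases "W x" rule: ennreal_trichotomy) (auto simp: top_unique)
    obtain k where k: "a / b < 2 ^ k" using real_arch_pow[of 2 "a / b"] by auto
    have "2 ^ k * W x \<le> W X" unfolding pow[of k, symmetric] by (intro mult_left_mono le) auto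
    then have "ennreal (2 ^ k * b) \<le> ennreal a" using a b by (simp add: ennreal_mult ennreal_power[symmetric])
    then show False using k a b by (simp add: ennreal_le_iff field_simps)
  qed
  then have "blocks m q u w v t" by unfold_locales (use t X in auto)
  then show ?thesis using t by blast
qed

section \<open>Lower bounds\<close>

context exponents
begin

text \<open>Equal to - q', and for q < 1 the exponent with 1 + r = 1 / (1 - q).\<close>

definition r :: real where "r = q / (1 - q)"

lemma r_facts:
  assumes "q < 1"
  shows "0 < r" "q * (1 + r) = r" "(1 + r) * q = r" "p * (1 + r) = r / m" "(1 + r) * (1 - q) = 1" "r * (1 - q) = q"
  using assms q m by (auto simp: r_def field_simps)

text \<open>The first factor compares \<open>phi\<close> with the distribution function of the
  atoms, \<open>8 epowr (1 + r)\<close> is the constant of \<open>Hardy_less1_necessary\<close>, and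
  4 = 2 + 2 comes from two families of atoms, each dominated by \<open>2 * N h\<close>.\<close>

definition lowerA_const :: ennreal where
  "lowerA_const = (2 epowr (p + 1) * (4 * absorb_const p + 1)) epowr r * (8 epowr (1 + r) * (4 epowr (1 / q)) epowr r)"

end

context weights
begin

text \<open>The essential supremum in \<open>A3\<close>, with v to the power q' written through
  \<open>inverse\<close>. The exponent of U is p and not r / m because the factor
  \<open>phi y epowr r\<close> supplies the remaining p * r.\<close>

definition sig :: "real \<Rightarrow> ennreal" where
  "sig y = esssup_from y (\<lambda>z. U y z epowr p * inverse (v z) epowr r)"

lemma sig_integrand_Mplus: "0 \<le> y \<Longrightarrow> (\<lambda>z. U y z epowr p * inverse (v z) epowr r) \<in> Mplus"
  unfolding Mplus_def
  by (intro borel_measurable_times_ennreal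
      measurable_compose[OF integ_measurable_right epowr_measurable]
      measurable_compose[OF borel_measurable_inverse_ennreal[OF meas(3)] epowr_measurable])

lemma sig_AE: "0 \<le> y \<Longrightarrow> AE z in Lpos. y < z \<longrightarrow> U y z epowr p * inverse (v z) epowr r \<le> sig y"
  using esssup_AE[of "\<lambda>z. U y z epowr p * inverse (v z) epowr r" "lebesgue_on {y<..}"]
  unfolding sig_def esssup_from_def by (subst (asm) AE_from_iff)

lemma mult_sig_le:
  assumes y: "0 \<le> y" and c: "c < top"
    and le: "AE z in Lpos. y < z \<longrightarrow> c * (U y z epowr p * inverse (v z) epowr r) \<le> K"
  shows "c * sig y \<le> K"
  unfolding sig_def esssup_from_def
  by (rule mult_esssup_le[OF measurable_from[OF sig_integrand_Mplus[OF y] y] c])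
     (use le in \<open>simp only: AE_from_iff[OF y]\<close>)

lemma sig_antimono: assumes "0 \<le> y" "y \<le> y'" shows "sig y' \<le> sig y"
proof -
  have "1 * sig y' \<le> sig y"
  proof (rule mult_sig_le)
    show "AE z in Lpos. y' < z \<longrightarrow> 1 * (U y' z epowr p * inverse (v z) epowr r) \<le> sig y"
      using sig_AE[OF assms(1)]
    proof (rule eventually_mono, intro impI)
      fix z assume z: "y < z \<longrightarrow> U y z epowr p * inverse (v z) epowr r \<le> sig y" "y' < z"
      have "U y' z epowr p * inverse (v z) epowr r \<le> U y z epowr p * inverse (v z) epowr r"
        using assms p by (intro mult_right_mono epowr_mono integ_mono) auto
      then show "1 * (U y' z epowr p * inverse (v z) epowr r) \<le> sig y" using z assms by auto
    qed
  qed (use assms in auto)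
  then show ?thesis by simp
qed

lemma sig_measurable [measurable]: "sig \<in> borel_measurable Lpos"
  by (intro measurable_antimono_on monotone_onI sig_antimono) auto

lemma U_rho_power_le:
  assumes q1: "q < 1" and t: "0 < t" and z: "0 \<le> z" and fin: "B t < top"
  shows "U t z epowr (r / m) * rho v z epowr r \<le> B t epowr r"
  using epowr_mono[OF U_rho_le_B[OF less_imp_le[OF t] z fin], of r] r_facts(1)[OF q1] by (simp add: epowr_mult epowr_epowr)

lemma sig_eq_0: "0 < y \<Longrightarrow> W y = top \<Longrightarrow> sig y = 0"
  using mult_sig_le[of y 1 0] U_eq_0 p by simp

lemma N_le_power:
  assumes "C < top" "h \<in> Mplus" "I h < top" shows "N h \<le> (C * I h) epowr q"
  using N_le[OF assms] q epowr_le_swap[of "1 / q" "N h"] by simp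

end

context blocks
begin

text \<open>The numbers \<open>\<gamma> k h\<close> are chosen so that their power 1 + r, divided by
  the r-th power of the cost, has the k-th term as its supremum. For a combination f of one
  \<open>h k\<close> per block, \<open>loc f (t k)\<close> dominates
  \<open>\<alpha> k epowr m * loc (h k) (t k)\<close>, so all k are tested at once through
  \<open>N f\<close>.\<close>

lemma sum_B_le:
  assumes q1: "q < 1" and C: "C < top"
  shows "(\<Sum>k. \<omega> k epowr (1 + r) * B (t k) epowr r) \<le> 2 epowr (1 + r) * C epowr r"
proof (rule suminf_le_const)
  note rf = r_facts[OF q1]
  define A where "A = {h \<in> Mplus. I h < top}"
  define \<gamma> where "\<gamma> k h = \<omega> k * loc h (t k) epowr p" for k h
  have term_le: "\<omega> k epowr (1 + r) * B (t k) epowr r \<le> (SUP h\<in>A. \<gamma> k h epowr (1 + r) * inverse (I h) epowr r)" for k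
  proof -
    have "\<omega> k epowr (1 + r) * B (t k) epowr r \<le> (SUP h\<in>Mplus. \<omega> k epowr (1 + r) * (loc h (t k) epowr (1 / m) / I h) epowr r)"
      unfolding B_def SUP_mult_left_ennreal[symmetric] using rf(1) by (intro mult_left_mono SUP_epowr_le) auto
    also have "\<dots> \<le> (SUP h\<in>A. \<gamma> k h epowr (1 + r) * inverse (I h) epowr r)"
    proof (rule SUP_least)
      fix h assume h: "h \<in> Mplus"
      have "\<omega> k epowr (1 + r) * (loc h (t k) epowr (1 / m) / I h) epowr r = \<gamma> k h epowr (1 + r) * inverse (I h) epowr r"
        using rf(1,2) by (simp add: \<gamma>_def divide_ennreal_def epowr_mult epowr_epowr mult.assoc)
      also have "\<dots> \<le> (SUP h\<in>A. \<gamma> k h epowr (1 + r) * inverse (I h) epowr r)"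
        using h rf(1) by (cases "I h = top") (auto simp: A_def less_top[symmetric] intro: SUP_upper)
      finally show "\<omega> k epowr (1 + r) * (loc h (t k) epowr (1 / m) / I h) epowr r \<le> (SUP h\<in>A. \<gamma> k h epowr (1 + r) * inverse (I h) epowr r)" .
    qed
    finally show ?thesis .
  qed
  have test: "(\<Sum>k\<in>F. \<gamma> k (h k) * \<alpha> k epowr q) \<le> 2 * C epowr q * I f epowr q"
    if F: "finite F" and hA: "\<And>k. k \<in> F \<Longrightarrow> h k \<in> A" and f: "f = (\<lambda>y. \<Sum>k\<in>F. \<alpha> k * h k y)" and fin: "I f < top" for F h \<alpha> f
  proof -
    have hM: "h k \<in> Mplus" if "k \<in> F" for k using hA[OF that] by (auto simp: A_def)
    have loc_f: "\<alpha> k epowr m * loc (h k) (t k) \<le> loc f (t k)" if k: "k \<in> F" for k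
    proof -
      have [measurable]: "h k \<in> borel_measurable Lpos" using hM[OF k] by (simp add: Mplus_def)
      have "\<alpha> k epowr m * loc (h k) (t k) = (\<integral>\<^sup>+s. \<alpha> k epowr m * (tail (h k) s epowr m * u s * indicator {t k<..} s) \<partial>Lpos)"
        unfolding loc_def tail_def[of _ "t k"] by (intro nn_integral_cmult[symmetric]) measurable
      also have "\<dots> \<le> loc f (t k)" unfolding loc_def tail_def[of _ "t k"]
      proof (intro nn_integral_mono)
        fix s
        have "(\<alpha> k * tail (h k) s) epowr m \<le> tail f s epowr m"
          unfolding f using m F k hM by (intro epowr_mono tail_combination_ge) auto
        then have "\<alpha> k epowr m * tail (h k) s epowr m * (u s * indicator {t k<..} s) \<le> tail f s epowr m * (u s * indicator {t k<..} s)"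
          using m by (intro mult_right_mono) (auto simp: epowr_mult)
        then show "\<alpha> k epowr m * (tail (h k) s epowr m * u s * indicator {t k<..} s) \<le> tail f s epowr m * u s * indicator {t k<..} s"
          by (simp add: mult.assoc)
      qed
      finally show ?thesis .
    qed
    have "(\<Sum>k\<in>F. \<gamma> k (h k) * \<alpha> k epowr q) = (\<Sum>k\<in>F. \<omega> k * (\<alpha> k epowr m * loc (h k) (t k)) epowr p)"
      using m p by (simp add: \<gamma>_def epowr_mult epowr_epowr ac_simps)
    also have "\<dots> \<le> (\<Sum>k\<in>F. \<omega> k * loc f (t k) epowr p)"
      using p by (intro sum_mono mult_left_mono epowr_mono loc_f) auto
    also have "\<dots> \<le> (\<Sum>k. \<omega> k * loc f (t k) epowr p)" using F by (intro sum_le_suminf) auto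
    also have "\<dots> \<le> 2 * N f" by (rule sum_loc_le_N)
    also have "\<dots> \<le> 2 * (C * I f) epowr q"
      using combination_Mplus[of F h \<alpha>] hM fin unfolding f by (intro mult_left_mono N_le_power C) auto
    finally show ?thesis using q by (simp add: epowr_mult mult.assoc)
  qed
  fix n
  have "(\<Sum>k<n. \<omega> k epowr (1 + r) * B (t k) epowr r) \<le> (\<Sum>k<n. SUP h\<in>A. \<gamma> k h epowr (1 + r) * inverse (I h) epowr r)"
    by (intro sum_mono term_le)
  also have "\<dots> \<le> (2 * C epowr q) epowr (1 + r)"
  proof (rule sum_SUP_saturation_le[OF q q1 r_def v])
    show "2 * C epowr q < top" using C q by (simp add: ennreal_mult_less_top)
  qed (auto intro: test simp: A_def)
  also have "\<dots> = 2 epowr (1 + r) * C epowr r"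
    using rf(1,2) by (simp add: epowr_mult epowr_epowr)
  finally show "(\<Sum>k<n. \<omega> k epowr (1 + r) * B (t k) epowr r) \<le> 2 epowr (1 + r) * C epowr r" .
qed simp

text \<open>On \<open>J k\<close> the integrand is bounded by W at the right end and B at the left
  end; since \<open>\<omega> k = 2 * \<omega> (Suc k)\<close>, both can be read at index
  \<open>Suc k\<close>.\<close>

lemma nn_integral_B_blocks_le:
  assumes q1: "q < 1"
  shows "(\<integral>\<^sup>+y. W y epowr r * B y epowr r * w y * indicator {0<..t 0} y \<partial>Lpos)
     \<le> 2 epowr r * (\<Sum>k. \<omega> k epowr (1 + r) * B (t k) epowr r)"
proof -
  note rf = r_facts[OF q1]
  have [measurable]: "W \<in> borel_measurable Lpos" by (rule integ_measurable_right) simp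
  have "(\<integral>\<^sup>+y. W y epowr r * B y epowr r * w y * indicator {0<..t 0} y \<partial>Lpos)
     = (\<Sum>k. \<integral>\<^sup>+y. W y epowr r * B y epowr r * w y * indicator (J k) y \<partial>Lpos)"
    by (rule nn_integral_blocks) measurable
  also have "\<dots> \<le> (\<Sum>k. 2 epowr r * (\<omega> (Suc k) epowr (1 + r) * B (t (Suc k)) epowr r))"
  proof (intro suminf_le)
    fix k
    have "(\<integral>\<^sup>+y. W y epowr r * B y epowr r * w y * indicator (J k) y \<partial>Lpos) \<le> (\<omega> k epowr r * B (t (Suc k)) epowr r) * \<omega> (Suc k)"
      using rf(1) t_pos[of "Suc k"] by (intro block_le mult_mono epowr_mono integ_mono B_antimono) (auto simp: J_def)
    also have "\<dots> = 2 epowr r * (\<omega> (Suc k) epowr (1 + r) * B (t (Suc k)) epowr r)"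
      unfolding W_half[of k, symmetric] using rf(1) by (simp add: epowr_mult epowr_add ac_simps)
    finally show "(\<integral>\<^sup>+y. W y epowr r * B y epowr r * w y * indicator (J k) y \<partial>Lpos) \<le> 2 epowr r * (\<omega> (Suc k) epowr (1 + r) * B (t (Suc k)) epowr r)" .
  qed auto
  also have "\<dots> = 2 epowr r * (\<Sum>k. \<omega> (Suc k) epowr (1 + r) * B (t (Suc k)) epowr r)" by simp
  also have "\<dots> \<le> 2 epowr r * (\<Sum>k. \<omega> k epowr (1 + r) * B (t k) epowr r)"
    using suminf_offset[of "\<lambda>k. \<omega> k epowr (1 + r) * B (t k) epowr r" 1] by (intro mult_left_mono) simp_all
  finally show ?thesis .
qed

text \<open>The integral is split at the left end of the block: for s to the left of it U is
  additive across that point, and for s inside the block U s y is at most U from the left end while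
  the mass of w is at most \<open>\<omega> (Suc k)\<close>.\<close>

lemma phi_block_le:
  assumes y: "y \<in> J k"
  shows "phi y \<le> 2 epowr (p + 1) * (phi (t (Suc k)) + \<omega> (Suc k) * U (t (Suc k)) y epowr p)"
proof -
  let ?t = "t (Suc k)"
  have ty: "0 < ?t" "?t < y" "y \<le> t k" using y t_pos by (auto simp: J_def)
  have "phi y = (\<integral>\<^sup>+s. U s y epowr p * w s * indicator {0<..?t} s + U s y epowr p * w s * indicator {?t<..y} s \<partial>Lpos)"
    unfolding phi_def integ_Ioc[OF order_refl] using ty
    by (intro nn_integral_cong) (auto split: split_indicator)
  also have "\<dots> = (\<integral>\<^sup>+s. U s y epowr p * w s * indicator {0<..?t} s \<partial>Lpos) + (\<integral>\<^sup>+s. U s y epowr p * w s * indicator {?t<..y} s \<partial>Lpos)"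
    by (rule nn_integral_add) measurable
  also have "\<dots> \<le> 2 epowr p * (phi ?t + \<omega> (Suc k) * U ?t y epowr p) + 2 epowr p * (\<omega> (Suc k) * U ?t y epowr p)"
  proof (rule add_mono)
    have "(\<integral>\<^sup>+s. U s y epowr p * w s * indicator {0<..?t} s \<partial>Lpos) \<le>
      (\<integral>\<^sup>+s. 2 epowr p * (U s ?t epowr p * w s * indicator {0<..?t} s + U ?t y epowr p * (w s * indicator {0<..?t} s)) \<partial>Lpos)"
    proof (intro nn_integral_mono)
      fix s
      show "U s y epowr p * w s * indicator {0<..?t} s \<le> 2 epowr p * (U s ?t epowr p * w s * indicator {0<..?t} s + U ?t y epowr p * (w s * indicator {0<..?t} s))"
      proof (cases "s \<in> {0<..?t}")
        case True
        then have "U s y = U s ?t + U ?t y" using ty by (intro integ_split) auto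
        then have "U s y epowr p \<le> 2 epowr p * (U s ?t epowr p + U ?t y epowr p)"
          using epowr_add_le[of p] p by simp
        then have "U s y epowr p * w s \<le> 2 epowr p * (U s ?t epowr p + U ?t y epowr p) * w s"
          by (intro mult_right_mono) auto
        then show ?thesis using True by (simp add: distrib_right mult.assoc)
      qed simp
    qed
    also have "\<dots> = 2 epowr p * (phi ?t + U ?t y epowr p * \<omega> (Suc k))"
      by (subst nn_integral_cmult, measurable, subst nn_integral_add, measurable)
         (simp add: nn_integral_cmult phi_def integ_Ioc)
    finally show "(\<integral>\<^sup>+s. U s y epowr p * w s * indicator {0<..?t} s \<partial>Lpos) \<le> 2 epowr p * (phi ?t + \<omega> (Suc k) * U ?t y epowr p)"
      by (simp add: mult.commute)
  next
    have "(\<integral>\<^sup>+s. U s y epowr p * w s * indicator {?t<..y} s \<partial>Lpos) \<le> (\<integral>\<^sup>+s. U ?t y epowr p * w s * indicator (J k) s \<partial>Lpos)"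
      using p ty by (intro nn_integral_mono) (auto simp: J_def split: split_indicator intro!: mult_right_mono epowr_mono integ_mono)
    also have "\<dots> \<le> U ?t y epowr p * \<omega> (Suc k)" by (rule block_le) simp
    also have "\<dots> \<le> 2 epowr p * (\<omega> (Suc k) * U ?t y epowr p)"
      using mult_right_mono[OF epowr_mono[of 1 2 p], of "\<omega> (Suc k) * U ?t y epowr p"] p by (simp add: mult.commute)
    finally show "(\<integral>\<^sup>+s. U s y epowr p * w s * indicator {?t<..y} s \<partial>Lpos) \<le> 2 epowr p * (\<omega> (Suc k) * U ?t y epowr p)" .
  qed
  also have "\<dots> \<le> 2 epowr p * (phi ?t + \<omega> (Suc k) * U ?t y epowr p) + 2 epowr p * (phi ?t + \<omega> (Suc k) * U ?t y epowr p)"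
    by (intro add_left_mono mult_left_mono) (auto simp: add_increasing)
  also have "\<dots> = 2 epowr (p + 1) * (phi ?t + \<omega> (Suc k) * U ?t y epowr p)"
    using p epowr_add[of p 1 2] by (simp only: mult_2[symmetric] epowr_one_right) (simp add: ac_simps)
  finally show ?thesis .
qed

text \<open>The argument of \<open>phi\<close> is cut at z as well as at \<open>t k\<close>: this
  still bounds \<open>phi y\<close> for y < z in the block, whereas \<open>phi (t k)\<close> could
  not be controlled by atoms up to a z inside the block.\<close>

definition sig_block :: "nat \<Rightarrow> ennreal" where
  "sig_block k = (SUP z\<in>{t (Suc k)<..}. phi (min z (t k)) epowr r * (U (t (Suc k)) z epowr p * rho v z epowr r))"

lemma phi_sig_le:
  assumes q1: "q < 1" and y: "y \<in> J k"
  shows "phi y epowr r * sig y \<le> sig_block k"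
proof (rule mult_sig_le)
  note rf = r_facts[OF q1]
  have ty: "0 < t (Suc k)" "t (Suc k) < y" "y \<le> t k" using y t_pos by (auto simp: J_def)
  show "0 \<le> y" using ty by simp
  show "phi y epowr r < top" using ty rf(1) phi_bounds(2)[of y] by (intro epowr_less_top) auto
  show "AE z in Lpos. y < z \<longrightarrow> phi y epowr r * (U y z epowr p * inverse (v z) epowr r) \<le> sig_block k"
    using AE_inverse_le_rho[of v]
  proof (rule eventually_mono, intro impI)
    fix z assume z: "inverse (v z) \<le> rho v z" "y < z"
    have "phi y epowr r * (U y z epowr p * inverse (v z) epowr r) \<le> phi (min z (t k)) epowr r * (U (t (Suc k)) z epowr p * rho v z epowr r)"
      using z ty p rf(1) by (intro mult_mono epowr_mono integ_mono phi_mono) auto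
    also have "\<dots> \<le> sig_block k" unfolding sig_block_def using z ty by (intro SUP_upper) auto
    finally show "phi y epowr r * (U y z epowr p * inverse (v z) epowr r) \<le> sig_block k" .
  qed
qed

text \<open>The masses \<open>\<beta> k\<close> at \<open>t k\<close> keep the distribution function above a multiple of \<open>phi\<close> at the points
  \<open>t k\<close>; inside a block the mass placed at \<open>z k\<close> itself accounts for the growth of \<open>phi\<close>.\<close>

lemma choice_sum_le:
  assumes q1: "q < 1" and C: "C < top" and z: "\<And>k. k < n \<Longrightarrow> t (Suc k) < z k"
  shows "(\<Sum>k<n. \<omega> (Suc k) * (phi (min (z k) (t k)) epowr r * (U (t (Suc k)) (z k) epowr p * rho v (z k) epowr r)))
    \<le> lowerA_const * C epowr r" (is "?L \<le> _")
proof -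
  note rf = r_facts[OF q1]
  let ?g = "absorb_const p"
  \<comment> \<open>With this mass the atom at \<open>z k\<close> contributes exactly the k-th
    summand to the integral of \<Phi>^r * rho^r, up to the comparison of \<open>phi\<close> with
    \<Phi>.\<close>
  define b where "b k = (if k < n then \<omega> (Suc k) * U (t (Suc k)) (z k) epowr p else 0)" for k
  interpret D: pos_distribution "atoms b z \<beta> t"
  proof (rule pos_distribution_atoms)
    show "b k < top" for k
      using \<omega>_bounds[of "Suc k"] U_finite[OF t_pos[of "Suc k"]] p by (auto simp: b_def ennreal_mult_less_top intro!: epowr_less_top)
    show "0 < z k" if "k < n" for k using z[OF that] t_pos[of "Suc k"] by simp
  qed (simp add: b_def)
  have C': "4 epowr (1 / q) * C < top" using C q by (simp add: ennreal_mult_less_top)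
  have D: "(\<integral>\<^sup>+x. D.\<Phi> x epowr r * rho v x epowr r \<partial>atoms b z \<beta> t) \<le> 8 epowr (1 + r) * (4 epowr (1 / q) * C) epowr r"
  proof (rule D.Hardy_less1_necessary[OF v q q1 r_def C'])
    fix h assume h: "h \<in> Mplus" "I h < top"
    have 1: "b k * tail h (z k) epowr q \<le> \<omega> (Suc k) * loc h (t (Suc k)) epowr p" for k
    proof (cases "k < n")
      case True
      have "tail h (z k) epowr q * U (t (Suc k)) (z k) epowr p = (tail h (z k) epowr m * U (t (Suc k)) (z k)) epowr p"
        using p m by (simp add: epowr_mult epowr_epowr)
      also have "\<dots> \<le> loc h (t (Suc k)) epowr p"
        using p t_pos[of "Suc k"] by (intro epowr_mono loc_ge) (auto intro: less_imp_le tail_antimono)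
      finally have "\<omega> (Suc k) * (tail h (z k) epowr q * U (t (Suc k)) (z k) epowr p) \<le> \<omega> (Suc k) * loc h (t (Suc k)) epowr p"
        by (intro mult_left_mono) auto
      then show ?thesis using True by (simp add: b_def ac_simps)
    qed (simp add: b_def)
    have "(\<integral>\<^sup>+x. tail h x epowr q \<partial>atoms b z \<beta> t) = (\<Sum>k. b k * tail h (z k) epowr q) + (\<Sum>k. \<beta> k * tail h (t k) epowr q)"
      by (rule nn_integral_atoms) measurable
    also have "\<dots> \<le> (\<Sum>k. \<omega> (Suc k) * loc h (t (Suc k)) epowr p) + 2 * N h"
      by (intro add_mono suminf_le 1 sum_\<beta>_tail_le_N) auto
    also have "\<dots> \<le> 2 * N h + 2 * N h"
      by (intro add_right_mono order_trans[OF suminf_Suc_le sum_loc_le_N])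
    also have "\<dots> = 4 * N h" by (simp only: distrib_right[symmetric]) simp
    also have "\<dots> \<le> 4 * (C * I h) epowr q" by (intro mult_left_mono N_le_power C h) auto
    also have "\<dots> = (4 epowr (1 / q) * C * I h) epowr q" using q by (simp add: epowr_mult epowr_epowr mult.assoc)
    finally show "(\<integral>\<^sup>+x. tail h x epowr q \<partial>atoms b z \<beta> t) \<le> (4 epowr (1 / q) * C * I h) epowr q" .
  qed
  have Phi: "phi (min (z k) (t k)) \<le> 2 epowr (p + 1) * (4 * ?g + 1) * D.\<Phi> (z k)" if k: "k < n" for k
  proof -
    let ?t = "t (Suc k)" and ?y = "min (z k) (t k)"
    have "\<omega> (Suc k) * U ?t ?y epowr p \<le> b k" unfolding b_def using k p t_pos[of "Suc k"]
      by (auto intro!: mult_left_mono epowr_mono integ_mono)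
    also have "\<dots> \<le> (\<Sum>j. b j * indicator {..z k} (z j))"
      using sum_le_suminf[of "\<lambda>j. b j * indicator {..z k} (z j)" "{k}"] by simp
    also have "\<dots> \<le> D.\<Phi> (z k)" unfolding D.\<Phi>_def emeasure_atoms by simp
    finally have own: "\<omega> (Suc k) * U ?t ?y epowr p \<le> D.\<Phi> (z k)" .
    \<comment> \<open>All atoms of index at least \<open>Suc k\<close> lie at or below
      \<open>t (Suc k)\<close>, which is less than \<open>z k\<close>, and are counted by \<Phi> at
      \<open>z k\<close>.\<close>
    have "(\<Sum>i. \<beta> (Suc k + i)) \<le> (\<Sum>i. \<beta> (i + Suc k) * indicator {..z k} (t (i + Suc k)))"
    proof (intro suminf_le)
      fix i
      have "t (i + Suc k) \<le> z k" using t_antimono[of "Suc k" "i + Suc k"] z[OF k] by simp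
      then show "\<beta> (Suc k + i) \<le> \<beta> (i + Suc k) * indicator {..z k} (t (i + Suc k))" by (simp add: add.commute)
    qed auto
    also have "\<dots> \<le> D.\<Phi> (z k)" unfolding D.\<Phi>_def emeasure_atoms
      using suminf_offset[of "\<lambda>i. \<beta> i * indicator {..z k} (t i)" "Suc k"] by (simp add: add_increasing)
    finally have "phi ?t \<le> 4 * ?g * D.\<Phi> (z k)"
      by (intro order_trans[OF phi_le_sum_\<beta>[of "Suc k"]] mult_left_mono) auto
    moreover have "?y \<in> J k" using z[OF k] t_dec[of k] by (auto simp: J_def)
    ultimately have "phi ?y \<le> 2 epowr (p + 1) * (4 * ?g * D.\<Phi> (z k) + D.\<Phi> (z k))"
      using own by (intro order_trans[OF phi_block_le[of ?y k]] mult_left_mono add_mono) auto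
    then show ?thesis by (simp add: distrib_left distrib_right mult.assoc)
  qed
  let ?c = "2 epowr (p + 1) * (4 * ?g + 1)"
  have "?L \<le> (\<Sum>k<n. ?c epowr r * (b k * (D.\<Phi> (z k) epowr r * rho v (z k) epowr r)))"
  proof (intro sum_mono)
    fix k assume k: "k \<in> {..<n}"
    have "phi (min (z k) (t k)) epowr r * (b k * rho v (z k) epowr r) \<le> (?c * D.\<Phi> (z k)) epowr r * (b k * rho v (z k) epowr r)"
      using k rf(1) by (intro mult_right_mono epowr_mono Phi) auto
    also have "\<dots> = ?c epowr r * (b k * (D.\<Phi> (z k) epowr r * rho v (z k) epowr r))"
      using rf(1) by (simp only: epowr_mult less_imp_le ac_simps)
    finally show "\<omega> (Suc k) * (phi (min (z k) (t k)) epowr r * (U (t (Suc k)) (z k) epowr p * rho v (z k) epowr r))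
        \<le> ?c epowr r * (b k * (D.\<Phi> (z k) epowr r * rho v (z k) epowr r))"
      using k by (simp add: b_def ac_simps)
  qed
  also have "\<dots> \<le> ?c epowr r * (\<Sum>k. b k * (D.\<Phi> (z k) epowr r * rho v (z k) epowr r))"
    unfolding sum_distrib_left[symmetric] by (intro mult_left_mono sum_le_suminf) auto
  also have "\<dots> \<le> ?c epowr r * (\<integral>\<^sup>+x. D.\<Phi> x epowr r * rho v x epowr r \<partial>atoms b z \<beta> t)"
    by (subst nn_integral_atoms) (auto intro!: mult_left_mono)
  also have "\<dots> \<le> ?c epowr r * (8 epowr (1 + r) * (4 epowr (1 / q) * C) epowr r)"
    by (intro mult_left_mono D) auto
  also have "\<dots> = lowerA_const * C epowr r"
    using rf(1) by (simp add: lowerA_const_def epowr_mult[of r "4 epowr (1 / q)"] mult.assoc)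
  finally show ?thesis .
qed

text \<open>\<open>sum_SUP_le\<close> reduces the block suprema to one point \<open>z k\<close> per
  block, and at these points atoms can be placed.\<close>

lemma nn_integral_sig_blocks_le:
  assumes q1: "q < 1" and C: "C < top"
  shows "(\<integral>\<^sup>+y. phi y epowr r * sig y * w y * indicator {0<..t 0} y \<partial>Lpos) \<le> lowerA_const * C epowr r"
proof -
  have "(\<integral>\<^sup>+y. phi y epowr r * sig y * w y * indicator {0<..t 0} y \<partial>Lpos)
     = (\<Sum>k. \<integral>\<^sup>+y. phi y epowr r * sig y * w y * indicator (J k) y \<partial>Lpos)"
    by (rule nn_integral_blocks) measurable
  also have "\<dots> \<le> (\<Sum>k. \<omega> (Suc k) * sig_block k)"
  proof (intro suminf_le)
    show "(\<integral>\<^sup>+y. phi y epowr r * sig y * w y * indicator (J k) y \<partial>Lpos) \<le> \<omega> (Suc k) * sig_block k" for k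
      unfolding mult.commute[of "\<omega> (Suc k)"] by (intro block_le phi_sig_le q1)
  qed auto
  also have "\<dots> \<le> lowerA_const * C epowr r"
  proof (rule suminf_le_const)
    fix n
    have "(\<Sum>k<n. \<omega> (Suc k) * sig_block k) = (\<Sum>k<n. SUP z\<in>{t (Suc k)<..}.
        \<omega> (Suc k) * (phi (min z (t k)) epowr r * (U (t (Suc k)) z epowr p * rho v z epowr r))) + 0"
      by (simp add: sig_block_def SUP_mult_left_ennreal)
    also have "\<dots> \<le> lowerA_const * C epowr r"
    proof (rule sum_SUP_le)
      fix z assume z: "\<And>k. k < n \<Longrightarrow> {t (Suc k)<..} \<noteq> {} \<Longrightarrow> z k \<in> {t (Suc k)<..}"
      have "{k. k < n \<and> {t (Suc k)<..} \<noteq> {}} = {..<n}" by auto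
      then show "(\<Sum>k | k < n \<and> {t (Suc k)<..} \<noteq> {}. \<omega> (Suc k) * (phi (min (z k) (t k)) epowr r *
          (U (t (Suc k)) (z k) epowr p * rho v (z k) epowr r))) + 0 \<le> lowerA_const * C epowr r"
        using choice_sum_le[OF q1 C, of n z] z by simp
    qed
    finally show "(\<Sum>k<n. \<omega> (Suc k) * sig_block k) \<le> lowerA_const * C epowr r" .
  qed simp
  finally show ?thesis .
qed

end

section \<open>Lower bounds on the whole half-line\<close>

context weights
begin

lemma nn_integral_B_le:
  assumes q1: "q < 1" and C: "C < top"
  shows "(\<integral>\<^sup>+y. W y epowr r * B y epowr r * w y \<partial>Lpos) \<le> 2 epowr r * 2 epowr (1 + r) * C epowr r"
proof (rule exhaust_le)
  have "W \<in> borel_measurable Lpos" by (rule integ_measurable_right) simp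
  then show "(\<lambda>y. W y epowr r * B y epowr r * w y) \<in> borel_measurable Lpos" by measurable
next
  fix X assume X: "0 < X" "W X < top"
  then obtain t where t: "t 0 = X" "blocks m q u w v t" using blocks_exist by blast
  interpret blocks m q u w v t by fact
  have "2 epowr r * (\<Sum>k. \<omega> k epowr (1 + r) * B (t k) epowr r) \<le> 2 epowr r * (2 epowr (1 + r) * C epowr r)"
    by (intro mult_left_mono sum_B_le q1 C) auto
  then show "(\<integral>\<^sup>+y. W y epowr r * B y epowr r * w y * indicator {0<..X} y \<partial>Lpos) \<le> 2 epowr r * 2 epowr (1 + r) * C epowr r"
    using nn_integral_B_blocks_le[OF q1] t by (simp add: mult.assoc)
qed (use B_eq_0 r_facts(1)[OF q1] in simp)

lemma nn_integral_sig_le: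
  assumes q1: "q < 1" and C: "C < top"
  shows "(\<integral>\<^sup>+y. phi y epowr r * sig y * w y \<partial>Lpos) \<le> lowerA_const * C epowr r"
proof (rule exhaust_le)
  show "(\<lambda>y. phi y epowr r * sig y * w y) \<in> borel_measurable Lpos" by measurable
next
  fix X assume X: "0 < X" "W X < top"
  then obtain t where t: "t 0 = X" "blocks m q u w v t" using blocks_exist by blast
  interpret blocks m q u w v t by fact
  show "(\<integral>\<^sup>+y. phi y epowr r * sig y * w y * indicator {0<..X} y \<partial>Lpos) \<le> lowerA_const * C epowr r"
    using nn_integral_sig_blocks_le[OF q1 C] t by simp
qed (use sig_eq_0 in simp)

end

section \<open>Upper bounds\<close>

context exponents
begin

text \<open>The 4 comes from summation against halving weights, 2^q is the p-th power of the 2^m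
  that splits the m-th power of the tail, and 2^p splits the p-th power.\<close>

definition upper_const :: ennreal where
  "upper_const = 4 * (absorb_const p * 2 epowr (q + p))"

definition upper_ge1_const :: ennreal where
  "upper_ge1_const = (2 * upper_const) epowr (1 / q) * (2 * 2 epowr (1 / q) + 1)"

definition sum_const :: ennreal where
  "sum_const = 4 epowr r * (3 * 2 epowr (1 + r) + 2 epowr (r + 1))"

definition upper_less1_const :: ennreal where
  "upper_less1_const = (2 * upper_const) epowr (1 / q) *
     ((2 epowr (r + 2) * sum_const + 2 epowr (1 + r)) epowr (1 / r) * 2 epowr (1 / r))"

lemma upper_const_finite: "upper_const < top" "upper_ge1_const < top" "q < 1 \<Longrightarrow> upper_less1_const < top"
proof -
  show 1: "upper_const < top"
    using m q p absorb_const(2)[OF p] by (auto simp: upper_const_def ennreal_mult_less_top intro!: epowr_less_top)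
  show "upper_ge1_const < top"
    using 1 q by (auto simp: upper_ge1_const_def ennreal_mult_less_top intro!: epowr_less_top)
  assume q1: "q < 1"
  have "sum_const < top"
    using r_facts(1)[OF q1]
    by (auto simp: sum_const_def ennreal_mult_less_top intro!: epowr_less_top)
  then show "upper_less1_const < top"
    using 1 q r_facts(1)[OF q1]
    by (auto simp: upper_less1_const_def ennreal_mult_less_top intro!: epowr_less_top)
qed

end

context weights
begin

lemma N_exhaust_le:
  assumes "\<And>x. 0 < x \<Longrightarrow> W x < top \<Longrightarrow> (\<integral>\<^sup>+y. loc h y epowr p * w y * indicator {0<..x} y \<partial>Lpos) \<le> K"
  shows "N h \<le> K"
  unfolding N_def
proof (rule exhaust_le[OF _ assms])
  fix y assume "0 < y" "W y = top"
  then show "loc h y epowr p * w y = 0" using loc_eq_0[OF _ U_eq_0, of y h] p by simp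
qed measurable

end

section \<open>Splitting a test function along the blocks\<close>

context blocks
begin

text \<open>Shifted against J so that \<open>t k\<close> is the left end of piece k; piece 0 takes
  the part of h beyond \<open>t 0\<close>.\<close>

definition Jb :: "nat \<Rightarrow> real set" where
  "Jb k = (case k of 0 \<Rightarrow> {t 0<..} | Suc j \<Rightarrow> J j)"

lemma Jb_gt: "z \<in> Jb k \<Longrightarrow> t k < z"
  by (auto simp: Jb_def J_def split: nat.splits)

definition hk :: "(real \<Rightarrow> ennreal) \<Rightarrow> nat \<Rightarrow> real \<Rightarrow> ennreal" where
  "hk h k y = h y * indicator (Jb k) y"

lemma Jb_borel [measurable]: "Jb k \<in> sets borel"
  by (cases k) (auto simp: Jb_def)

lemma disjoint_Jb: "disjoint_family Jb"
proof -
  have "Jb i \<inter> Jb j = {}" if ij: "i < j" for i j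
  proof -
    obtain k where k: "j = Suc k" "i \<le> k" using ij by (cases j) auto
    have "z \<le> t i" if "z \<in> Jb j" for z
      using that k t_antimono[of i k] by (auto simp: Jb_def J_def)
    then show ?thesis using Jb_gt by force
  qed
  then show ?thesis unfolding disjoint_family_on_def by (metis Int_commute linorder_neqE_nat)
qed

lemma hk_Mplus: "h \<in> Mplus \<Longrightarrow> hk h k \<in> Mplus"
proof -
  assume "h \<in> Mplus"
  then have [measurable]: "h \<in> borel_measurable Lpos" by (simp add: Mplus_def)
  show "hk h k \<in> Mplus" unfolding Mplus_def hk_def by measurable
qed

lemma sum_I_hk_le: assumes "h \<in> Mplus" shows "(\<Sum>k. I (hk h k)) \<le> I h"
proof -
  have [measurable]: "h \<in> borel_measurable Lpos" using assms by (simp add: Mplus_def)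
  have "(\<Sum>k. I (hk h k)) = (\<integral>\<^sup>+y. (\<Sum>k. hk h k y * v y) \<partial>Lpos)"
    unfolding cost_def hk_def by (rule nn_integral_suminf[symmetric]) measurable
  also have "\<dots> = (\<integral>\<^sup>+y. (h y * v y) * (\<Sum>k. indicator (Jb k) y) \<partial>Lpos)"
    unfolding hk_def by (subst ennreal_suminf_cmult[symmetric]) (simp only: ac_simps)
  also have "\<dots> \<le> I h" unfolding cost_def suminf_indicator[OF disjoint_Jb]
    by (intro nn_integral_mono) (auto split: split_indicator)
  finally show ?thesis .
qed

lemma I_hk_le: "I (hk h k) \<le> I h"
  unfolding cost_def hk_def by (intro nn_integral_mono) (auto split: split_indicator)

lemma loc_t0: "loc h (t 0) = loc (hk h 0) (t 0)"
proof -
  have "tail h s = tail (hk h 0) s" if "t 0 < s" for s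
    unfolding tail_def hk_def Jb_def using that
    by (intro nn_integral_cong) (auto split: split_indicator)
  then show ?thesis unfolding loc_def tail_def[of _ "t 0"]
    by (intro nn_integral_cong) (auto split: split_indicator)
qed

text \<open>For s in \<open>J k\<close> the tail of h is the mass inside the block plus
  \<open>tail h (t k)\<close>. The first part gives the local term, the second is constant on the
  block and gives the atomic term. What lies beyond \<open>t k\<close> is \<open>loc h (t k)\<close>
  with coefficient exactly 1, as absorption requires.\<close>

lemma loc_Suc_le:
  assumes h: "h \<in> Mplus"
  shows "loc h (t (Suc k)) \<le> loc h (t k) + 2 epowr m * (tail h (t k) epowr m * U (t (Suc k)) (t k) + loc (hk h (Suc k)) (t (Suc k)))"
proof -
  have [measurable]: "h \<in> borel_measurable Lpos" using h by (simp add: Mplus_def)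
  let ?t = "t (Suc k)"
  have t: "0 < ?t" "?t < t k" using t_pos t_dec by auto
  have tail_le: "tail h s \<le> tail (hk h (Suc k)) s + tail h (t k)" if s: "s \<in> J k" for s
  proof -
    have "tail h s = (\<integral>\<^sup>+y. hk h (Suc k) y * indicator {s<..} y + h y * indicator {t k<..} y \<partial>Lpos)"
      unfolding tail_def hk_def Jb_def using s
      by (intro nn_integral_cong) (auto simp: J_def split: split_indicator)
    also have "\<dots> = tail (hk h (Suc k)) s + tail h (t k)"
      unfolding tail_def hk_def by (rule nn_integral_add) measurable
    finally show ?thesis by simp
  qed
  define F where "F s = tail h s epowr m * u s" for s
  have [measurable]: "F \<in> borel_measurable Lpos" unfolding F_def by measurable
  have "loc h ?t = (\<integral>\<^sup>+s. F s * indicator {t k<..} s + F s * indicator (J k) s \<partial>Lpos)"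
    unfolding loc_def tail_def[of _ ?t] F_def using t
    by (intro nn_integral_cong) (auto simp: J_def split: split_indicator)
  also have "\<dots> = loc h (t k) + (\<integral>\<^sup>+s. F s * indicator (J k) s \<partial>Lpos)"
    unfolding loc_def tail_def[of _ "t k"] F_def[symmetric] by (rule nn_integral_add) measurable
  also have "(\<integral>\<^sup>+s. F s * indicator (J k) s \<partial>Lpos) \<le>
     (\<integral>\<^sup>+s. 2 epowr m * (tail (hk h (Suc k)) s epowr m * u s * indicator {?t<..} s + tail h (t k) epowr m * (u s * indicator {?t<..t k} s)) \<partial>Lpos)"
  proof (intro nn_integral_mono)
    fix s
    show "F s * indicator (J k) s \<le> 2 epowr m * (tail (hk h (Suc k)) s epowr m * u s * indicator {?t<..} s + tail h (t k) epowr m * (u s * indicator {?t<..t k} s))"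
    proof (cases "s \<in> J k")
      case True
      have "tail h s epowr m \<le> (tail (hk h (Suc k)) s + tail h (t k)) epowr m"
        using m by (intro epowr_mono tail_le True) auto
      also have "\<dots> \<le> 2 epowr m * (tail (hk h (Suc k)) s epowr m + tail h (t k) epowr m)"
        using m by (intro epowr_add_le) auto
      finally have "F s \<le> 2 epowr m * (tail (hk h (Suc k)) s epowr m + tail h (t k) epowr m) * u s"
        unfolding F_def by (intro mult_right_mono) auto
      then show ?thesis using True by (simp add: J_def distrib_left distrib_right mult.assoc)
    qed simp
  qed
  also have "\<dots> = 2 epowr m * (loc (hk h (Suc k)) ?t + tail h (t k) epowr m * U ?t (t k))"
    using t by (subst nn_integral_cmult, measurable, subst nn_integral_add, measurable)
       (simp add: nn_integral_cmult loc_def tail_def[of _ ?t] integ_Ioc)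
  finally show ?thesis by (simp add: add_left_mono add.commute)
qed

text \<open>\<open>loc_Suc_le\<close> is a recursion that can be absorbed against the halving
  \<omega>. Its inhomogeneity consists of the atomic and the local term, so from here on the two
  Hardy problems are separate.\<close>

lemma sum_loc_le:
  assumes h: "h \<in> Mplus"
  shows "(\<integral>\<^sup>+y. loc h y epowr p * w y * indicator {0<..t 0} y \<partial>Lpos) \<le>
    upper_const * ((\<Sum>k. \<beta> k * tail h (t k) epowr q) + (\<Sum>k. \<omega> k * loc (hk h k) (t k) epowr p))"
proof -
  let ?g = "absorb_const p"
  \<comment> \<open>The recursion starts at \<open>t 0\<close> without an atomic term, hence the 0;
    the shift by one makes \<open>\<omega> k * G k\<close> a term with \<beta>.\<close>
  define G where "G k = (case k of 0 \<Rightarrow> 0 | Suc j \<Rightarrow> tail h (t j) epowr q * U (t (Suc j)) (t j) epowr p)" for k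
  define d where "d k = loc (hk h k) (t k) epowr p" for k
  define c where "c = ?g * 2 epowr (q + p)"
  have c1: "1 \<le> c" unfolding c_def using mult_mono[OF absorb_const(1)[OF p] epowr_mono[of 1 2 "q + p"]] q p by simp
  have "(\<integral>\<^sup>+y. loc h y epowr p * w y * indicator {0<..t 0} y \<partial>Lpos)
     = (\<Sum>k. \<integral>\<^sup>+y. loc h y epowr p * w y * indicator (J k) y \<partial>Lpos)"
    by (rule nn_integral_blocks) measurable
  also have "\<dots> \<le> (\<Sum>k. loc h (t (Suc k)) epowr p * \<omega> (Suc k))"
    using p by (intro suminf_le block_le epowr_mono loc_antimono) (auto simp: J_def)
  also have "\<dots> \<le> (\<Sum>k. loc h (t k) epowr p * \<omega> k)"
    using suminf_offset[of "\<lambda>k. loc h (t k) epowr p * \<omega> k" 1] by simp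
  also have "\<dots> = (\<Sum>k. \<omega> k * loc h (t k) epowr p)" by (simp only: mult.commute)
  also have "\<dots> \<le> 4 * (\<Sum>k. \<omega> k * (c * (G k + d k)))"
  proof (rule halving_weights_sum_le)
    show "2 * \<omega> (Suc k) = \<omega> k" for k by (rule W_half)
    show "loc h (t 0) epowr p \<le> c * (G 0 + d 0)"
      using mult_right_mono[OF c1, of "d 0"] unfolding loc_t0[of h] G_def d_def by simp
    fix k
    let ?a = "tail h (t k) epowr m * U (t (Suc k)) (t k)" and ?b = "loc (hk h (Suc k)) (t (Suc k))"
    have "2 * loc h (t (Suc k)) epowr p \<le> 2 * (loc h (t k) + 2 epowr m * (?a + ?b)) epowr p"
      using p by (intro mult_left_mono epowr_mono loc_Suc_le h) auto
    also have "\<dots> \<le> 3 * loc h (t k) epowr p + 2 * ?g * (2 epowr m * (?a + ?b)) epowr p"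
      by (rule absorb_const(3)[OF p])
    also have "\<dots> \<le> 3 * loc h (t k) epowr p + 2 * ?g * (2 epowr q * (2 epowr p * (?a epowr p + ?b epowr p)))"
    proof (intro add_left_mono mult_left_mono)
      have "(2 epowr m * (?a + ?b)) epowr p = 2 epowr q * (?a + ?b) epowr p"
        using p m by (simp add: epowr_mult epowr_epowr)
      also have "\<dots> \<le> 2 epowr q * (2 epowr p * (?a epowr p + ?b epowr p))"
        using p by (intro mult_left_mono epowr_add_le) auto
      finally show "(2 epowr m * (?a + ?b)) epowr p \<le> 2 epowr q * (2 epowr p * (?a epowr p + ?b epowr p))" .
    qed auto
    also have "2 * ?g * (2 epowr q * (2 epowr p * (?a epowr p + ?b epowr p))) = 2 * (c * (G (Suc k) + d (Suc k)))"
    proof -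
      have "?a epowr p = G (Suc k)" using p m by (simp add: G_def epowr_mult epowr_epowr)
      moreover have "2 epowr (q + p) = 2 epowr q * 2 epowr p" using p q by (intro epowr_add) auto
      ultimately show ?thesis by (simp only: d_def c_def mult.assoc)
    qed
    finally show "2 * loc h (t (Suc k)) epowr p \<le> 3 * loc h (t k) epowr p + 2 * (c * (G (Suc k) + d (Suc k)))" .
  qed
  also have "(\<Sum>k. \<omega> k * (c * (G k + d k))) = (\<Sum>k. c * (\<omega> k * G k + \<omega> k * d k))"
    by (intro suminf_cong) (simp only: distrib_left ac_simps)
  also have "\<dots> = c * ((\<Sum>k. \<omega> k * G k) + (\<Sum>k. \<omega> k * d k))"
    by (subst suminf_add) auto
  also have "(\<Sum>k. \<omega> k * G k) = (\<Sum>k. \<beta> k * tail h (t k) epowr q)"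
    using suminf_offset[of "\<lambda>k. \<omega> k * G k" 1] by (simp add: G_def \<beta>_def ac_simps)
  finally show ?thesis by (simp add: upper_const_def c_def d_def mult.assoc)
qed

section \<open>The atomic measure at the block ends\<close>

abbreviation "\<nu> \<equiv> atoms (\<lambda>_. 0) t \<beta> t"

lemma pos_distribution_\<nu>: "pos_distribution \<nu>"
  by (rule pos_distribution_atoms[of _ 0]) auto

lemma nn_integral_\<nu>: "g \<in> borel_measurable borel \<Longrightarrow> (\<integral>\<^sup>+x. g x \<partial>\<nu>) = (\<Sum>k. \<beta> k * g (t k))"
  by (simp add: nn_integral_atoms)

abbreviation "\<Phi>\<nu> \<equiv> pos_distribution.\<Phi> \<nu>"

lemma \<Phi>\<nu>: "\<Phi>\<nu> y = (\<Sum>k. \<beta> k * indicator {..y} (t k))"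
  by (simp add: pos_distribution.\<Phi>_def[OF pos_distribution_\<nu>] emeasure_atoms)

lemma \<Phi>\<nu>_le: "0 < y \<Longrightarrow> \<Phi>\<nu> y \<le> 2 * phi y"
  unfolding \<Phi>\<nu> by (rule sum_\<beta>_le_phi)

lemma loc_hk_le:
  assumes fin: "B (t k) < top" and h: "h \<in> Mplus" "I h < top"
  shows "loc (hk h k) (t k) epowr p \<le> (B (t k) * I (hk h k)) epowr q"
proof -
  have "I (hk h k) < top" using I_hk_le h(2) by (rule le_less_trans)
  then have "loc (hk h k) (t k) epowr (1 / m) \<le> B (t k) * I (hk h k)"
    by (intro loc_le_B fin hk_Mplus h)
  then have "(loc (hk h k) (t k) epowr (1 / m)) epowr q \<le> (B (t k) * I (hk h k)) epowr q"
    using q by (intro epowr_mono) auto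
  then show ?thesis by (simp add: epowr_epowr)
qed

text \<open>The atomic sum is Hardy's inequality for \<nu>, whose condition follows from \<Phi>\<nu>
  \<le> 2 * phi. The local sum is estimated block by block through B, and q \<ge> 1 allows the costs
  to be added inside the q-th power.\<close>

lemma upper_ge1_blocks:
  assumes q1: "1 \<le> q" and h: "h \<in> Mplus" "I h < top"
    and A: "A < top" "AE y in Lpos. phi y epowr (1 / q) * inverse (v y) \<le> A"
    and S: "S < top" "\<And>t. 0 < t \<Longrightarrow> W t epowr (1 / q) * B t \<le> S"
  shows "(\<integral>\<^sup>+y. loc h y epowr p * w y * indicator {0<..t 0} y \<partial>Lpos) \<le>
    2 * upper_const * ((2 * 2 epowr (1 / q) + 1) * (A + S) * I h) epowr q"
proof -
  let ?c = "2 * 2 epowr (1 / q) + 1"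
  have fin: "B (t k) < top" for k
  proof -
    have "\<omega> k epowr (1 / q) * B (t k) < top" using S(2)[OF t_pos[of k]] S(1) by (rule le_less_trans)
    then show ?thesis using \<omega>_bounds(1)[of k] q
      by (cases "B (t k) = top") (auto simp: ennreal_mult_top less_top[symmetric] split: if_splits)
  qed
  have K: "2 epowr (1 / q) * A < top" using A(1) q by (simp add: ennreal_mult_less_top)
  have "(\<Sum>k. \<beta> k * tail h (t k) epowr q) = (\<integral>\<^sup>+x. tail h x epowr q \<partial>\<nu>)"
    by (rule nn_integral_\<nu>[symmetric]) measurable
  also have "\<dots> \<le> 2 epowr q * (2 epowr (1 / q) * A * I h) epowr q"
  proof (rule pos_distribution.Hardy_ge1[OF pos_distribution_\<nu> h(1) v q1 K])
    show "AE y in Lpos. \<Phi>\<nu> y epowr (1 / q) * inverse (v y) \<le> 2 epowr (1 / q) * A"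
      using A(2) AE_space
    proof (rule eventually_elim2)
      fix y assume y: "phi y epowr (1 / q) * inverse (v y) \<le> A" "y \<in> space Lpos"
      then have "\<Phi>\<nu> y epowr (1 / q) \<le> (2 * phi y) epowr (1 / q)"
        using q by (intro epowr_mono \<Phi>\<nu>_le) auto
      also have "\<dots> = 2 epowr (1 / q) * phi y epowr (1 / q)" using q by (intro epowr_mult) auto
      finally have "\<Phi>\<nu> y epowr (1 / q) * inverse (v y) \<le> 2 epowr (1 / q) * phi y epowr (1 / q) * inverse (v y)"
        by (intro mult_right_mono) auto
      also have "\<dots> \<le> 2 epowr (1 / q) * A" using y by (simp add: mult.assoc mult_left_mono)
      finally show "\<Phi>\<nu> y epowr (1 / q) * inverse (v y) \<le> 2 epowr (1 / q) * A" .
    qed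
  qed (rule h(2))
  also have "\<dots> = ((2 * 2 epowr (1 / q)) * A * I h) epowr q"
    using q by (simp add: epowr_mult mult.assoc)
  also have "\<dots> \<le> (?c * (A + S) * I h) epowr q"
    using q by (intro epowr_mono mult_mono) (auto simp: add_increasing2)
  finally have 1: "(\<Sum>k. \<beta> k * tail h (t k) epowr q) \<le> (?c * (A + S) * I h) epowr q" .
  have "(\<Sum>k. \<omega> k * loc (hk h k) (t k) epowr p) \<le> (\<Sum>k. (S * I (hk h k)) epowr q)"
  proof (intro suminf_le)
    fix k
    have "\<omega> k * loc (hk h k) (t k) epowr p \<le> \<omega> k * (B (t k) * I (hk h k)) epowr q"
      by (intro mult_left_mono loc_hk_le fin h) auto
    also have "\<dots> = (\<omega> k epowr (1 / q) * B (t k) * I (hk h k)) epowr q"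
      using q by (simp add: epowr_mult epowr_epowr ac_simps)
    also have "\<dots> \<le> (S * I (hk h k)) epowr q"
      using q by (intro epowr_mono mult_right_mono mult_left_mono S(2) t_pos) auto
    finally show "\<omega> k * loc (hk h k) (t k) epowr p \<le> (S * I (hk h k)) epowr q" .
  qed auto
  also have "\<dots> \<le> (\<Sum>k. S * I (hk h k)) epowr q" by (rule epowr_suminf_le[OF q1])
  also have "\<dots> \<le> (?c * (A + S) * I h) epowr q"
    using q sum_I_hk_le[OF h(1)] mult_mono[of 1 ?c S "A + S"]
    by (intro epowr_mono order_trans[OF eq_refl[OF ennreal_suminf_cmult] mult_mono]) (auto simp: add_increasing)
  finally have 2: "(\<Sum>k. \<omega> k * loc (hk h k) (t k) epowr p) \<le> (?c * (A + S) * I h) epowr q" .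
  have "(\<integral>\<^sup>+y. loc h y epowr p * w y * indicator {0<..t 0} y \<partial>Lpos) \<le>
    upper_const * ((?c * (A + S) * I h) epowr q + (?c * (A + S) * I h) epowr q)"
    by (intro order_trans[OF sum_loc_le[OF h(1)]] mult_left_mono add_mono 1 2) auto
  also have "\<dots> = 2 * upper_const * (?c * (A + S) * I h) epowr q"
    by (simp only: mult_2[symmetric] ac_simps)
  finally show ?thesis .
qed

text \<open>On \<open>J k\<close> W is at least \<open>\<omega> k / 2\<close> and B at least
  \<open>B (t k)\<close>, and the block has mass \<open>\<omega> k / 2\<close>.\<close>

lemma sum_B_le_nn_integral:
  assumes q1: "q < 1"
  shows "(\<Sum>k. \<omega> k epowr (1 + r) * B (t k) epowr r) \<le> 2 epowr (1 + r) * (\<integral>\<^sup>+y. W y epowr r * B y epowr r * w y \<partial>Lpos)"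
proof -
  have r0: "0 < r" by (rule r_facts(1)[OF q1])
  have [measurable]: "W \<in> borel_measurable Lpos" by (rule integ_measurable_right) simp
  have "(\<Sum>k. \<omega> k epowr (1 + r) * B (t k) epowr r) \<le> (\<Sum>k. 2 epowr (1 + r) * (\<integral>\<^sup>+y. W y epowr r * B y epowr r * w y * indicator (J k) y \<partial>Lpos))"
  proof (intro suminf_le)
    fix k
    have "\<omega> k epowr (1 + r) * B (t k) epowr r = 2 epowr (1 + r) * ((\<omega> (Suc k) epowr r * B (t k) epowr r) * \<omega> (Suc k))"
      unfolding W_half[of k, symmetric] using r0 by (simp add: epowr_mult epowr_add ac_simps)
    also have "\<dots> \<le> 2 epowr (1 + r) * (\<integral>\<^sup>+y. W y epowr r * B y epowr r * w y * indicator (J k) y \<partial>Lpos)"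
      using r0 t_pos[of "Suc k"] by (intro mult_left_mono block_ge mult_mono epowr_mono integ_mono B_antimono) (auto simp: J_def)
    finally show "\<omega> k epowr (1 + r) * B (t k) epowr r \<le> 2 epowr (1 + r) * (\<integral>\<^sup>+y. W y epowr r * B y epowr r * w y * indicator (J k) y \<partial>Lpos)" .
  qed auto
  also have "\<dots> = 2 epowr (1 + r) * (\<integral>\<^sup>+y. W y epowr r * B y epowr r * w y * indicator {0<..t 0} y \<partial>Lpos)"
    by (subst nn_integral_blocks) auto
  also have "\<dots> \<le> 2 epowr (1 + r) * (\<integral>\<^sup>+y. W y epowr r * B y epowr r * w y \<partial>Lpos)"
    by (intro mult_left_mono nn_integral_mono) (auto split: split_indicator)
  finally show ?thesis .
qed

text \<open>Two atoms are split off, not one: the remaining \<open>phi\<close> is then taken at the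
  left end of \<open>J (Suc k)\<close>, the block over which \<open>\<beta>_phi_rho_le\<close>
  spreads \<open>\<beta> k\<close>, and \<open>phi\<close> is at least this value there.\<close>

lemma \<Phi>\<nu>_t_le: "\<Phi>\<nu> (t k) \<le> \<beta> k + \<beta> (Suc k) + 2 * phi (t (Suc (Suc k)))"
proof -
  let ?K = "Suc (Suc k)"
  define f where "f j = \<beta> j * indicator {..t k} (t j)" for j
  have z: "f j = 0" if "j < k" for j
  proof -
    have "t k < t j" using t_antimono[of "Suc j" k] t_dec[of j] that by auto
    then show ?thesis by (simp add: f_def)
  qed
  have "\<Phi>\<nu> (t k) = (\<Sum>j. f j)"
    unfolding \<Phi>\<nu> f_def ..
  also have "\<dots> = (\<Sum>j. f (j + ?K)) + (\<Sum>j<?K. f j)" by (rule suminf_offset) simp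
  also have "(\<Sum>j<?K. f j) \<le> \<beta> k + \<beta> (Suc k)"
    using z by (simp add: add_mono) (auto simp: f_def intro!: add_mono split: split_indicator)
  also have "(\<Sum>j. f (j + ?K)) \<le> (\<Sum>j. \<beta> (j + ?K) * indicator {..t ?K} (t (j + ?K)))"
    using t_antimono[of ?K] by (intro suminf_le) (auto simp: f_def split: split_indicator)
  also have "\<dots> \<le> (\<Sum>j. \<beta> j * indicator {..t ?K} (t j))"
    using suminf_offset[of "\<lambda>j. \<beta> j * indicator {..t ?K} (t j)" ?K] by simp
  also have "\<dots> \<le> 2 * phi (t ?K)" by (rule sum_\<beta>_le_phi[OF t_pos])
  finally show ?thesis by (simp add: add.commute add_left_mono)
qed

text \<open>As p * (1 + r) = r / m, the power of U on the left is the one in the unit-mass bound for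
  \<open>B (t (Suc k))\<close>.\<close>

lemma \<beta>_rho_le:
  assumes q1: "q < 1" and fin: "\<And>k. B (t k) < top"
  shows "\<beta> k epowr (1 + r) * rho v (t k) epowr r \<le> \<omega> (Suc k) epowr (1 + r) * B (t (Suc k)) epowr r"
proof -
  have r0: "0 < r" by (rule r_facts(1)[OF q1])
  have "\<beta> k epowr (1 + r) * rho v (t k) epowr r = \<omega> (Suc k) epowr (1 + r) * (U (t (Suc k)) (t k) epowr (r / m) * rho v (t k) epowr r)"
    unfolding \<beta>_def using r0 by (simp only: epowr_mult epowr_epowr r_facts(4)[OF q1] mult.assoc less_imp_le add_nonneg_nonneg zero_le_one)
  also have "\<dots> \<le> \<omega> (Suc k) epowr (1 + r) * B (t (Suc k)) epowr r"
    using t_pos[of k] by (intro mult_left_mono U_rho_power_le q1 t_pos fin) auto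
  finally show ?thesis .
qed

text \<open>The factor \<open>\<omega> (Suc k)\<close> of \<open>\<beta> k\<close> is twice the mass
  of \<open>J (Suc k)\<close>. For y in that block and z beyond \<open>t k\<close>,
  \<open>U y z\<close> contains \<open>U (t (Suc k)) (t k)\<close>, so \<open>sig y\<close>
  dominates the remaining factor.\<close>

lemma \<beta>_phi_rho_le:
  assumes q1: "q < 1"
  shows "\<beta> k * phi (t (Suc (Suc k))) epowr r * rho v (t k) epowr r \<le> 2 * (\<integral>\<^sup>+y. phi y epowr r * sig y * w y * indicator (J (Suc k)) y \<partial>Lpos)"
proof -
  have r0: "0 < r" by (rule r_facts(1)[OF q1])
  let ?K = "Suc (Suc k)" and ?U = "U (t (Suc k)) (t k) epowr p"
  have sig: "?U * rho v (t k) epowr r \<le> sig y" if y: "y \<in> J (Suc k)" for y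
  proof (rule mult_rho_power_le[OF v _ _ r0])
    have ty: "0 < y" "y \<le> t (Suc k)" "t (Suc k) < t k" using y t_pos[of ?K] t_dec[of k] by (auto simp: J_def)
    show "0 \<le> t k" "?U < top" using ty U_finite[OF t_pos] p by (auto intro!: epowr_less_top)
    show "AE z in Lpos. t k < z \<longrightarrow> ?U * inverse (v z) epowr r \<le> sig y"
      using sig_AE[OF less_imp_le[OF ty(1)]]
    proof (rule eventually_mono, intro impI)
      fix z assume z: "y < z \<longrightarrow> U y z epowr p * inverse (v z) epowr r \<le> sig y" "t k < z"
      have "?U * inverse (v z) epowr r \<le> U y z epowr p * inverse (v z) epowr r"
        using ty z p by (intro mult_right_mono epowr_mono integ_mono) auto
      then show "?U * inverse (v z) epowr r \<le> sig y" using z ty by (auto intro: order_trans)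
    qed
  qed
  have "\<beta> k * phi (t ?K) epowr r * rho v (t k) epowr r = 2 * ((phi (t ?K) epowr r * (?U * rho v (t k) epowr r)) * \<omega> ?K)"
    unfolding \<beta>_def by (simp only: \<omega>_mult[of "Suc k"] ac_simps)
  also have "\<dots> \<le> 2 * (\<integral>\<^sup>+y. phi y epowr r * sig y * w y * indicator (J (Suc k)) y \<partial>Lpos)"
    using r0 t_pos[of ?K] by (intro mult_left_mono block_ge mult_mono epowr_mono phi_mono sig) (auto simp: J_def)
  finally show ?thesis .
qed

text \<open>Of the three parts of \<open>\<Phi>\<nu> (t k)\<close>, the two atoms are controlled by
  B, the neighbouring one after decoupling by \<open>mult_epowr_le_max\<close>, and the remainder by
  \<open>sig\<close>. In the neighbour's term \<open>rho v\<close> may be moved to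
  \<open>t (Suc k)\<close>, where it is larger.\<close>

lemma sum_\<beta>_\<Phi>_rho_le:
  assumes q1: "q < 1" and fin: "\<And>k. B (t k) < top"
  shows "(\<integral>\<^sup>+x. \<Phi>\<nu> x epowr r * rho v x epowr r \<partial>\<nu>) \<le>
    sum_const * ((\<integral>\<^sup>+y. W y epowr r * B y epowr r * w y \<partial>Lpos) + (\<integral>\<^sup>+y. phi y epowr r * sig y * w y \<partial>Lpos))"
    (is "_ \<le> _ * (?Q + ?A)")
proof -
  have r0: "0 < r" by (rule r_facts(1)[OF q1])
  let ?P = \<Phi>\<nu>
  define E where "E k = \<omega> k epowr (1 + r) * B (t k) epowr r" for k
  define Z where "Z k = (\<integral>\<^sup>+y. phi y epowr r * sig y * w y * indicator (J k) y \<partial>Lpos)" for k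
  have term_le: "\<beta> k * (?P (t k) epowr r * rho v (t k) epowr r) \<le> 4 epowr r * (2 * E (Suc k) + E (Suc (Suc k)) + 2 epowr (r + 1) * Z (Suc k))" for k
  proof -
    let ?K = "Suc (Suc k)" and ?r = "rho v (t k) epowr r"
    let ?x = "\<beta> k" and ?y = "\<beta> (Suc k)" and ?z = "phi (t (Suc (Suc k)))"
    have own: "\<beta> k epowr (1 + r) * rho v (t k) epowr r \<le> E (Suc k)" for k
      unfolding E_def by (rule \<beta>_rho_le[OF q1 fin])
    have "?P (t k) epowr r \<le> 4 epowr r * (?x epowr r + ?y epowr r + (2 * ?z) epowr r)"
      using r0 by (intro order_trans[OF epowr_mono epowr_add3_le] \<Phi>\<nu>_t_le) auto
    then have "?x * (?P (t k) epowr r * ?r) \<le> ?x * (4 epowr r * (?x epowr r + ?y epowr r + (2 * ?z) epowr r) * ?r)"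
      by (intro mult_left_mono mult_right_mono) auto
    also have "\<dots> = 4 epowr r * (?x * ?x epowr r * ?r + ?x * ?y epowr r * ?r + 2 epowr r * (?x * ?z epowr r * ?r))"
      using r0 by (simp only: epowr_mult less_imp_le distrib_left distrib_right ac_simps)
    also have "\<dots> \<le> 4 epowr r * (E (Suc k) + (E (Suc k) + E ?K) + 2 epowr r * (2 * Z (Suc k)))"
    proof (intro mult_left_mono add_mono)
      show "?x * ?x epowr r * ?r \<le> E (Suc k)" using own[of k] r0 by (simp add: epowr_add)
      have "?x * ?y epowr r * ?r \<le> (?x epowr (1 + r) + ?y epowr (1 + r)) * ?r"
        using r0 by (intro mult_right_mono mult_epowr_le_max) auto
      also have "\<dots> \<le> ?x epowr (1 + r) * ?r + ?y epowr (1 + r) * rho v (t (Suc k)) epowr r"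
        unfolding distrib_right using r0 t_dec[of k]
        by (intro add_left_mono mult_left_mono epowr_mono rho_antimono) auto
      also have "\<dots> \<le> E (Suc k) + E ?K" by (intro add_mono own)
      finally show "?x * ?y epowr r * ?r \<le> E (Suc k) + E ?K" .
      show "?x * ?z epowr r * ?r \<le> 2 * Z (Suc k)" unfolding Z_def by (rule \<beta>_phi_rho_le[OF q1])
    qed auto
    also have "\<dots> = 4 epowr r * (2 * E (Suc k) + E ?K + 2 epowr (r + 1) * Z (Suc k))"
    proof -
      have "2 epowr (r + 1) = 2 epowr r * 2" using epowr_add[of r 1 2] r0 by simp
      then show ?thesis by (simp only: mult_2 mult.assoc add.assoc)
    qed
    finally show ?thesis .
  qed
  have E: "(\<Sum>k. E k) \<le> 2 epowr (1 + r) * ?Q"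
    unfolding E_def by (rule sum_B_le_nn_integral[OF q1])
  have E1: "(\<Sum>k. E (Suc k)) \<le> (\<Sum>k. E k)" "(\<Sum>k. E (Suc (Suc k))) \<le> (\<Sum>k. E k)"
    by (rule suminf_Suc_le, rule order_trans[OF suminf_Suc_le[of "\<lambda>k. E (Suc k)"] suminf_Suc_le])
  have Z: "(\<Sum>k. Z (Suc k)) \<le> ?A"
  proof -
    have "(\<Sum>k. Z (Suc k)) \<le> (\<Sum>k. Z k)" using suminf_offset[of Z 1] by simp
    also have "\<dots> = (\<integral>\<^sup>+y. phi y epowr r * sig y * w y * indicator {0<..t 0} y \<partial>Lpos)"
      unfolding Z_def by (rule nn_integral_blocks[symmetric]) measurable
    also have "\<dots> \<le> ?A" by (intro nn_integral_mono) (auto split: split_indicator)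
    finally show ?thesis .
  qed
  have \<Phi>_meas: "?P \<in> borel_measurable borel"
    by (rule pos_distribution.\<Phi>_measurable[OF pos_distribution_\<nu>])
  have "(\<integral>\<^sup>+x. ?P x epowr r * rho v x epowr r \<partial>\<nu>) = (\<Sum>k. \<beta> k * (?P (t k) epowr r * rho v (t k) epowr r))"
    by (rule nn_integral_\<nu>)
       (intro borel_measurable_times_ennreal measurable_compose[OF \<Phi>_meas epowr_measurable] measurable_compose[OF rho_measurable epowr_measurable])
  also have "\<dots> \<le> (\<Sum>k. 4 epowr r * (2 * E (Suc k) + E (Suc (Suc k)) + 2 epowr (r + 1) * Z (Suc k)))"
    by (intro suminf_le term_le) auto
  also have "\<dots> = 4 epowr r * (2 * (\<Sum>k. E (Suc k)) + (\<Sum>k. E (Suc (Suc k))) + 2 epowr (r + 1) * (\<Sum>k. Z (Suc k)))"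
    by (simp add: suminf_add[symmetric])
  also have "\<dots> \<le> 4 epowr r * (2 * (\<Sum>k. E k) + (\<Sum>k. E k) + 2 epowr (r + 1) * ?A)"
    by (intro mult_left_mono add_mono E1 Z) auto
  also have "\<dots> \<le> 4 epowr r * (3 * (2 epowr (1 + r) * ?Q) + 2 epowr (r + 1) * ?A)"
  proof (intro mult_left_mono add_right_mono)
    have "2 * (\<Sum>k. E k) + (\<Sum>k. E k) = 3 * (\<Sum>k. E k)"
      using distrib_right[of 2 1 "\<Sum>k. E k"] by simp
    also have "\<dots> \<le> 3 * (2 epowr (1 + r) * ?Q)" by (intro mult_left_mono E) auto
    finally show "2 * (\<Sum>k. E k) + (\<Sum>k. E k) \<le> 3 * (2 epowr (1 + r) * ?Q)" .
  qed auto
  also have "\<dots> \<le> sum_const * (?Q + ?A)"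
  proof -
    let ?a = "3 * 2 epowr (1 + r)" and ?b = "2 epowr (r + 1) :: ennreal"
    have "?a * ?Q + ?b * ?A \<le> (?a + ?b) * ?Q + (?a + ?b) * ?A"
      by (intro add_mono mult_right_mono) (auto simp: add_increasing)
    then have "4 epowr r * (?a * ?Q + ?b * ?A) \<le> 4 epowr r * ((?a + ?b) * ?Q + (?a + ?b) * ?A)"
      by (intro mult_left_mono) auto
    then show ?thesis by (simp only: sum_const_def distrib_left distrib_right mult.assoc)
  qed
  finally show ?thesis .
qed

text \<open>The atomic sum is \<open>Hardy_less1\<close> for \<nu>. In the local sum
  \<open>\<omega> k * B (t k) epowr q\<close> is the power 1 - q of
  \<open>\<omega> k epowr (1 + r) * B (t k) epowr r\<close>, so Hoelder's inequality for sums
  separates the costs from the terms belonging to Q.\<close>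

lemma upper_less1_blocks:
  assumes q1: "q < 1" and h: "h \<in> Mplus" "I h < top"
    and Q: "Q = (\<integral>\<^sup>+y. W y epowr r * B y epowr r * w y \<partial>Lpos)" "Q < top"
    and A: "A = (\<integral>\<^sup>+y. phi y epowr r * sig y * w y \<partial>Lpos)" "A < top"
  shows "(\<integral>\<^sup>+y. loc h y epowr p * w y * indicator {0<..t 0} y \<partial>Lpos) \<le>
    2 * upper_const * (I h epowr q * ((2 epowr (r + 2) * sum_const + 2 epowr (1 + r)) * (Q + A)) epowr (1 - q))"
proof -
  note rf = r_facts[OF q1]
  let ?c = "2 epowr (r + 2) * sum_const + 2 epowr (1 + r)"
  let ?R = "I h epowr q * (?c * (Q + A)) epowr (1 - q)"
  \<comment> \<open>B is non-increasing, so \<open>B (t k) = \<infinity>\<close> would make the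
    integrand of Q infinite on \<open>J k\<close>, a block of positive mass.\<close>
  have fin: "B (t k) < top" for k
  proof (rule ccontr)
    assume "\<not> B (t k) < top"
    then have top: "B (t k) = top" by (simp add: less_top[symmetric])
    have "(\<omega> (Suc k) epowr r * B (t k) epowr r) * \<omega> (Suc k) \<le> (\<integral>\<^sup>+y. W y epowr r * B y epowr r * w y * indicator (J k) y \<partial>Lpos)"
      using rf(1) t_pos[of "Suc k"] by (intro block_ge mult_mono epowr_mono integ_mono B_antimono) (auto simp: J_def)
    also have "\<dots> \<le> Q" unfolding Q(1) by (intro nn_integral_mono) (auto split: split_indicator)
    finally have "(\<omega> (Suc k) epowr r * B (t k) epowr r) * \<omega> (Suc k) < top" using Q(2) by (rule le_less_trans)
    moreover have "\<omega> (Suc k) \<noteq> 0" using \<omega>_bounds(1)[of "Suc k"] by simp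
    ultimately show False using top rf(1) by (simp add: ennreal_mult_top ennreal_top_mult)
  qed
  let ?D = "\<integral>\<^sup>+x. \<Phi>\<nu> x epowr r * rho v x epowr r \<partial>\<nu>"
  have D: "?D \<le> sum_const * (Q + A)" unfolding Q(1) A(1) by (rule sum_\<beta>_\<Phi>_rho_le[OF q1 fin])
  have "sum_const < top"
    using rf(1)  by (auto simp: sum_const_def ennreal_mult_less_top intro!: epowr_less_top)
  then have "sum_const * (Q + A) < top" using Q(2) A(2) by (simp add: ennreal_mult_less_top)
  with D have D_fin: "?D < top" by (rule le_less_trans)
  have "(\<Sum>k. \<beta> k * tail h (t k) epowr q) = (\<integral>\<^sup>+x. tail h x epowr q \<partial>\<nu>)"
    by (rule nn_integral_\<nu>[symmetric]) measurable
  also have "\<dots> \<le> I h epowr q * (2 epowr (r + 2) * ?D) epowr (1 - q)"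
    by (rule pos_distribution.Hardy_less1[OF pos_distribution_\<nu> h(1) v q q1 r_def D_fin])
       (rule h(2))
  also have "\<dots> \<le> ?R"
  proof (intro mult_left_mono epowr_mono)
    have "2 epowr (r + 2) * ?D \<le> 2 epowr (r + 2) * (sum_const * (Q + A))" by (intro mult_left_mono D) auto
    also have "\<dots> \<le> ?c * (Q + A)" unfolding mult.assoc[symmetric] by (intro mult_right_mono) auto
    finally show "2 epowr (r + 2) * ?D \<le> ?c * (Q + A)" .
  qed (use q1 in auto)
  finally have 1: "(\<Sum>k. \<beta> k * tail h (t k) epowr q) \<le> ?R" .
  define g where "g k = \<omega> k epowr (1 + r) * B (t k) epowr r" for k
  have "(\<Sum>k. \<omega> k * loc (hk h k) (t k) epowr p) \<le> (\<Sum>k. I (hk h k) epowr q * g k epowr (1 - q))"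
  proof (intro suminf_le)
    fix k
    have "\<omega> k * loc (hk h k) (t k) epowr p \<le> \<omega> k * (B (t k) * I (hk h k)) epowr q"
      by (intro mult_left_mono loc_hk_le fin h) auto
    also have "\<dots> = I (hk h k) epowr q * (\<omega> k * B (t k) epowr q)"
      using q by (simp add: epowr_mult ac_simps)
    also have "\<omega> k * B (t k) epowr q = g k epowr (1 - q)"
      unfolding g_def using q1 rf(5,6) by (simp add: epowr_mult epowr_epowr)
    finally show "\<omega> k * loc (hk h k) (t k) epowr p \<le> I (hk h k) epowr q * g k epowr (1 - q)" .
  qed auto
  also have "\<dots> \<le> (\<Sum>k. I (hk h k)) epowr q * (\<Sum>k. g k) epowr (1 - q)" by (rule suminf_Holder[OF q q1])
  also have "\<dots> \<le> ?R"
  proof (intro mult_mono epowr_mono sum_I_hk_le h)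
    have "(\<Sum>k. g k) \<le> 2 epowr (1 + r) * Q"
      unfolding Q(1) g_def by (rule sum_B_le_nn_integral[OF q1])
    also have "\<dots> \<le> ?c * (Q + A)" unfolding mult.assoc[symmetric] by (intro mult_mono) (auto simp: add_increasing add_increasing2)
    finally show "(\<Sum>k. g k) \<le> ?c * (Q + A)" .
  qed (use q q1 in auto)
  finally have 2: "(\<Sum>k. \<omega> k * loc (hk h k) (t k) epowr p) \<le> ?R" .
  have "(\<integral>\<^sup>+y. loc h y epowr p * w y * indicator {0<..t 0} y \<partial>Lpos) \<le> upper_const * (?R + ?R)"
    by (intro order_trans[OF sum_loc_le[OF h(1)]] mult_left_mono add_mono 1 2) auto
  also have "\<dots> = 2 * upper_const * ?R" by (simp only: mult_2[symmetric] ac_simps)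
  finally show ?thesis .
qed

end

section \<open>Upper bounds on the whole half-line\<close>

context weights
begin

lemma upper_ge1:
  assumes q1: "1 \<le> q" and h: "h \<in> Mplus" "I h < top"
    and A: "A < top" "AE y in Lpos. phi y epowr (1 / q) * inverse (v y) \<le> A"
    and S: "S < top" "\<And>t. 0 < t \<Longrightarrow> W t epowr (1 / q) * B t \<le> S"
  shows "N h epowr (1 / q) \<le> upper_ge1_const * (A + S) * I h"
proof -
  let ?c = "2 * 2 epowr (1 / q) + 1"
  have "N h \<le> 2 * upper_const * (?c * (A + S) * I h) epowr q"
  proof (rule N_exhaust_le)
    fix X assume "0 < X" "W X < top"
    then obtain t where t: "t 0 = X" "blocks m q u w v t" using blocks_exist by blast
    interpret blocks m q u w v t by fact
    show "(\<integral>\<^sup>+y. loc h y epowr p * w y * indicator {0<..X} y \<partial>Lpos) \<le> 2 * upper_const * (?c * (A + S) * I h) epowr q"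
      using upper_ge1_blocks[OF q1 h A S] t by simp
  qed
  then have "N h epowr (1 / q) \<le> (2 * upper_const * (?c * (A + S) * I h) epowr q) epowr (1 / q)"
    using q by (intro epowr_mono) auto
  also have "\<dots> = (2 * upper_const) epowr (1 / q) * (?c * (A + S) * I h)"
    using q by (subst epowr_mult) (auto simp: epowr_epowr)
  finally show ?thesis by (simp add: upper_ge1_const_def mult.assoc)
qed

lemma upper_less1:
  assumes q1: "q < 1" and h: "h \<in> Mplus" "I h < top"
    and Q: "Q = (\<integral>\<^sup>+y. W y epowr r * B y epowr r * w y \<partial>Lpos)" "Q < top"
    and A: "A = (\<integral>\<^sup>+y. phi y epowr r * sig y * w y \<partial>Lpos)" "A < top"
  shows "N h epowr (1 / q) \<le> upper_less1_const * (A epowr (1 / r) + Q epowr (1 / r)) * I h"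
proof -
  note rf = r_facts[OF q1]
  let ?c = "2 epowr (r + 2) * sum_const + 2 epowr (1 + r)"
  have "N h \<le> 2 * upper_const * (I h epowr q * (?c * (Q + A)) epowr (1 - q))"
  proof (rule N_exhaust_le)
    fix X assume "0 < X" "W X < top"
    then obtain t where t: "t 0 = X" "blocks m q u w v t" using blocks_exist by blast
    interpret blocks m q u w v t by fact
    show "(\<integral>\<^sup>+y. loc h y epowr p * w y * indicator {0<..X} y \<partial>Lpos) \<le> 2 * upper_const * (I h epowr q * (?c * (Q + A)) epowr (1 - q))"
      using upper_less1_blocks[OF q1 h Q A] t by simp
  qed
  then have "N h epowr (1 / q) \<le> (2 * upper_const * (I h epowr q * (?c * (Q + A)) epowr (1 - q))) epowr (1 / q)"
    using q by (intro epowr_mono) auto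
  also have "\<dots> = (2 * upper_const) epowr (1 / q) * (I h * (?c epowr (1 / r) * (Q + A) epowr (1 / r)))"
  proof -
    have "(1 - q) * (1 / q) = 1 / r" using q q1 by (simp add: r_def)
    then show ?thesis using q rf(1) by (simp only: epowr_mult epowr_epowr less_imp_le divide_nonneg_nonneg zero_le_one) simp
  qed
  also have "\<dots> \<le> (2 * upper_const) epowr (1 / q) * (I h * (?c epowr (1 / r) * (2 epowr (1 / r) * (A epowr (1 / r) + Q epowr (1 / r)))))"
    using rf(1) by (subst add.commute[of Q A], intro mult_left_mono epowr_add_le) auto
  also have "\<dots> = upper_less1_const * (A epowr (1 / r) + Q epowr (1 / r)) * I h"
    by (simp only: upper_less1_const_def ac_simps)
  finally show ?thesis .
qed

end

section \<open>The four cases\<close>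

text \<open>Measurability is assumed of f alone, so the constant is moved to that side by dividing
  by c.\<close>

lemma nn_integral_le_cmult:
  assumes f: "f \<in> borel_measurable M" and c: "c < top" and le: "\<And>x. x \<in> space M \<Longrightarrow> f x \<le> c * g x"
  shows "(\<integral>\<^sup>+x. f x \<partial>M) \<le> c * (\<integral>\<^sup>+x. g x \<partial>M)"
proof (cases "c = 0")
  case True
  then have "(\<integral>\<^sup>+x. f x \<partial>M) = (\<integral>\<^sup>+x. 0 \<partial>M)" using le by (intro nn_integral_cong) simp
  then show ?thesis by simp
next
  case False
  have inv: "c * inverse c = 1" using False c by (intro ennreal_divide_self[unfolded divide_ennreal_def]) auto
  have "(\<integral>\<^sup>+x. f x \<partial>M) = (\<integral>\<^sup>+x. c * (inverse c * f x) \<partial>M)" by (simp add: mult.assoc[symmetric] inv)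
  also have "\<dots> = c * (\<integral>\<^sup>+x. inverse c * f x \<partial>M)" using f by (intro nn_integral_cmult) measurable
  also have "\<dots> \<le> c * (\<integral>\<^sup>+x. g x \<partial>M)"
  proof (intro mult_left_mono nn_integral_mono)
    fix x assume "x \<in> space M"
    then have "inverse c * f x \<le> inverse c * (c * g x)" by (intro mult_left_mono le) auto
    also have "\<dots> = g x" using inv by (simp add: mult.assoc[symmetric] mult.commute[of "inverse c"])
    finally show "inverse c * f x \<le> g x" .
  qed simp
  finally show ?thesis .
qed

context exponents
begin

lemma conj_exp_eq: "conj_exp q = - r"
  unfolding conj_exp_def r_def by (metis minus_diff_eq minus_divide_right)

text \<open>For m \<ge> 1 this is the constant of \<open>Hardy_ge1\<close> after the m-th root. For
  m < 1 the two comparisons of B with \<open>local_const\<close> give 2 to the power 1 + 2 (1 - m) /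
  m and 8 to the power 1 / m; the latter exponent is the smaller one, so one number serves
  both.\<close>

definition local_factor :: ennreal where
  "local_factor = (if 1 \<le> m then 2 else 8 epowr (1 + 2 * (1 - m) / m))"

abbreviation "\<kappa> \<equiv> local_factor"

lemma local_factor: "1 \<le> \<kappa>" "\<kappa> < top"
proof -
  have "1 epowr (1 + 2 * (1 - m) / m) \<le> 8 epowr (1 + 2 * (1 - m) / m)" if "m < 1"
    using m that by (intro epowr_mono) auto
  then show "1 \<le> \<kappa>" by (auto simp: local_factor_def)
  show "\<kappa> < top" using m by (auto simp: local_factor_def)
qed

lemma le_local_factor_mult: "x \<le> \<kappa> * x"
  using mult_right_mono[OF local_factor(1), of x] by simp

definition lower_less1_const :: ennreal where
  "lower_less1_const = lowerA_const epowr (1 / r) + \<kappa> * (2 epowr r * 2 epowr (1 + r)) epowr (1 / r)"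

lemma lower_less1_const_finite: "q < 1 \<Longrightarrow> lower_less1_const < top"
  using r_facts(1) local_factor(2) absorb_const(2)[OF p] p q
  by (auto simp: lower_less1_const_def lowerA_const_def ennreal_mult_less_top intro!: epowr_less_top)

end

section \<open>The inner constant in closed form\<close>

context weights
begin

text \<open>The Hardy condition for the measure u on (t, \<infinity>): a supremum for m \<ge> 1 and
  an integral for m < 1, with m in the role of q and m / (1 - m) in that of r.\<close>

definition local_const :: "real \<Rightarrow> ennreal" where
  "local_const t =
     (if 1 \<le> m then esssup_from t (\<lambda>z. U t z epowr (1 / m) * inverse (v z))
      else tail (\<lambda>z. U t z epowr (m / (1 - m)) * u z * rho v z epowr (m / (1 - m))) t epowr ((1 - m) / m))"

lemma pos_distribution_u: "0 < t \<Longrightarrow> pos_distribution (dens u t)"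
  by (intro pos_distribution_dens U_finite) auto

lemma \<Phi>_dens: "0 < t \<Longrightarrow> pos_distribution.\<Phi> (dens u t) = U t"
  by (rule ext) (simp add: pos_distribution.\<Phi>_def[OF pos_distribution_u] emeasure_dens)

lemma local_const_less1:
  assumes "m < 1" "0 < t"
  shows "local_const t = (\<integral>\<^sup>+x. U t x epowr (m / (1 - m)) * rho v x epowr (m / (1 - m)) \<partial>dens u t) epowr ((1 - m) / m)"
proof -
  have "(\<integral>\<^sup>+x. U t x epowr (m / (1 - m)) * rho v x epowr (m / (1 - m)) \<partial>dens u t)
    = tail (\<lambda>z. U t z epowr (m / (1 - m)) * u z * rho v z epowr (m / (1 - m))) t"
    unfolding tail_def
  proof (subst nn_integral_dens)
    show "(\<lambda>x. U t x epowr (m / (1 - m)) * rho v x epowr (m / (1 - m))) \<in> borel_measurable borel"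
      using pos_distribution.\<Phi>_measurable[OF pos_distribution_u[OF assms(2)]] \<Phi>_dens[OF assms(2)] by simp
  qed (auto intro!: nn_integral_cong simp: ac_simps)
  then show ?thesis using assms by (simp add: local_const_def)
qed

lemma local_integrand_Mplus: "0 \<le> t \<Longrightarrow> (\<lambda>z. U t z epowr (1 / m) * inverse (v z)) \<in> Mplus"
  unfolding Mplus_def
  by (intro borel_measurable_times_ennreal borel_measurable_inverse_ennreal meas
      measurable_compose[OF integ_measurable_right epowr_measurable])

lemma AE_le_local_const: assumes "1 \<le> m" "0 < t"
  shows "AE z in Lpos. t < z \<longrightarrow> U t z epowr (1 / m) * inverse (v z) \<le> local_const t"
  using assms esssup_AE[of "\<lambda>z. U t z epowr (1 / m) * inverse (v z)" "lebesgue_on {t<..}"]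
  unfolding AE_from_iff[OF less_imp_le[OF assms(2)]] by (simp only: local_const_def esssup_from_def if_True)

text \<open>Sufficiency in Hardy's inequality for \<open>dens u t\<close> and exponent m.\<close>

lemma B_le_local_const:
  assumes t: "0 < t"
  shows "B t \<le> \<kappa> * local_const t"
proof (cases "local_const t = top")
  case True
  then show ?thesis using local_factor(1) by (auto simp: ennreal_mult_top)
next
  case False
  then have fin: "local_const t < top" by (simp add: less_top)
  show ?thesis unfolding B_def
  proof (rule SUP_ratio_le, cases "1 \<le> m")
    case True
    fix h assume h: "h \<in> Mplus" "I h < top"
    have "(\<integral>\<^sup>+x. tail h x epowr m \<partial>dens u t) \<le> 2 epowr m * (local_const t * I h) epowr m"
    proof (rule pos_distribution.Hardy_ge1[OF pos_distribution_u[OF t] h(1) v True fin])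
      show "AE y in Lpos. pos_distribution.\<Phi> (dens u t) y epowr (1 / m) * inverse (v y) \<le> local_const t"
        unfolding \<Phi>_dens[OF t] using AE_le_local_const[OF True t]
      proof (rule eventually_mono)
        fix y assume "t < y \<longrightarrow> U t y epowr (1 / m) * inverse (v y) \<le> local_const t"
        then show "U t y epowr (1 / m) * inverse (v y) \<le> local_const t"
          using t m by (cases "t < y") (auto simp: integ_empty)
      qed
    qed (rule h(2))
    then have "loc h t \<le> (2 * local_const t * I h) epowr m"
      using m by (simp add: nn_integral_tail_dens epowr_mult mult.assoc)
    then show "loc h t epowr (1 / m) \<le> \<kappa> * local_const t * I h"
      using m True epowr_le_swap[of "1 / m" "loc h t"] by (simp add: local_factor_def)
  next
    case False
    fix h assume h: "h \<in> Mplus" "I h < top"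
    define s where "s = m / (1 - m)"
    have s: "0 < s" "(s + 2) * (1 - m) / m = 1 + 2 * (1 - m) / m" using m False by (auto simp: s_def field_simps)
    define D where "D = (\<integral>\<^sup>+x. U t x epowr s * rho v x epowr s \<partial>dens u t)"
    have BD: "local_const t = D epowr ((1 - m) / m)" unfolding D_def s_def using local_const_less1[OF _ t] False by simp
    have "D epowr ((1 - m) / m) \<noteq> top" using fin BD by simp
    then have D: "D < top" using m False by (simp add: less_top)
    have "(\<integral>\<^sup>+x. tail h x epowr m \<partial>dens u t) \<le> I h epowr m * (2 epowr (s + 2) * D) epowr (1 - m)"
      unfolding D_def \<Phi>_dens[OF t, symmetric]
      by (rule pos_distribution.Hardy_less1[OF pos_distribution_u[OF t] h(1) v m _ s_def])
         (use False h D in \<open>auto simp: D_def \<Phi>_dens[OF t]\<close>)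
    then have "loc h t epowr (1 / m) \<le> (I h epowr m * (2 epowr (s + 2) * D) epowr (1 - m)) epowr (1 / m)"
      unfolding nn_integral_tail_dens using m by (intro epowr_mono) auto
    also have "\<dots> = I h * (2 epowr (1 + 2 * (1 - m) / m) * local_const t)"
      using m False s by (simp add: epowr_mult epowr_epowr BD)
    also have "\<dots> \<le> I h * (\<kappa> * local_const t)"
      using m False by (intro mult_left_mono mult_right_mono) (auto simp: local_factor_def intro!: epowr_mono)
    finally show "loc h t epowr (1 / m) \<le> \<kappa> * local_const t * I h" by (simp add: ac_simps)
  qed
qed

text \<open>Necessity: for m \<ge> 1 unit masses just beyond z suffice, for m < 1 the dyadic level
  argument is applied to \<open>dens u t\<close>.\<close>

lemma local_const_le_B:
  assumes t: "0 < t"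
  shows "local_const t \<le> \<kappa> * B t"
proof (cases "B t = top")
  case True
  then show ?thesis using local_factor(1) by (auto simp: ennreal_mult_top)
next
  case False
  then have fin: "B t < top" by (simp add: less_top)
  show ?thesis
  proof (cases "1 \<le> m")
    case True
    have "local_const t = esssup (lebesgue_on {t<..}) (\<lambda>z. U t z epowr (1 / m) * inverse (v z))"
      using True by (simp add: local_const_def esssup_from_def)
    also have "\<dots> \<le> B t"
    proof (rule esssup_I)
      show "(\<lambda>z. U t z epowr (1 / m) * inverse (v z)) \<in> borel_measurable (lebesgue_on {t<..})"
        using t by (intro measurable_from local_integrand_Mplus) auto
      show "AE z in lebesgue_on {t<..}. U t z epowr (1 / m) * inverse (v z) \<le> B t"
        unfolding AE_from_iff[OF less_imp_le[OF t]] using AE_inverse_le_rho[of v]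
      proof (rule eventually_mono, intro impI)
        fix z assume z: "inverse (v z) \<le> rho v z" "t < z"
        then have "U t z epowr (1 / m) * inverse (v z) \<le> U t z epowr (1 / m) * rho v z" by (intro mult_left_mono) auto
        also have "\<dots> \<le> B t" using z t fin by (intro U_rho_le_B) auto
        finally show "U t z epowr (1 / m) * inverse (v z) \<le> B t" .
      qed
    qed
    also have "\<dots> \<le> \<kappa> * B t" by (rule le_local_factor_mult)
    finally show ?thesis .
  next
    case False
    define s where "s = m / (1 - m)"
    have s: "0 < s" "(1 + s) * (1 - m) / m = 1 / m" "s * (1 - m) / m = 1" using m False by (auto simp: s_def field_simps)
    have "(\<integral>\<^sup>+x. U t x epowr s * rho v x epowr s \<partial>dens u t) \<le> 8 epowr (1 + s) * B t epowr s"
      unfolding \<Phi>_dens[OF t, symmetric]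
    proof (rule pos_distribution.Hardy_less1_necessary[OF pos_distribution_u[OF t] v m _ s_def fin])
      fix h assume "h \<in> Mplus" "I h < top"
      then show "(\<integral>\<^sup>+x. tail h x epowr m \<partial>dens u t) \<le> (B t * I h) epowr m"
        using loc_le_B[OF fin, of h] m epowr_le_swap[of "1 / m" "loc h t"] by (simp add: nn_integral_tail_dens)
    qed (use False in simp)
    then have "local_const t \<le> (8 epowr (1 + s) * B t epowr s) epowr ((1 - m) / m)"
      unfolding s_def local_const_less1[OF False[unfolded not_le] t] using m False by (intro epowr_mono) auto
    also have "\<dots> = 8 epowr (1 / m) * B t" using m False s by (simp add: epowr_mult epowr_epowr)
    also have "\<dots> \<le> \<kappa> * B t"
    proof (intro mult_right_mono)
      have "ennreal (8 powr (1 / m)) \<le> ennreal (8 powr (1 + 2 * (1 - m) / m))"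
        using m False by (intro ennreal_leI powr_mono) (auto simp: field_simps)
      then show "8 epowr (1 / m) \<le> \<kappa>"
        using False epowr_ennreal[of 8] by (simp add: local_factor_def)
    qed simp
    finally show ?thesis .
  qed
qed

section \<open>Rewriting the quantities of the statement\<close>

lemma lhs_norm_eq: "lhs_norm m q u w h = N h epowr (1 / q)"
proof -
  have "integ_inf (\<lambda>s. integ_inf h s epowr m * u s) t = loc h t" if "0 < t" for t
  proof -
    have "integ_inf (\<lambda>s. integ_inf h s epowr m * u s) t = tail (\<lambda>s. integ_inf h s epowr m * u s) t"
      using that by (simp add: integ_inf_eq_tail)
    also have "\<dots> = loc h t" unfolding loc_def by (intro tail_cong) (simp add: integ_inf_eq_tail)
    finally show ?thesis .
  qed
  then show ?thesis unfolding lhs_norm_def N_def integ_inf_0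
    by (intro arg_cong[where f = "\<lambda>x. x epowr (1 / q)"] nn_integral_cong) simp
qed

lemma opt_const_eq: "opt_const m q u w v = C"
  by (simp add: opt_const_def C_def lhs_norm_eq rhs_norm_def cost_def integ_inf_0)

lemma phi_eq: "integ (\<lambda>s. w s * U s t epowr (q / m)) 0 t = phi t"
  unfolding phi_def by (simp add: mult.commute)

lemma A1_eq: "A1 m q u w v = esssup Lpos (\<lambda>y. phi y epowr (1 / q) * inverse (v y))"
  unfolding A1_def phi_eq esssup_from_def by (simp add: divide_ennreal_def)

lemma A1_integrand: "(\<lambda>y. phi y epowr (1 / q) * inverse (v y)) \<in> borel_measurable Lpos"
  by measurable

lemma AE_phi_le_A1: "AE y in Lpos. phi y epowr (1 / q) * inverse (v y) \<le> A1 m q u w v"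
  unfolding A1_eq by (rule esssup_AE)

lemma esssup_from_v:
  assumes "0 < s" "0 \<le> z"
  shows "esssup_from z (\<lambda>y. v y epowr - s) = rho v z epowr s"
proof -
  have "(\<lambda>y. v y epowr - s) = (\<lambda>y. inverse (v y) epowr s)" by (simp add: epowr_minus inverse_epowr)
  moreover have "(\<lambda>y. inverse (v y)) \<in> borel_measurable (lebesgue_on {z<..})"
    using measurable_from[OF v assms(2)] by (rule borel_measurable_inverse_ennreal)
  ultimately show ?thesis unfolding esssup_from_def rho_def using assms(1) by (simp add: esssup_epowr)
qed

lemma local_const_eq:
  assumes "m < 1" "0 < t"
  shows "integ_inf (\<lambda>z. U t z epowr (m / (1 - m)) * u z * esssup_from z (\<lambda>y. v y epowr (- m / (1 - m)))) t
    epowr ((1 - m) / m) = local_const t"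
proof -
  have s: "0 < m / (1 - m)" "- m / (1 - m) = - (m / (1 - m))" using assms m by auto
  have "integ_inf (\<lambda>z. U t z epowr (m / (1 - m)) * u z * esssup_from z (\<lambda>y. v y epowr (- m / (1 - m)))) t =
     tail (\<lambda>z. U t z epowr (m / (1 - m)) * u z * rho v z epowr (m / (1 - m))) t"
    unfolding integ_inf_eq_tail[OF less_imp_le[OF assms(2)]] s(2) using s(1)
    by (intro tail_cong) (simp add: esssup_from_v)
  then show ?thesis using assms by (simp add: local_const_def)
qed

lemma A4_eq: "m < 1 \<Longrightarrow> A4 m q u w v = (SUP t\<in>{0<..}. W t epowr (1 / q) * local_const t)"
  unfolding A4_def by (intro SUP_cong refl) (simp only: local_const_eq greaterThan_iff)

lemma A3_eq: "A3 m q u w v = (\<integral>\<^sup>+y. phi y epowr r * sig y * w y \<partial>Lpos) epowr (1 / r)"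
proof -
  have "(\<lambda>z. U t z epowr p * v z epowr - r) = (\<lambda>z. U t z epowr p * inverse (v z) epowr r)" for t
    by (simp add: epowr_minus inverse_epowr)
  then show ?thesis
    unfolding A3_def Let_def conj_exp_eq phi_eq integ_inf_0 sig_def[symmetric]
    by (simp add: sig_def mult.assoc mult.commute[of "w _"])
qed

lemma A2_eq:
  assumes "1 \<le> m" "q < 1"
  shows "A2 m q u w v = (\<integral>\<^sup>+y. W y epowr r * local_const y epowr r * w y \<partial>Lpos) epowr (1 / r)"
proof -
  have r0: "0 < r" by (rule r_facts(1)[OF assms(2)])
  have "esssup_from t (\<lambda>z. U t z epowr (r / m) * v z epowr - r) = local_const t epowr r" if t: "0 < t" for t
  proof -
    have "(\<lambda>z. U t z epowr (r / m) * v z epowr - r) = (\<lambda>z. (U t z epowr (1 / m) * inverse (v z)) epowr r)"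
      using r0 by (simp add: epowr_mult epowr_epowr epowr_minus inverse_epowr)
    then show ?thesis
      unfolding esssup_from_def local_const_def
      using assms(1) esssup_epowr[OF measurable_from[OF local_integrand_Mplus] r0] t by simp
  qed
  then have "(\<integral>\<^sup>+t. W t epowr r * w t * esssup_from t (\<lambda>z. U t z epowr (r / m) * v z epowr - r) \<partial>Lpos) =
     (\<integral>\<^sup>+y. W y epowr r * local_const y epowr r * w y \<partial>Lpos)"
    by (intro nn_integral_cong) (simp add: ac_simps)
  then show ?thesis unfolding A2_def Let_def conj_exp_eq integ_inf_0 by simp
qed

lemma A5_eq:
  assumes "m < 1" "q < 1"
  shows "A5 m q u w v = (\<integral>\<^sup>+y. W y epowr r * local_const y epowr r * w y \<partial>Lpos) epowr (1 / r)"
proof -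
  have e: "- (- r * (1 - m)) / m = (1 - m) / m * r" by simp
  have "(\<integral>\<^sup>+t. W t epowr r * w t * (integ_inf (\<lambda>z. U t z epowr (m / (1 - m)) * u z *
      esssup_from z (\<lambda>y. v y epowr (- m / (1 - m)))) t) epowr ((1 - m) / m * r) \<partial>Lpos) =
     (\<integral>\<^sup>+y. W y epowr r * local_const y epowr r * w y \<partial>Lpos)"
    unfolding epowr_epowr[symmetric]
    by (intro nn_integral_cong) (simp only: local_const_eq[OF assms(1)] space_Lpos greaterThan_iff, simp only: ac_simps)
  then show ?thesis unfolding A5_def Let_def conj_exp_eq integ_inf_0 e by simp
qed

text \<open>Almost everywhere 1 / v y is at most \<open>rho v y\<close>, and for the latter unit
  masses give the bound.\<close>

lemma A1_le:
  assumes C: "C < top"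
  shows "A1 m q u w v \<le> C"
  unfolding A1_eq
proof (rule esssup_I[OF A1_integrand])
  show "AE y in Lpos. phi y epowr (1 / q) * inverse (v y) \<le> C"
    using AE_inverse_le_rho[of v] AE_space
  proof (rule eventually_elim2)
    fix y assume y: "inverse (v y) \<le> rho v y" "y \<in> space Lpos"
    have "phi y epowr (1 / q) * inverse (v y) \<le> phi y epowr (1 / q) * rho v y"
      using y by (intro mult_left_mono) auto
    also have "\<dots> \<le> C"
      using y by (intro phi_rho_le C) auto
    finally show "phi y epowr (1 / q) * inverse (v y) \<le> C" .
  qed
qed

text \<open>As W t times the p-th power of U t z is at most \<open>phi z\<close>, the local
  condition is contained in \<open>A1\<close>; this is why no second quantity appears for m, q \<ge>
  1. If W t = \<infinity>, then \<open>B t\<close> and \<open>local_const t\<close> are 0.\<close>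

lemma W_local_const_le_A1:
  assumes m1: "1 \<le> m" and t: "0 < t"
  shows "W t epowr (1 / q) * local_const t \<le> A1 m q u w v"
proof (cases "W t = top")
  case True
  then show ?thesis using local_const_le_B[OF t] B_eq_0[OF t] by simp
next
  case False
  have t0: "0 \<le> t" using t by simp
  have "W t epowr (1 / q) * esssup (lebesgue_on {t<..}) (\<lambda>z. U t z epowr (1 / m) * inverse (v z)) \<le> A1 m q u w v"
  proof (rule mult_esssup_le)
    show "(\<lambda>z. U t z epowr (1 / m) * inverse (v z)) \<in> borel_measurable (lebesgue_on {t<..})"
      by (intro measurable_from local_integrand_Mplus t0)
    show "W t epowr (1 / q) < top" using False q by (intro epowr_less_top) (auto simp: less_top)
    show "AE z in lebesgue_on {t<..}. W t epowr (1 / q) * (U t z epowr (1 / m) * inverse (v z)) \<le> A1 m q u w v"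
      unfolding AE_from_iff[OF t0] using AE_phi_le_A1
    proof (rule eventually_mono, intro impI)
      fix z assume z: "phi z epowr (1 / q) * inverse (v z) \<le> A1 m q u w v" "t < z"
      have "W t epowr (1 / q) * U t z epowr (1 / m) = (U t z epowr p * W t) epowr (1 / q)"
        using q p by (simp add: epowr_mult epowr_epowr mult.commute)
      also have "\<dots> \<le> phi z epowr (1 / q)" using t z q by (intro epowr_mono le_phi) auto
      finally have "W t epowr (1 / q) * U t z epowr (1 / m) * inverse (v z) \<le> phi z epowr (1 / q) * inverse (v z)"
        by (intro mult_right_mono) auto
      then show "W t epowr (1 / q) * (U t z epowr (1 / m) * inverse (v z)) \<le> A1 m q u w v"
        using z by (simp add: mult.assoc)
    qed
  qed
  then show ?thesis using m1 by (simp add: local_const_def esssup_from_def)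
qed

lemma opt_const_ge1:
  assumes q1: "1 \<le> q" and S: "\<And>t. 0 < t \<Longrightarrow> W t epowr (1 / q) * local_const t \<le> S"
    and fin: "A1 m q u w v < top" "S < top"
  shows "C \<le> upper_ge1_const * \<kappa> * (A1 m q u w v + S)"
proof -
  have WB: "W t epowr (1 / q) * B t \<le> \<kappa> * S" if t: "0 < t" for t
  proof -
    have "W t epowr (1 / q) * B t \<le> W t epowr (1 / q) * (\<kappa> * local_const t)"
      by (intro mult_left_mono B_le_local_const t) simp
    also have "\<dots> = \<kappa> * (W t epowr (1 / q) * local_const t)" by (simp only: ac_simps)
    also have "\<dots> \<le> \<kappa> * S" by (intro mult_left_mono S t) simp
    finally show ?thesis .
  qed
  have \<kappa>S: "\<kappa> * S < top" using local_factor(2) fin(2) by (simp add: ennreal_mult_less_top)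
  have "C \<le> upper_ge1_const * (A1 m q u w v + \<kappa> * S)"
    unfolding C_def using upper_ge1[OF q1 _ _ fin(1) AE_phi_le_A1 \<kappa>S WB] by (intro SUP_ratio_le) auto
  also have "\<dots> \<le> upper_ge1_const * (\<kappa> * A1 m q u w v + \<kappa> * S)"
    by (intro mult_left_mono add_right_mono le_local_factor_mult) simp
  finally show ?thesis by (simp only: distrib_left mult.assoc)
qed

text \<open>X is \<open>A2\<close> or \<open>A5\<close> according to m; replacing B by
  \<open>local_const\<close> in its integral costs a factor \<kappa> in either direction.\<close>

lemma opt_const_less1:
  assumes q1: "q < 1"
    and X: "X = (\<integral>\<^sup>+y. W y epowr r * local_const y epowr r * w y \<partial>Lpos) epowr (1 / r)"
  shows "A3 m q u w v + X < top \<Longrightarrow> C \<le> upper_less1_const * \<kappa> * (A3 m q u w v + X)"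
    and "C < top \<Longrightarrow> A3 m q u w v + X \<le> lower_less1_const * C"
proof -
  have r0: "0 < r" by (rule r_facts(1)[OF q1])
  have [measurable]: "W \<in> borel_measurable Lpos" by (rule integ_measurable_right) simp
  let ?Q = "\<integral>\<^sup>+y. W y epowr r * B y epowr r * w y \<partial>Lpos"
  let ?L = "\<integral>\<^sup>+y. W y epowr r * local_const y epowr r * w y \<partial>Lpos"
  let ?A = "\<integral>\<^sup>+y. phi y epowr r * sig y * w y \<partial>Lpos"
  have root: "(c * x epowr r) epowr (1 / r) = c epowr (1 / r) * x" "(c epowr r * x) epowr (1 / r) = c * x epowr (1 / r)" for c x
    using r0 by (simp_all add: epowr_mult epowr_epowr)
  have power: "a * x epowr r * b \<le> \<kappa> epowr r * (a * y epowr r * b)" if "x \<le> \<kappa> * y" for a b x y :: ennreal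
  proof -
    have "x epowr r \<le> \<kappa> epowr r * y epowr r" using epowr_mono[OF that, of r] r0 by (simp add: epowr_mult)
    then have "a * x epowr r * b \<le> a * (\<kappa> epowr r * y epowr r) * b" by (intro mult_left_mono mult_right_mono) auto
    then show ?thesis by (simp only: ac_simps)
  qed
  have "?Q \<le> \<kappa> epowr r * ?L"
    using r0 local_factor(2) by (intro nn_integral_le_cmult power B_le_local_const) auto
  then have Q: "?Q epowr (1 / r) \<le> \<kappa> * X"
    unfolding X root(2)[symmetric] using r0 by (intro epowr_mono) auto
  have "?L \<le> (\<integral>\<^sup>+y. \<kappa> epowr r * (W y epowr r * B y epowr r * w y) \<partial>Lpos)"
    by (intro nn_integral_mono power local_const_le_B) auto
  also have "\<dots> = \<kappa> epowr r * ?Q" by (rule nn_integral_cmult) measurable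
  finally have L: "X \<le> \<kappa> * ?Q epowr (1 / r)"
    unfolding X root(2)[symmetric] using r0 by (intro epowr_mono) auto
  show "C \<le> upper_less1_const * \<kappa> * (A3 m q u w v + X)" if fin: "A3 m q u w v + X < top"
  proof -
    have "?A < top" using fin r0 by (auto simp: A3_eq less_top[symmetric])
    moreover have "?Q epowr (1 / r) < top"
      by (rule le_less_trans[OF Q]) (use fin local_factor(2) in \<open>simp add: ennreal_mult_less_top\<close>)
    then have "?Q < top" using r0 by (auto simp: less_top[symmetric])
    ultimately have "C \<le> upper_less1_const * (A3 m q u w v + ?Q epowr (1 / r))"
      unfolding C_def A3_eq by (intro SUP_ratio_le upper_less1[OF q1]) auto
    also have "\<dots> \<le> upper_less1_const * (\<kappa> * A3 m q u w v + \<kappa> * X)"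
      by (intro mult_left_mono add_mono le_local_factor_mult Q) simp
    finally show ?thesis by (simp only: distrib_left mult.assoc)
  qed
  assume C: "C < top"
  have "A3 m q u w v \<le> lowerA_const epowr (1 / r) * C"
    unfolding A3_eq root(1)[symmetric] using r0 by (intro epowr_mono nn_integral_sig_le q1 C) auto
  moreover have "X \<le> \<kappa> * ((2 epowr r * 2 epowr (1 + r)) epowr (1 / r) * C)"
    unfolding root(1)[symmetric] using r0
    by (intro order_trans[OF L] mult_left_mono epowr_mono nn_integral_B_le q1 C) auto
  ultimately show "A3 m q u w v + X \<le> lower_less1_const * C"
    unfolding lower_less1_const_def distrib_right mult.assoc by (rule add_mono)
qed

end

text \<open>An infinite right-hand side makes the inequality trivial because c > 0, so each
  direction may assume finiteness. The 1 added to both constants keeps c positive, and c is fixed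
  before the weights.\<close>

lemma opt_const_equivI:
  assumes mq: "0 < m" "0 < q" and c: "c1 < top" "c2 < top"
    and upper: "\<And>u w v. weights m q u w v \<Longrightarrow> A u w v < top \<Longrightarrow> weights.C m q u w v \<le> c1 * A u w v"
    and lower: "\<And>u w v. weights m q u w v \<Longrightarrow> weights.C m q u w v < top \<Longrightarrow> A u w v \<le> c2 * weights.C m q u w v"
  shows "opt_const_equiv m q A"
proof -
  obtain a b where ab: "0 \<le> a" "c1 = ennreal a" "0 \<le> b" "c2 = ennreal b"
    using c by (cases c1; cases c2) auto
  define c where "c = a + b + 1"
  have c: "0 < c" "c1 \<le> ennreal c" "c2 \<le> ennreal c" using ab by (auto simp: c_def intro!: ennreal_leI)
  have step: "y \<le> ennreal c * x" if "x < top \<Longrightarrow> y \<le> d * x" "d \<le> ennreal c" for x y d :: ennreal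
  proof (cases "x < top")
    case True
    then show ?thesis using that by (meson mult_right_mono order_trans zero_le)
  next
    case False
    then show ?thesis using c(1) by (simp add: less_top[symmetric] ennreal_mult_top)
  qed
  show ?thesis unfolding opt_const_equiv_def
  proof (intro exI[of _ c] conjI ballI impI c(1))
    fix u w v assume "u \<in> Mplus" "w \<in> Mplus" "v \<in> Mplus" "admissible m q u w"
    then have W: "weights m q u w v" using mq by unfold_locales
    show "opt_const m q u w v \<le> ennreal c * A u w v" unfolding weights.opt_const_eq[OF W] by (rule step[OF upper[OF W] c(2)])
    show "A u w v \<le> ennreal c * opt_const m q u w v" unfolding weights.opt_const_eq[OF W] by (rule step[OF lower[OF W] c(3)])
  qed
qed

theorem theorem1p3:
  fixes m q :: real
  assumes "0 < m" and "0 < q"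
  shows "(1 \<le> m \<and> 1 \<le> q \<longrightarrow>
            opt_const_equiv m q (\<lambda>u w v. A1 m q u w v)) \<and>
         (1 \<le> m \<and> q < 1 \<longrightarrow>
            opt_const_equiv m q (\<lambda>u w v. A2 m q u w v + A3 m q u w v)) \<and>
         (m < 1 \<and> 1 \<le> q \<longrightarrow>
            opt_const_equiv m q (\<lambda>u w v. A1 m q u w v + A4 m q u w v)) \<and>
         (m < 1 \<and> q < 1 \<longrightarrow>
            opt_const_equiv m q (\<lambda>u w v. A3 m q u w v + A5 m q u w v))"
proof (intro conjI impI; elim conjE)
  interpret exponents m q using assms by unfold_locales
  note fin = upper_const_finite lower_less1_const_finite local_factor(2)
  {
    assume m1: "1 \<le> m" and q1: "1 \<le> q"
    show "opt_const_equiv m q (\<lambda>u w v. A1 m q u w v)"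
    proof (rule opt_const_equivI[OF m q])
      fix u w v assume "weights m q u w v"
      then interpret weights m q u w v .
      \<comment> \<open>Here S is \<open>A1\<close> itself, so the sum A1 + S accounts for the
        factor 2.\<close>
      show "C \<le> 2 * (upper_ge1_const * \<kappa>) * A1 m q u w v" if "A1 m q u w v < top"
        using opt_const_ge1[OF q1 W_local_const_le_A1[OF m1] that that] by (simp add: mult_2[symmetric] ac_simps)
      show "A1 m q u w v \<le> 1 * C" if "C < top" using A1_le[OF that] by simp
    qed (use fin in \<open>auto simp: ennreal_mult_less_top\<close>)
  next
    assume m1: "1 \<le> m" and q1: "q < 1"
    show "opt_const_equiv m q (\<lambda>u w v. A2 m q u w v + A3 m q u w v)"
    proof (rule opt_const_equivI[OF m q])
      fix u w v assume "weights m q u w v"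
      then interpret weights m q u w v .
      note * = opt_const_less1[OF q1 A2_eq[OF m1 q1], unfolded add.commute[of "A3 m q u w v"]]
      show "C \<le> upper_less1_const * \<kappa> * (A2 m q u w v + A3 m q u w v)" if "A2 m q u w v + A3 m q u w v < top"
        by (rule *(1)[OF that])
      show "A2 m q u w v + A3 m q u w v \<le> lower_less1_const * C" if "C < top" by (rule *(2)[OF that])
    qed (use fin q1 in \<open>auto simp: ennreal_mult_less_top\<close>)
  next
    assume m1: "m < 1" and q1: "1 \<le> q"
    show "opt_const_equiv m q (\<lambda>u w v. A1 m q u w v + A4 m q u w v)"
    proof (rule opt_const_equivI[OF m q])
      fix u w v assume "weights m q u w v"
      then interpret weights m q u w v .
      have S: "W t epowr (1 / q) * local_const t \<le> A4 m q u w v" if "0 < t" for t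
        unfolding A4_eq[OF m1] using that by (intro SUP_upper) auto
      show "C \<le> upper_ge1_const * \<kappa> * (A1 m q u w v + A4 m q u w v)" if "A1 m q u w v + A4 m q u w v < top"
        using that by (intro opt_const_ge1[OF q1 S]) auto
      assume C: "C < top"
      have "W t epowr (1 / q) * local_const t \<le> \<kappa> * C" if "0 < t" for t
      proof -
        have "W t epowr (1 / q) * local_const t \<le> W t epowr (1 / q) * (\<kappa> * B t)"
          by (intro mult_left_mono local_const_le_B that) simp
        also have "\<dots> = \<kappa> * (W t epowr (1 / q) * B t)" by (simp only: ac_simps)
        also have "\<dots> \<le> \<kappa> * C" by (intro mult_left_mono W_B_le) simp
        finally show ?thesis .
      qed
      then have "A4 m q u w v \<le> \<kappa> * C" unfolding A4_eq[OF m1] by (intro SUP_least) auto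
      then show "A1 m q u w v + A4 m q u w v \<le> (1 + \<kappa>) * C"
        using A1_le[OF C] by (simp add: distrib_right add_mono)
    qed (use fin in \<open>auto simp: ennreal_mult_less_top\<close>)
  next
    assume m1: "m < 1" and q1: "q < 1"
    show "opt_const_equiv m q (\<lambda>u w v. A3 m q u w v + A5 m q u w v)"
    proof (rule opt_const_equivI[OF m q])
      fix u w v assume "weights m q u w v"
      then interpret weights m q u w v .
      note * = opt_const_less1[OF q1 A5_eq[OF m1 q1]]
      show "C \<le> upper_less1_const * \<kappa> * (A3 m q u w v + A5 m q u w v)" if "A3 m q u w v + A5 m q u w v < top"
        by (rule *(1)[OF that])
      show "A3 m q u w v + A5 m q u w v \<le> lower_less1_const * C" if "C < top" by (rule *(2)[OF that])
    qed (use fin q1 in \<open>auto simp: ennreal_mult_less_top\<close>)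
  }
qed

end
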